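(* Let $E$ be a subspatial product system over a unital $C^*$-algebra $\mathcal B$ with reference unit $\omega$, and let $\mathcal U=\mathcal U_\omega$ be the maximal continuous set of units containing $\omega$, with its $\mathcal B$-$\mathcal B$ module structure. Then $\mathcal U$ is (algebraically) isomorphic to $\operatorname{ind}(E)\oplus\mathcal B$ as a right $\mathcal B$-module. If $E$ is, in addition, spatial, then $\mathcal U$ is isomorphic to $\operatorname{ind}(E)\oplus\mathcal B$ as a left-right $\mathcal B$-$\mathcal B$ module.
   Context: $\mathcal B$ is a unital $C^*$-algebra with unit $1$; as a summand it carries its canonical bimodule structure. A Hilbert $\mathcal B$-$\mathcal B$ module is a right Hilbert $\mathcal B$-module (inner product $\mathcal B$-valued, linear in the second variable) with a unital left action of $\mathcal B$ by adjointable operators. A product system over $\mathcal B$ is a family $E=(E_t)_{t\ge0}$ of Hilbert $\mathcal B$-$\mathcal B$ modules with $E_0\cong\mathcal B$ and (associative) bilinear unitary isomorphisms $\varphi_{t,s}:E_t\otimes E_s\to E_{t+s}$, where $\otimes$ is the inner tensor product over $\mathcal B$ with $\langle u\otimes v,u_1\otimes v_1\rangle=\langle v,\langle u,u_1\rangle v_1\rangle$; one identifies $E_t\otimes E_s$ with $E_{t+s}$. A unit on $E$ is a family $u=(u_t)_{t\ge0}$, $u_t\in E_t$, with $u_0=1$ and $u_t\otimes u_s=u_{t+s}$. It is unital if $\langle u_t,u_t\rangle=1$ for all $t$, central if $bu_t=u_tb$ for all $b\in\mathcal B$, $t\ge0$. For units $u,v$ put $\mathcal K^{u,v}_t(b)=\langle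 u_t,bv_t\rangle$; these are bounded linear operators on $\mathcal B$ forming a semigroup in $t$. A set $S$ of units is continuous if for all $\xi,\eta\in S$ the semigroup $\mathcal K_t^{\xi,\eta}$ is uniformly continuous (continuous in the norm of $L(\mathcal B)$); then $\mathcal L^{\xi,\eta}=\frac{d}{dt}\mathcal K^{\xi,\eta}_t|_{t=0}\in L(\mathcal B)$ and $\mathcal K^{\xi,\eta}_t=\exp(t\mathcal L^{\xi,\eta})$. A unit $u$ is continuous if $\{u\}$ is continuous. For a continuous unit $\omega$, $\mathcal U_\omega$ is the set of all continuous units $x$ on $E$ such that $\{x,\omega\}$ is a continuous set; it is the maximal continuous set of units containing $\omega$. For $x^1,\dots,x^n\in\mathcal U_\omega$ and $\varkappa_j\in\mathcal B$ with $\sum_j\varkappa_j=1$, $\varkappa_1x^1\boxplus\dots\boxplus\varkappa_nx^n$ denotes the unit $\zeta$ with $\zeta_t=\lim_{m\to\infty}\big(\sum_j\varkappa_jx^j_{t/m}\big)^{\otimes m}$ (norm limit), and $x^1\varkappa_1\boxplus\dots\boxplus x^n\varkappa_n$ the unit obtained from $\sum_jx^j_{t/m}\varkappa_j$ in the same way; it is known that these limits exist and the units belong to $\mathcal U_\omega$. $\mathcal U_\omega$ is a $\mathcal B$-$\mathcal B$ module with $x+y=x\boxplus y\boxplus(-\omega)$, $b\cdot x=bx\boxplus(1-b)\omega$, $x\cdot b=xb\boxplus\omega(1-b)$ and neutral element $\omega$. For $\xi\in\mathcal U_\omega$, $a,c\in\mathcal B$: $\mathcal L^{x+y,\xi}=\mathcal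 L^{x,\xi}+\mathcal L^{y,\xi}-\mathcal L^{\omega,\xi}$, $\mathcal L^{x\cdot a,\xi}(c)=a^*\mathcal L^{x,\xi}(c)+(1-a)^*\mathcal L^{\omega,\xi}(c)$, $\mathcal L^{a\cdot x,\xi}(c)=\mathcal L^{x,\xi}(a^*c)+\mathcal L^{\omega,\xi}((1-a^* )c)$. With $\langle x,y\rangle=(\mathcal L^{x,y}-\mathcal L^{x,\omega}-\mathcal L^{\omega,y}+\mathcal L^{\omega,\omega})(1)$, $N=\{x:\langle x,x\rangle=0\}$ (a submodule) and $x\sim y$ iff $x-y\in N$, the index $\operatorname{ind}(E)=\operatorname{ind}(E,\omega)$ is the completion of the pre-Hilbert $\mathcal B$-$\mathcal B$ module $\mathcal U_\omega/\sim$. A product system is spatial if it contains a central unital unit; it is subspatial if it can be embedded (by fiberwise isometric bilinear maps compatible with the product structure, which we regard as inclusions) into a spatial one. Convention: the reference unit $\omega$ is a continuous unit on $E$; if $E$ is spatial, $\omega$ is taken to be central. *)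

theory Defs
  imports "HOL-Analysis.Analysis" "HOL-Algebra.Ring"
begin

section \<open>Unital C*-algebras\<close>

text \<open>
  The class is built on \<^class>\<open>real_normed_algebra\<close> and \<^class>\<open>monoid_mult\<close> rather than on
  \<^class>\<open>real_normed_algebra_1\<close>, because the latter excludes the zero algebra.
\<close>

class unital_cstar_algebra = real_normed_algebra + monoid_mult + banach +
  fixes scaleC :: "complex \<Rightarrow> 'a \<Rightarrow> 'a" (infixr "*\<^sub>C" 75)
    and adj :: "'a \<Rightarrow> 'a"
  assumes scaleC_add_right: "c *\<^sub>C (x + y) = c *\<^sub>C x + c *\<^sub>C y"
    and scaleC_add_left: "(c + d) *\<^sub>C x = c *\<^sub>C x + d *\<^sub>C x"
    and scaleC_scaleC: "c *\<^sub>C d *\<^sub>C x = (c * d) *\<^sub>C x"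
    and scaleR_eq_scaleC: "r *\<^sub>R x = complex_of_real r *\<^sub>C x"
    and mult_scaleC_left: "(c *\<^sub>C x) * y = c *\<^sub>C (x * y)"
    and mult_scaleC_right: "x * (c *\<^sub>C y) = c *\<^sub>C (x * y)"
    and norm_scaleC: "norm (c *\<^sub>C x) = cmod c * norm x"
    and adj_adj: "adj (adj x) = x"
    and adj_add: "adj (x + y) = adj x + adj y"
    and adj_scaleC: "adj (c *\<^sub>C x) = cnj c *\<^sub>C adj x"
    and adj_mult: "adj (x * y) = adj y * adj x"
    and cstar_identity: "norm (adj x * x) = (norm x)\<^sup>2"

definition positive :: "'b::unital_cstar_algebra \<Rightarrow> bool" where
  "positive a \<longleftrightarrow> (\<exists>c. a = adj c * c)"


section \<open>Modules and Hilbert modules\<close>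

text \<open>
  As for the modules of HOL-Algebra, only the additive part of the underlying
  ring record is meaningful.  The complex scalar multiplication is not a separate field:
  since all actions are unital, \<open>c\<close> acts as the element \<open>c *\<^sub>C 1\<close> of the algebra.
\<close>

record ('b, 'm) hilb_bimod = "'m ring" +
  lact :: "'b \<Rightarrow> 'm \<Rightarrow> 'm"
  ract :: "'m \<Rightarrow> 'b \<Rightarrow> 'm"
  ip :: "'m \<Rightarrow> 'm \<Rightarrow> 'b"

definition mk_bimod ::
  "'m set \<Rightarrow> ('m \<Rightarrow> 'm \<Rightarrow> 'm) \<Rightarrow> 'm \<Rightarrow> ('b \<Rightarrow> 'm \<Rightarrow> 'm) \<Rightarrow> ('m \<Rightarrow> 'b \<Rightarrow> 'm) \<Rightarrow> ('m \<Rightarrow> 'm \<Rightarrow> 'b)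
    \<Rightarrow> ('b, 'm) hilb_bimod" where
  "mk_bimod A p z l r i =
    \<lparr>carrier = A, mult = undefined, one = undefined, zero = z, add = p, lact = l, ract = r, ip = i\<rparr>"

locale right_module = abelian_group M
  for M :: "('b::unital_cstar_algebra, 'm, 'z) hilb_bimod_scheme" (structure) +
  assumes ract_closed: "x \<in> carrier M \<Longrightarrow> ract M x b \<in> carrier M"
    and ract_add_left:
      "x \<in> carrier M \<Longrightarrow> y \<in> carrier M \<Longrightarrow> ract M (x \<oplus> y) b = ract M x b \<oplus> ract M y b"
    and ract_add_right: "x \<in> carrier M \<Longrightarrow> ract M x (a + b) = ract M x a \<oplus> ract M x b"
    and ract_mult: "x \<in> carrier M \<Longrightarrow> ract M x (a * b) = ract M (ract M x a) b"
    and ract_one: "x \<in> carrier M \<Longrightarrow> ract M x 1 = x"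

locale bimodule = right_module +
  assumes lact_closed: "x \<in> carrier M \<Longrightarrow> lact M b x \<in> carrier M"
    and lact_add_right:
      "x \<in> carrier M \<Longrightarrow> y \<in> carrier M \<Longrightarrow> lact M b (x \<oplus> y) = lact M b x \<oplus> lact M b y"
    and lact_add_left: "x \<in> carrier M \<Longrightarrow> lact M (a + b) x = lact M a x \<oplus> lact M b x"
    and lact_mult: "x \<in> carrier M \<Longrightarrow> lact M (a * b) x = lact M a (lact M b x)"
    and lact_one: "x \<in> carrier M \<Longrightarrow> lact M 1 x = x"
    and lact_ract: "x \<in> carrier M \<Longrightarrow> lact M a (ract M x b) = ract M (lact M a x) b"
    and lact_scalar: "x \<in> carrier M \<Longrightarrow> lact M (c *\<^sub>C 1) x = ract M x (c *\<^sub>C 1)"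

definition hnorm :: "('b::unital_cstar_algebra, 'm, 'z) hilb_bimod_scheme \<Rightarrow> 'm \<Rightarrow> real" where
  "hnorm M x = sqrt (norm (ip M x x))"

definition h_tendsto ::
  "('b::unital_cstar_algebra, 'm, 'z) hilb_bimod_scheme \<Rightarrow> (nat \<Rightarrow> 'm) \<Rightarrow> 'm \<Rightarrow> bool" where
  "h_tendsto M f l \<longleftrightarrow> (\<lambda>n. hnorm M (f n \<ominus>\<^bsub>M\<^esub> l)) \<longlonglongrightarrow> 0"

definition h_Cauchy ::
  "('b::unital_cstar_algebra, 'm, 'z) hilb_bimod_scheme \<Rightarrow> (nat \<Rightarrow> 'm) \<Rightarrow> bool" where
  "h_Cauchy M f \<longleftrightarrow> (\<forall>n. f n \<in> carrier M) \<and>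
     (\<forall>e>0. \<exists>N. \<forall>m\<ge>N. \<forall>n\<ge>N. hnorm M (f m \<ominus>\<^bsub>M\<^esub> f n) < e)"

definition h_lim ::
  "('b::unital_cstar_algebra, 'm, 'z) hilb_bimod_scheme \<Rightarrow> (nat \<Rightarrow> 'm) \<Rightarrow> 'm" where
  "h_lim M f = (THE l. l \<in> carrier M \<and> h_tendsto M f l)"

locale pre_hilbert_bimodule = bimodule +
  assumes ip_add_right:
      "x \<in> carrier M \<Longrightarrow> y \<in> carrier M \<Longrightarrow> z \<in> carrier M \<Longrightarrow> ip M x (y \<oplus> z) = ip M x y + ip M x z"
    and ip_ract: "x \<in> carrier M \<Longrightarrow> y \<in> carrier M \<Longrightarrow> ip M x (ract M y b) = ip M x y * b"
    and ip_adj: "x \<in> carrier M \<Longrightarrow> y \<in> carrier M \<Longrightarrow> ip M y x = adj (ip M x y)"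
    and ip_positive: "x \<in> carrier M \<Longrightarrow> positive (ip M x x)"
    and ip_definite: "x \<in> carrier M \<Longrightarrow> ip M x x = 0 \<Longrightarrow> x = \<zero>"
    and ip_lact:
      "x \<in> carrier M \<Longrightarrow> y \<in> carrier M \<Longrightarrow> ip M (lact M b x) y = ip M x (lact M (adj b) y)"

locale hilbert_bimodule = pre_hilbert_bimodule +
  assumes complete: "h_Cauchy M f \<Longrightarrow> \<exists>l\<in>carrier M. h_tendsto M f l"

definition base_bimod :: "('b::unital_cstar_algebra, 'b) hilb_bimod" where
  "base_bimod = mk_bimod UNIV (+) 0 (*) (*) (\<lambda>x y. adj x * y)"

definition direct_sum ::
  "('b::unital_cstar_algebra, 'm) hilb_bimod \<Rightarrow> ('b, 'n) hilb_bimod \<Rightarrow> ('b, 'm \<times> 'n) hilb_bimod" where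
  "direct_sum M N = mk_bimod (carrier M \<times> carrier N)
     (\<lambda>(x, y) (x', y'). (x \<oplus>\<^bsub>M\<^esub> x', y \<oplus>\<^bsub>N\<^esub> y'))
     (\<zero>\<^bsub>M\<^esub>, \<zero>\<^bsub>N\<^esub>)
     (\<lambda>b (x, y). (lact M b x, lact N b y))
     (\<lambda>(x, y) b. (ract M x b, ract N y b))
     (\<lambda>(x, y) (x', y'). ip M x x' + ip N y y')"

definition right_module_isomorphic ::
  "('b::unital_cstar_algebra, 'm) hilb_bimod \<Rightarrow> ('b, 'n) hilb_bimod \<Rightarrow> bool" where
  "right_module_isomorphic M N \<longleftrightarrow> right_module M \<and> right_module N \<and>
     (\<exists>f. bij_betw f (carrier M) (carrier N) \<and>
        (\<forall>x\<in>carrier M. \<forall>y\<in>carrier M. f (x \<oplus>\<^bsub>M\<^esub> y) = f x \<oplus>\<^bsub>N\<^esub> f y) \<and>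
        (\<forall>x\<in>carrier M. \<forall>b. f (ract M x b) = ract N (f x) b))"

definition bimodule_isomorphic ::
  "('b::unital_cstar_algebra, 'm) hilb_bimod \<Rightarrow> ('b, 'n) hilb_bimod \<Rightarrow> bool" where
  "bimodule_isomorphic M N \<longleftrightarrow> bimodule M \<and> bimodule N \<and>
     (\<exists>f. bij_betw f (carrier M) (carrier N) \<and>
        (\<forall>x\<in>carrier M. \<forall>y\<in>carrier M. f (x \<oplus>\<^bsub>M\<^esub> y) = f x \<oplus>\<^bsub>N\<^esub> f y) \<and>
        (\<forall>x\<in>carrier M. \<forall>b. f (ract M x b) = ract N (f x) b) \<and>
        (\<forall>x\<in>carrier M. \<forall>b. f (lact M b x) = lact N b (f x)))"

text \<open>
  Quotient of a semi-inner product module by its submodule \<open>N\<close> of vectors of length zero.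
\<close>

definition length_zero :: "('b::unital_cstar_algebra, 'm) hilb_bimod \<Rightarrow> 'm set" where
  "length_zero M = {x \<in> carrier M. ip M x x = 0}"

definition length_zero_rel :: "('b::unital_cstar_algebra, 'm) hilb_bimod \<Rightarrow> ('m \<times> 'm) set" where
  "length_zero_rel M = {(x, y) \<in> carrier M \<times> carrier M. x \<ominus>\<^bsub>M\<^esub> y \<in> length_zero M}"

definition length_quotient ::
  "('b::unital_cstar_algebra, 'm) hilb_bimod \<Rightarrow> ('b, 'm set) hilb_bimod" where
  "length_quotient M =
    (let cls = (\<lambda>x. length_zero_rel M `` {x}) in
     mk_bimod (carrier M // length_zero_rel M)
       (\<lambda>X Y. \<Union>x\<in>X. \<Union>y\<in>Y. cls (x \<oplus>\<^bsub>M\<^esub> y))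
       (cls \<zero>\<^bsub>M\<^esub>)
       (\<lambda>b X. \<Union>x\<in>X. cls (lact M b x))
       (\<lambda>X b. \<Union>x\<in>X. cls (ract M x b))
       (\<lambda>X Y. the_elem (\<Union>x\<in>X. \<Union>y\<in>Y. {ip M x y})))"

text \<open>
  Completion of a pre-Hilbert module: Cauchy sequences modulo sequences tending to zero.
\<close>

definition null_sequence_rel ::
  "('b::unital_cstar_algebra, 'm) hilb_bimod \<Rightarrow> ((nat \<Rightarrow> 'm) \<times> (nat \<Rightarrow> 'm)) set" where
  "null_sequence_rel M =
     {(f, g). h_Cauchy M f \<and> h_Cauchy M g \<and> (\<lambda>n. hnorm M (f n \<ominus>\<^bsub>M\<^esub> g n)) \<longlonglongrightarrow> 0}"

definition completion ::
  "('b::unital_cstar_algebra, 'm) hilb_bimod \<Rightarrow> ('b, (nat \<Rightarrow> 'm) set) hilb_bimod" where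
  "completion M =
    (let cls = (\<lambda>f. null_sequence_rel M `` {f}) in
     mk_bimod (Collect (h_Cauchy M) // null_sequence_rel M)
       (\<lambda>X Y. \<Union>f\<in>X. \<Union>g\<in>Y. cls (\<lambda>n. f n \<oplus>\<^bsub>M\<^esub> g n))
       (cls (\<lambda>n. \<zero>\<^bsub>M\<^esub>))
       (\<lambda>b X. \<Union>f\<in>X. cls (\<lambda>n. lact M b (f n)))
       (\<lambda>X b. \<Union>f\<in>X. cls (\<lambda>n. ract M (f n) b))
       (\<lambda>X Y. the_elem (\<Union>f\<in>X. \<Union>g\<in>Y. {lim (\<lambda>n. ip M (f n) (g n))})))"


section \<open>Product systems\<close>

text \<open>
  \<open>inner_tensor F G T \<tau>\<close>: the Hilbert bimodule \<open>T\<close> with the elementary tensors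
  \<open>\<tau> u v = u \<otimes> v\<close> is the inner tensor product of \<open>F\<close> and \<open>G\<close>, i.e. it is the closed linear span of
  the elementary tensors, which have the prescribed inner products.
\<close>

definition inner_tensor ::
  "('b::unital_cstar_algebra, 'm) hilb_bimod \<Rightarrow> ('b, 'n) hilb_bimod \<Rightarrow> ('b, 'k) hilb_bimod
    \<Rightarrow> ('m \<Rightarrow> 'n \<Rightarrow> 'k) \<Rightarrow> bool" where
  "inner_tensor F G T \<tau> \<longleftrightarrow>
     (\<forall>u\<in>carrier F. \<forall>v\<in>carrier G. \<tau> u v \<in> carrier T) \<and>
     (\<forall>u\<in>carrier F. \<forall>u'\<in>carrier F. \<forall>v\<in>carrier G. \<tau> (u \<oplus>\<^bsub>F\<^esub> u') v = \<tau> u v \<oplus>\<^bsub>T\<^esub> \<tau> u' v) \<and>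
     (\<forall>u\<in>carrier F. \<forall>v\<in>carrier G. \<forall>v'\<in>carrier G. \<tau> u (v \<oplus>\<^bsub>G\<^esub> v') = \<tau> u v \<oplus>\<^bsub>T\<^esub> \<tau> u v') \<and>
     (\<forall>u\<in>carrier F. \<forall>v\<in>carrier G. \<forall>b. \<tau> (ract F u b) v = \<tau> u (lact G b v)) \<and>
     (\<forall>u\<in>carrier F. \<forall>v\<in>carrier G. \<forall>b. \<tau> (lact F b u) v = lact T b (\<tau> u v)) \<and>
     (\<forall>u\<in>carrier F. \<forall>v\<in>carrier G. \<forall>b. \<tau> u (ract G v b) = ract T (\<tau> u v) b) \<and>
     (\<forall>u\<in>carrier F. \<forall>u'\<in>carrier F. \<forall>v\<in>carrier G. \<forall>v'\<in>carrier G.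
        ip T (\<tau> u v) (\<tau> u' v') = ip G v (lact G (ip F u u') v')) \<and>
     (\<forall>x\<in>carrier T. \<forall>e>0. \<exists>(n::nat) u v. u \<in> {..<n} \<rightarrow> carrier F \<and> v \<in> {..<n} \<rightarrow> carrier G \<and>
        hnorm T (x \<ominus>\<^bsub>T\<^esub> (\<Oplus>\<^bsub>T\<^esub>i\<in>{..<n}. \<tau> (u i) (v i))) < e)"

text \<open>
  \<open>prd E t s u v\<close> is the image of \<open>u \<otimes> v\<close> in \<open>E\<^sub>t\<^sub>+\<^sub>s\<close>, and \<open>triv E\<close> is the identification of the
  base algebra with \<open>E\<^sub>0\<close>.  Only the fibres at times \<open>t \<ge> 0\<close> are relevant.
\<close>

record ('b, 'e) prodsys =
  fibre :: "real \<Rightarrow> ('b, 'e) hilb_bimod"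
  prd :: "real \<Rightarrow> real \<Rightarrow> 'e \<Rightarrow> 'e \<Rightarrow> 'e"
  triv :: "'b \<Rightarrow> 'e"

text \<open>
  A bilinear unitary from \<open>E\<^sub>t \<otimes> E\<^sub>s\<close> onto \<open>E\<^sub>t\<^sub>+\<^sub>s\<close> is the same as a map of pairs that makes \<open>E\<^sub>t\<^sub>+\<^sub>s\<close>
  an inner tensor product of \<open>E\<^sub>t\<close> and \<open>E\<^sub>s\<close>.  The conditions on \<open>triv\<close> say that it is a bilinear
  unitary onto \<open>E\<^sub>0\<close> under which the products with \<open>E\<^sub>0\<close> become the canonical identifications
  \<open>b \<otimes> x = b x\<close> and \<open>x \<otimes> b = x b\<close>.
\<close>

locale product_system =
  fixes E :: "('b::unital_cstar_algebra, 'e) prodsys"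
  assumes hilbert: "t \<ge> 0 \<Longrightarrow> hilbert_bimodule (fibre E t)"
    and tensor: "t \<ge> 0 \<Longrightarrow> s \<ge> 0 \<Longrightarrow>
      inner_tensor (fibre E t) (fibre E s) (fibre E (t + s)) (prd E t s)"
    and assoc: "r \<ge> 0 \<Longrightarrow> s \<ge> 0 \<Longrightarrow> t \<ge> 0 \<Longrightarrow>
      u \<in> carrier (fibre E r) \<Longrightarrow> v \<in> carrier (fibre E s) \<Longrightarrow> w \<in> carrier (fibre E t) \<Longrightarrow>
      prd E (r + s) t (prd E r s u v) w = prd E r (s + t) u (prd E s t v w)"
    and triv_bij: "bij_betw (triv E) UNIV (carrier (fibre E 0))"
    and triv_add: "triv E (a + b) = triv E a \<oplus>\<^bsub>fibre E 0\<^esub> triv E b"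
    and triv_lact: "triv E (a * b) = lact (fibre E 0) a (triv E b)"
    and triv_ract: "triv E (a * b) = ract (fibre E 0) (triv E a) b"
    and triv_ip: "ip (fibre E 0) (triv E a) (triv E b) = adj a * b"
    and triv_prd_left: "t \<ge> 0 \<Longrightarrow> x \<in> carrier (fibre E t) \<Longrightarrow>
      prd E 0 t (triv E b) x = lact (fibre E t) b x"
    and triv_prd_right: "t \<ge> 0 \<Longrightarrow> x \<in> carrier (fibre E t) \<Longrightarrow>
      prd E t 0 x (triv E b) = ract (fibre E t) x b"

text \<open>
  Units are families over \<open>{0..}\<close>; being extensional, they take the default value at negative times.
\<close>

definition units :: "('b::unital_cstar_algebra, 'e) prodsys \<Rightarrow> (real \<Rightarrow> 'e) set" where
  "units E = {u \<in> (\<Pi>\<^sub>E t\<in>{0..}. carrier (fibre E t)).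
     u 0 = triv E 1 \<and> (\<forall>t\<ge>0. \<forall>s\<ge>0. prd E t s (u t) (u s) = u (t + s))}"

definition unital :: "('b::unital_cstar_algebra, 'e) prodsys \<Rightarrow> (real \<Rightarrow> 'e) \<Rightarrow> bool" where
  "unital E u \<longleftrightarrow> (\<forall>t\<ge>0. ip (fibre E t) (u t) (u t) = 1)"

definition central :: "('b::unital_cstar_algebra, 'e) prodsys \<Rightarrow> (real \<Rightarrow> 'e) \<Rightarrow> bool" where
  "central E u \<longleftrightarrow> (\<forall>t\<ge>0. \<forall>b. lact (fibre E t) b (u t) = ract (fibre E t) (u t) b)"

definition spatial :: "('b::unital_cstar_algebra, 'e) prodsys \<Rightarrow> bool" where
  "spatial E \<longleftrightarrow> (\<exists>u\<in>units E. central E u \<and> unital E u)"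

definition embedding ::
  "('b::unital_cstar_algebra, 'e) prodsys \<Rightarrow> ('b, 'f) prodsys \<Rightarrow> (real \<Rightarrow> 'e \<Rightarrow> 'f) \<Rightarrow> bool" where
  "embedding E F j \<longleftrightarrow>
     (\<forall>t\<ge>0. j t \<in> carrier (fibre E t) \<rightarrow> carrier (fibre F t) \<and>
        (\<forall>x\<in>carrier (fibre E t). \<forall>y\<in>carrier (fibre E t).
           j t (x \<oplus>\<^bsub>fibre E t\<^esub> y) = j t x \<oplus>\<^bsub>fibre F t\<^esub> j t y) \<and>
        (\<forall>x\<in>carrier (fibre E t). \<forall>b. j t (lact (fibre E t) b x) = lact (fibre F t) b (j t x)) \<and>
        (\<forall>x\<in>carrier (fibre E t). \<forall>b. j t (ract (fibre E t) x b) = ract (fibre F t) (j t x) b) \<and>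
        (\<forall>x\<in>carrier (fibre E t). \<forall>y\<in>carrier (fibre E t).
           ip (fibre F t) (j t x) (j t y) = ip (fibre E t) x y)) \<and>
     (\<forall>t\<ge>0. \<forall>s\<ge>0. \<forall>x\<in>carrier (fibre E t). \<forall>y\<in>carrier (fibre E s).
        j (t + s) (prd E t s x y) = prd F t s (j t x) (j s y))"

text \<open>
  The type argument is the type in which the fibres of the ambient spatial system live.  HOL cannot
  quantify over it existentially, but a type variable that occurs only in a hypothesis
  \<open>subspatial TYPE('f) E\<close> of a theorem has exactly this effect.
\<close>

definition subspatial :: "'f itself \<Rightarrow> ('b::unital_cstar_algebra, 'e) prodsys \<Rightarrow> bool" where
  "subspatial T E \<longleftrightarrow>
     (\<exists>(F :: ('b, 'f) prodsys) j. product_system F \<and> spatial F \<and> embedding E F j)"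


section \<open>Continuous units and their generators\<close>

text \<open>
  The bounded complex-linear operators on the base algebra are regarded as elements of the space of
  bounded real-linear operators, which carries the same operator norm.
\<close>

definition kern ::
  "('b::unital_cstar_algebra, 'e) prodsys \<Rightarrow> (real \<Rightarrow> 'e) \<Rightarrow> (real \<Rightarrow> 'e) \<Rightarrow> real \<Rightarrow> 'b \<Rightarrow>\<^sub>L 'b" where
  "kern E u v t = Blinfun (\<lambda>b. ip (fibre E t) (u t) (lact (fibre E t) b (v t)))"

definition continuous_units :: "('b::unital_cstar_algebra, 'e) prodsys \<Rightarrow> (real \<Rightarrow> 'e) set \<Rightarrow> bool" where
  "continuous_units E S \<longleftrightarrow>
     S \<subseteq> units E \<and> (\<forall>\<xi>\<in>S. \<forall>\<eta>\<in>S. continuous_on {0..} (kern E \<xi> \<eta>))"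

definition gen ::
  "('b::unital_cstar_algebra, 'e) prodsys \<Rightarrow> (real \<Rightarrow> 'e) \<Rightarrow> (real \<Rightarrow> 'e) \<Rightarrow> 'b \<Rightarrow>\<^sub>L 'b" where
  "gen E u v = vector_derivative (kern E u v) (at 0 within {0..})"

definition max_units :: "('b::unital_cstar_algebra, 'e) prodsys \<Rightarrow> (real \<Rightarrow> 'e) \<Rightarrow> (real \<Rightarrow> 'e) set" where
  "max_units E \<omega> = {x. continuous_units E {x} \<and> continuous_units E {x, \<omega>}}"


section \<open>The module of units and the index\<close>

primrec tensor_power :: "('b::unital_cstar_algebra, 'e) prodsys \<Rightarrow> real \<Rightarrow> 'e \<Rightarrow> nat \<Rightarrow> 'e" where
  "tensor_power E s y 0 = triv E 1"
| "tensor_power E s y (Suc m) = prd E (real m * s) s (tensor_power E s y m) y"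

text \<open>
  The family of the limits over \<open>m \<ge> 1\<close> of the \<open>m\<close>-th tensor powers of \<open>y (t / m)\<close>.
\<close>

definition power_limit ::
  "('b::unital_cstar_algebra, 'e) prodsys \<Rightarrow> (real \<Rightarrow> 'e) \<Rightarrow> real \<Rightarrow> 'e" where
  "power_limit E y = (\<lambda>t\<in>{0..}.
     h_lim (fibre E t)
       (\<lambda>m. tensor_power E (t / real (Suc m)) (y (t / real (Suc m))) (Suc m)))"

definition boxplus_left ::
  "('b::unital_cstar_algebra, 'e) prodsys \<Rightarrow> ('b \<times> (real \<Rightarrow> 'e)) list \<Rightarrow> real \<Rightarrow> 'e" where
  "boxplus_left E xs = power_limit E
     (\<lambda>s. foldr (\<lambda>(k, x) y. lact (fibre E s) k (x s) \<oplus>\<^bsub>fibre E s\<^esub> y) xs \<zero>\<^bsub>fibre E s\<^esub>)"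

definition boxplus_right ::
  "('b::unital_cstar_algebra, 'e) prodsys \<Rightarrow> ((real \<Rightarrow> 'e) \<times> 'b) list \<Rightarrow> real \<Rightarrow> 'e" where
  "boxplus_right E xs = power_limit E
     (\<lambda>s. foldr (\<lambda>(x, k) y. ract (fibre E s) (x s) k \<oplus>\<^bsub>fibre E s\<^esub> y) xs \<zero>\<^bsub>fibre E s\<^esub>)"

definition unit_module ::
  "('b::unital_cstar_algebra, 'e) prodsys \<Rightarrow> (real \<Rightarrow> 'e) \<Rightarrow> ('b, real \<Rightarrow> 'e) hilb_bimod" where
  "unit_module E \<omega> = mk_bimod (max_units E \<omega>)
     (\<lambda>x y. boxplus_left E [(1, x), (1, y), (- 1, \<omega>)])
     \<omega>
     (\<lambda>b x. boxplus_left E [(b, x), (1 - b, \<omega>)])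
     (\<lambda>x b. boxplus_right E [(x, b), (\<omega>, 1 - b)])
     (\<lambda>x y. blinfun_apply (gen E x y - gen E x \<omega> - gen E \<omega> y + gen E \<omega> \<omega>) 1)"

definition ind ::
  "('b::unital_cstar_algebra, 'e) prodsys \<Rightarrow> (real \<Rightarrow> 'e)
    \<Rightarrow> ('b, (nat \<Rightarrow> (real \<Rightarrow> 'e) set) set) hilb_bimod" where
  "ind E \<omega> = completion (length_quotient (unit_module E \<omega>))"

end

theory Submission
  imports Defs
begin

text \<open>
  Write \<open>L\<^sup>x\<^sup>,\<^sup>\<xi>\<close> for the generator of the kernel of two units.  A unit \<open>x\<close> of \<open>U\<close> is determined by the operators
  \<open>L\<^sup>x\<^sup>,\<^sup>\<xi>\<close> with \<open>\<xi>\<close> in \<open>U\<close>, and the map \<open>\<beta>(x) = (L\<^sup>x\<^sup>,\<^sup>\<omega>(1) - L\<^sup>\<omega>\<^sup>,\<^sup>\<omega>(1))\<^sup>*\<close> from \<open>U\<close> to the base algebra is right linear,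
  and also left linear if \<open>\<omega>\<close> is central.  It splits off the vectors of length zero: these are the
  units with \<open>L\<^sup>x\<^sup>,\<^sup>\<xi>(c) = L\<^sup>\<omega>\<^sup>,\<^sup>\<xi>(c) + \<beta>\<^sup>* c\<close>.  Dividing the Cauchy-Schwarz inequality in the fibre at time \<open>t\<close>
  by \<open>t\<close> and letting \<open>t\<close> tend to 0 shows that for \<open>\<beta>(x) = \<beta>(y)\<close> the operator \<open>L\<^sup>x\<^sup>,\<^sup>\<xi> - L\<^sup>y\<^sup>,\<^sup>\<xi>\<close> is bounded by a
  multiple of the length of \<open>x - y\<close>.  Hence the map that sends \<open>x\<close> to its class in the index and to \<open>\<beta>(x)\<close> is
  injective.  It is onto: a Cauchy sequence of classes has representatives on which \<open>\<beta>\<close> takes a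
  prescribed value, their generators converge, and so they converge in every fibre to a unit.

  The sums that define the module operations exist because the tensor powers along two partitions
  of \<open>[0, t]\<close> can be compared through a common refinement; to first order, each factor contributes
  the same generator.
\<close>

text \<open>The obstacle in the Cauchy-Schwarz step is that \<open>\<omega>\<close> need not commute
  with the algebra, so \<open>\<langle>x\<^sub>s - y\<^sub>s, c \<xi>\<^sub>s\<rangle>\<close> does
  not reduce to its value at \<open>c = 1\<close>. The squared length of the commutator
  \<open>c \<omega>\<^sub>s - \<omega>\<^sub>s c\<close> is a linear expression in the kernel of
  \<open>\<omega>\<close> that vanishes for the identity kernel, hence of order \<open>s\<close>. So
  the commutator has the same order \<open>sqrt s\<close> as the difference of two units, and the
  product of two such terms survives division by \<open>s\<close>.

  The analysis runs on matrix elements \<open>b \<mapsto> \<langle>x, b y\<rangle>\<close>: tensor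
  products of vectors become compositions of operators, and existence of limits, equality of units
  and completeness become estimates for products of operators close to the identity.

  Since positivity means being of the form \<open>adj c * c\<close>, the Cauchy-Schwarz inequality
  in the fibres first requires that such elements form a cone. For the module of units that
  inequality is not derived from positivity but inherited from the fibres as a limit.\<close>

section \<open>Positivity in C*-algebras\<close>

lemma adj_zero [simp]: "adj (0::'b::unital_cstar_algebra) = 0"
proof -
  have "adj (0 + 0 :: 'b) = adj 0 + adj 0" by (rule adj_add)
  then show ?thesis by simp
qed

lemma adj_minus: "adj (- x :: 'b::unital_cstar_algebra) = - adj x"
proof -
  have "adj (x + - x) = adj x + adj (- x)" by (rule adj_add)
  then show ?thesis by (simp add: eq_neg_iff_add_eq_0 add.commute)
qed

lemma adj_diff: "adj (x - y :: 'b::unital_cstar_algebra) = adj x - adj y"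
  using adj_add[of x "- y"] by (simp add: adj_minus)

lemma adj_one [simp]: "adj (1::'b::unital_cstar_algebra) = 1"
proof -
  have "adj (adj (1::'b) * 1) = adj 1 * adj (adj 1)" by (rule adj_mult)
  then show ?thesis by (simp add: adj_adj)
qed

lemma adj_scaleR: "adj (r *\<^sub>R x :: 'b::unital_cstar_algebra) = r *\<^sub>R adj x"
  by (simp add: scaleR_eq_scaleC adj_scaleC)

lemma norm_adj [simp]: "norm (adj x :: 'b::unital_cstar_algebra) = norm x"
proof -
  have le: "norm y \<le> norm (adj y)" for y :: 'b
  proof (cases "y = 0")
    case False
    have "norm y * norm y \<le> norm (adj y) * norm y"
      using cstar_identity[of y] norm_mult_ineq[of "adj y" y] by (simp add: power2_eq_square)
    then show ?thesis using False by simp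
  qed simp
  show ?thesis using le[of x] le[of "adj x"] by (simp add: adj_adj)
qed

lemma norm_one_le: "norm (1::'b::unital_cstar_algebra) \<le> 1"
proof -
  have "norm (1::'b) = (norm (1::'b))\<^sup>2" using cstar_identity[of "1::'b"] by simp
  then have "norm (1::'b) = 0 \<or> norm (1::'b) = 1" by (simp add: power2_eq_square)
  then show ?thesis by auto
qed

lemma bounded_linear_adj: "bounded_linear (adj :: 'b::unital_cstar_algebra \<Rightarrow> 'b)"
  by (rule bounded_linear_intro[where K=1]) (simp_all add: adj_add adj_scaleR)

lemmas tendsto_adj = bounded_linear.tendsto[OF bounded_linear_adj]

section \<open>Squares of self-adjoint elements and their roots\<close>

lemma norm_selfadj_square: "adj h = h \<Longrightarrow> norm (h * h) = (norm h)\<^sup>2" for h :: "'b::unital_cstar_algebra"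
  using cstar_identity[of h] by simp

lemma norm_selfadj_square_le_1: "adj h = h \<Longrightarrow> norm h \<le> 1 \<Longrightarrow> norm (h * h) \<le> 1"
  for h :: "'b::unital_cstar_algebra"
  using norm_selfadj_square[of h] by (simp add: power_le_one)

lemma selfadj_square_eq_0: "adj h = h \<Longrightarrow> h * h = 0 \<Longrightarrow> h = 0" for h :: "'b::unital_cstar_algebra"
  using norm_selfadj_square[of h] by simp

text \<open>Kept at the generality of real normed algebras so that \<open>sqrt_iter 1\<close> over
  the reals can serve as scalar majorant of the iteration in the C*-algebra.\<close>

primrec sqrt_iter :: "'a::real_normed_algebra \<Rightarrow> nat \<Rightarrow> 'a" where
  "sqrt_iter h 0 = 0"
| "sqrt_iter h (Suc n) = (1/2) *\<^sub>R (h + sqrt_iter h n * sqrt_iter h n)"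

lemma sqrt_iter_commute: "z * h = h * z \<Longrightarrow> z * sqrt_iter h n = sqrt_iter h n * z"
proof (induction n)
  case (Suc n)
  then have "z * (sqrt_iter h n * sqrt_iter h n) = sqrt_iter h n * sqrt_iter h n * z"
    by (metis mult.assoc)
  with Suc show ?case by (simp add: algebra_simps)
qed simp

lemma sqrt_iter_real_bounds: "0 \<le> sqrt_iter (1::real) n \<and> sqrt_iter (1::real) n \<le> 1"
proof (induction n)
  case (Suc n)
  then have "sqrt_iter (1::real) n * sqrt_iter 1 n \<le> 1" by (simp add: mult_le_one)
  with Suc show ?case by simp
qed simp

text \<open>The limit of the iteration is \<open>1 - sqrt (1 - h)\<close>; it is dominated by the scalar iteration
  for \<open>h = 1\<close>, which converges.\<close>

lemma sqrt_one_minus: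
  fixes h :: "'b::unital_cstar_algebra"
  assumes sa: "adj h = h" and h1: "norm h \<le> 1"
  obtains k where "adj k = k" "k * k = 1 - h" "norm (1 - k) \<le> 1" "\<forall>z. z * h = h * z \<longrightarrow> z * k = k * z"
proof -
  let ?y = "sqrt_iter h" and ?s = "sqrt_iter (1::real)"
  have bd: "norm (?y n) \<le> ?s n" for n
  proof (induction n)
    case (Suc n)
    have "norm (h + ?y n * ?y n) \<le> norm h + norm (?y n * ?y n)" by (rule norm_triangle_ineq)
    also have "\<dots> \<le> 1 + ?s n * ?s n"
      using h1 Suc sqrt_iter_real_bounds[of n]
      by (intro add_mono order_trans[OF norm_mult_ineq] mult_mono) auto
    finally show ?case by simp
  qed simp
  have step: "norm (?y (Suc n) - ?y n) \<le> ?s (Suc n) - ?s n" for n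
  proof (induction n)
    case (Suc n)
    \<comment> \<open>All iterates commute, so the difference of two squares factors; the scalar
      iteration satisfies the same identity, hence its increments dominate.\<close>
    have c: "?y (Suc n) * ?y n = ?y n * ?y (Suc n)"
      by (rule sqrt_iter_commute) (rule sqrt_iter_commute[symmetric], simp)
    have "?y (Suc (Suc n)) - ?y (Suc n)
        = (1/2) *\<^sub>R (?y (Suc n) * ?y (Suc n) - ?y n * ?y n)"
      by (subst sqrt_iter.simps(2), subst (3) sqrt_iter.simps(2)) (simp add: algebra_simps del: sqrt_iter.simps)
    also have "?y (Suc n) * ?y (Suc n) - ?y n * ?y n = (?y (Suc n) - ?y n) * (?y (Suc n) + ?y n)"
      using c by (simp add: algebra_simps del: sqrt_iter.simps)
    finally have "norm (?y (Suc (Suc n)) - ?y (Suc n))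
        \<le> (1/2) * (norm (?y (Suc n) - ?y n) * norm (?y (Suc n) + ?y n))"
      by (simp add: norm_mult_ineq del: sqrt_iter.simps)
    also have "\<dots> \<le> (1/2) * ((?s (Suc n) - ?s n) * (?s (Suc n) + ?s n))"
      using Suc order_trans[OF norm_ge_zero Suc] bd[of n] bd[of "Suc n"] norm_triangle_ineq[of "?y (Suc n)" "?y n"]
      by (intro mult_left_mono mult_mono) (auto simp del: sqrt_iter.simps intro: order_trans[OF norm_ge_zero])
    also have "\<dots> = ?s (Suc (Suc n)) - ?s (Suc n)"
      by (subst (3) sqrt_iter.simps(2), subst (4) sqrt_iter.simps(2)) (simp add: algebra_simps del: sqrt_iter.simps)
    finally show ?case .
  qed (use h1 in simp)
  have inc: "incseq ?s" using order_trans[OF norm_ge_zero step] by (intro incseq_SucI) (simp del: sqrt_iter.simps)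
  have tele: "norm (?y (n + d) - ?y n) \<le> ?s (n + d) - ?s n" for n d
  proof (induction d)
    case (Suc d)
    have "?y (n + Suc d) - ?y n = (?y (Suc (n + d)) - ?y (n + d)) + (?y (n + d) - ?y n)"
      by (simp del: sqrt_iter.simps)
    then have "norm (?y (n + Suc d) - ?y n) \<le> norm (?y (Suc (n + d)) - ?y (n + d)) + norm (?y (n + d) - ?y n)"
      by (metis norm_triangle_ineq)
    also have "\<dots> \<le> ?s (n + Suc d) - ?s n" using Suc step[of "n + d"] by (simp del: sqrt_iter.simps)
    finally show ?case .
  qed simp
  have "convergent ?s"
    using inc sqrt_iter_real_bounds by (intro Bseq_mono_convergent BseqI'[of _ 1]) (auto simp: incseq_def)
  then have "Cauchy ?s" by (rule convergent_Cauchy)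
  have "Cauchy ?y"
  proof (rule metric_CauchyI)
    fix e :: real assume "e > 0"
    with \<open>Cauchy ?s\<close> obtain M where M: "\<And>m n. m \<ge> M \<Longrightarrow> n \<ge> M \<Longrightarrow> dist (?s m) (?s n) < e"
      unfolding Cauchy_def by blast
    have "dist (?y m) (?y n) < e" if "n \<ge> M" "m \<ge> n" for m n
      using tele[of n "m - n"] M[of m n] that by (simp add: dist_norm)
    then show "\<exists>M. \<forall>m\<ge>M. \<forall>n\<ge>M. dist (?y m) (?y n) < e"
      by (metis dist_commute nle_le)
  qed
  then obtain y where lim: "?y \<longlonglongrightarrow> y" using Cauchy_convergent_iff convergentD by blast
  have saN: "adj (?y n) = ?y n" for n
    by (induction n) (simp_all add: adj_scaleR adj_add adj_mult sa)
  have "(\<lambda>n. adj (?y n)) \<longlonglongrightarrow> adj y" by (rule tendsto_adj[OF lim])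
  with lim saN have say: "adj y = y" by (simp add: LIMSEQ_unique)
  have "(\<lambda>n. ?y (Suc n)) \<longlonglongrightarrow> (1/2) *\<^sub>R (h + y * y)"
    unfolding sqrt_iter.simps by (intro tendsto_intros lim)
  with LIMSEQ_Suc[OF lim] have eq: "y = (1/2) *\<^sub>R (h + y * y)" by (rule LIMSEQ_unique)
  have eq': "h + y * y = y + y" by (subst (3 4) eq) (simp flip: scaleR_add_left)
  have sq: "(1 - y) * (1 - y) = 1 - h" using eq' by (simp add: algebra_simps)
  have "norm y \<le> 1"
    using Lim_bounded[OF tendsto_norm[OF lim], of 0 1] bd sqrt_iter_real_bounds order_trans by blast
  then have n: "norm (1 - (1 - y)) \<le> 1" by simp
  have comm: "\<forall>z. z * h = h * z \<longrightarrow> z * (1 - y) = (1 - y) * z"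
  proof (intro allI impI)
    fix z assume zh: "z * h = h * z"
    have "(\<lambda>n. z * ?y n) \<longlonglongrightarrow> z * y" "(\<lambda>n. ?y n * z) \<longlonglongrightarrow> y * z" by (intro tendsto_intros lim)+
    with sqrt_iter_commute[OF zh] have "z * y = y * z" by (simp add: LIMSEQ_unique)
    then show "z * (1 - y) = (1 - y) * z" by (simp add: algebra_simps)
  qed
  have "adj (1 - y) = 1 - y" by (simp add: adj_diff say)
  from this sq n comm show ?thesis by (rule that)
qed

section \<open>The cone of squares of self-adjoint elements\<close>

lemma norm_unitary_parts:
  fixes h k :: "'b::unital_cstar_algebra"
  assumes "adj h = h" "adj k = k" "h * k = k * h" "h * h + k * k = 1"
  shows "norm h \<le> 1"
proof -
  \<comment> \<open>Since \<open>h\<close> and \<open>k\<close> commute,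
    \<open>adj u * u = h * h + k * k = 1\<close>; so \<open>norm u \<le> 1\<close>, and
    \<open>h\<close> is the real part of \<open>u\<close>.\<close>
  define u where "u = h + \<i> *\<^sub>C k"
  have adju: "adj u = h + (- \<i>) *\<^sub>C k" by (simp add: u_def adj_add adj_scaleC assms)
  have neg: "(- \<i>) *\<^sub>C k = - (\<i> *\<^sub>C k)"
    using scaleC_add_left[of "\<i>" "- \<i>" k] scaleR_eq_scaleC[of 0 k] by (simp add: eq_neg_iff_add_eq_0 add.commute)
  have i2: "(\<i> *\<^sub>C k) * (\<i> *\<^sub>C k) = - (k * k)"
    using scaleR_eq_scaleC[of "-1" "k * k"] by (simp add: mult_scaleC_left mult_scaleC_right scaleC_scaleC)
  have "adj u * u = h * h + k * k + (h * (\<i> *\<^sub>C k) - (\<i> *\<^sub>C k) * h)"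
    unfolding adju neg unfolding u_def using i2 by (simp add: algebra_simps)
  also have "\<dots> = 1" using assms by (simp add: mult_scaleC_left mult_scaleC_right)
  finally have "(norm u)\<^sup>2 \<le> 1" using cstar_identity[of u] norm_one_le by metis
  then have "norm u \<le> 1" by (simp add: power_le_one_iff)
  moreover have "h = (1/2) *\<^sub>R (u + adj u)"
    unfolding adju neg unfolding u_def by (simp flip: scaleR_2)
  ultimately show ?thesis using norm_triangle_ineq[of u "adj u"] by simp
qed

text \<open>A priori stronger than \<open>positive\<close>, as the root is self-adjoint; that the
  two notions agree is the content of \<open>cone_adj_mult\<close>.\<close>

definition cone :: "'b::unital_cstar_algebra \<Rightarrow> bool" where
  "cone a \<longleftrightarrow> (\<exists>h. adj h = h \<and> a = h * h)"

lemma one_minus_square: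
  fixes h :: "'b::unital_cstar_algebra"
  assumes "adj h = h" "norm h \<le> 1"
  obtains k where "adj k = k" "h * h + k * k = 1" "norm k \<le> 1" "h * k = k * h"
proof -
  have n: "norm (h * h) \<le> 1" by (rule norm_selfadj_square_le_1[OF assms])
  have "adj (h * h) = h * h" by (simp add: adj_mult assms)
  from this n obtain k where k: "adj k = k" "k * k = 1 - h * h" "norm (1 - k) \<le> 1"
      "\<forall>z. z * (h * h) = (h * h) * z \<longrightarrow> z * k = k * z"
    by (rule sqrt_one_minus)
  have hk: "h * k = k * h" using k(4) by (simp add: mult.assoc)
  have "norm k \<le> 1"
    using k(2) by (intro norm_unitary_parts[OF k(1) assms(1) hk[symmetric]]) simp
  then show ?thesis using k(1,2) hk by (intro that[of k]) simp_all
qed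

lemma cone_selfadj: "cone a \<Longrightarrow> adj a = a"
  unfolding cone_def by (metis adj_mult)

lemma cone_scaleR: "cone a \<Longrightarrow> 0 \<le> r \<Longrightarrow> cone (r *\<^sub>R a)"
  unfolding cone_def
  by (metis adj_scaleR mult_scaleR_left mult_scaleR_right scaleR_scaleR real_sqrt_mult_self abs_of_nonneg)

text \<open>Scaled to \<open>a = t g^2\<close>, the complement \<open>1 - g^2\<close> is a square
  \<open>k^2\<close> with \<open>norm k \<le> 1\<close>. With the converse \<open>coneI\<close> this
  gives a norm criterion for positivity in place of spectral theory.\<close>

lemma cone_normal:
  fixes a :: "'b::unital_cstar_algebra"
  assumes "cone a" "norm a \<le> t"
  shows "norm (t *\<^sub>R 1 - a) \<le> t"
proof (cases "t = 0")
  case False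
  with assms have t: "t > 0" using norm_ge_zero[of a] by linarith
  from assms obtain h where h: "adj h = h" "a = h * h" by (auto simp: cone_def)
  define g where "g = (1 / sqrt t) *\<^sub>R h"
  have g: "adj g = g" "g * g = (1/t) *\<^sub>R a" using t h by (auto simp: g_def adj_scaleR)
  have "(norm g)\<^sup>2 \<le> 1" using norm_selfadj_square[OF g(1)] g(2) assms t by (simp add: divide_simps)
  then have "norm g \<le> 1" by (simp add: power_le_one_iff)
  with g(1) obtain k where k: "adj k = k" "g * g + k * k = 1" "norm k \<le> 1" "g * k = k * g"
    by (rule one_minus_square)
  have "k * k = 1 - (1/t) *\<^sub>R a" using k(2) g(2) by (simp add: eq_diff_eq add.commute)
  then have "t *\<^sub>R 1 - a = t *\<^sub>R (k * k)" using t by (simp add: scaleR_diff_right)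
  moreover have "norm (k * k) \<le> 1" by (rule norm_selfadj_square_le_1[OF k(1,3)])
  ultimately show ?thesis using t by simp
qed (use assms in simp)

text \<open>With \<open>g = 1 - a / t\<close> the iteration produces a root of
  \<open>1 - g = a / t\<close>, and its limit inherits commutation with everything that commutes
  with \<open>a\<close>.\<close>

lemma cone_commuting_root:
  fixes a :: "'b::unital_cstar_algebra"
  assumes sa: "adj a = a" and "norm (t *\<^sub>R 1 - a) \<le> t"
  obtains h where "adj h = h" "a = h * h" "\<forall>z. z * a = a * z \<longrightarrow> z * h = h * z"
proof (cases "t = 0")
  case True
  with assms have "a = 0" by simp
  then show ?thesis using that[of 0] by simp
next
  case False
  with assms have t: "t > 0" using norm_ge_zero[of "t *\<^sub>R 1 - a"] by linarith
  let ?g = "1 - (1/t) *\<^sub>R a"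
  have "?g = (1/t) *\<^sub>R (t *\<^sub>R 1 - a)" using t by (simp add: scaleR_diff_right)
  then have n: "norm ?g \<le> 1" using t assms by (simp add: divide_simps)
  have "adj ?g = ?g" by (simp add: adj_diff adj_scaleR sa)
  from this n obtain k where k: "adj k = k" "k * k = 1 - ?g" "norm (1 - k) \<le> 1"
      "\<forall>z. z * ?g = ?g * z \<longrightarrow> z * k = k * z"
    by (rule sqrt_one_minus)
  have sq: "a = sqrt t *\<^sub>R k * sqrt t *\<^sub>R k" using k(2) t by simp
  have comm: "\<forall>z. z * a = a * z \<longrightarrow> z * (sqrt t *\<^sub>R k) = sqrt t *\<^sub>R k * z"
  proof (intro allI impI)
    fix z assume "z * a = a * z"
    then have "z * k = k * z" by (intro k(4)[rule_format]) (simp add: algebra_simps)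
    then show "z * (sqrt t *\<^sub>R k) = sqrt t *\<^sub>R k * z" by simp
  qed
  have "adj (sqrt t *\<^sub>R k) = sqrt t *\<^sub>R k" by (simp add: adj_scaleR k(1))
  from this sq comm show ?thesis by (rule that)
qed

lemma cone_root:
  fixes a :: "'b::unital_cstar_algebra"
  assumes "cone a"
  obtains h where "adj h = h" "a = h * h" "\<forall>z. z * a = a * z \<longrightarrow> z * h = h * z"
proof -
  from cone_selfadj[OF assms] cone_normal[OF assms order_refl] obtain h
    where h: "adj h = h" "a = h * h" "\<forall>z. z * a = a * z \<longrightarrow> z * h = h * z" by (rule cone_commuting_root)
  show ?thesis by (rule that[OF h])
qed

lemma coneI:
  fixes a :: "'b::unital_cstar_algebra"
  assumes "adj a = a" "norm (t *\<^sub>R 1 - a) \<le> t"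
  shows "cone a"
proof -
  from assms obtain h where h: "adj h = h" "a = h * h" "\<forall>z. z * a = a * z \<longrightarrow> z * h = h * z"
    by (rule cone_commuting_root)
  show ?thesis unfolding cone_def using h(1,2) by (intro exI[of _ h] conjI)
qed

text \<open>For \<open>t = norm a + norm b\<close> the norm criterion of the sum is the triangle
  inequality applied to the criteria of the summands.\<close>

lemma cone_add:
  fixes a b :: "'b::unital_cstar_algebra"
  assumes "cone a" "cone b" shows "cone (a + b)"
proof (rule coneI)
  show "adj (a + b) = a + b" using assms by (simp add: adj_add cone_selfadj)
  have "(norm a + norm b) *\<^sub>R 1 - (a + b) = (norm a *\<^sub>R 1 - a) + (norm b *\<^sub>R 1 - b)"
    by (simp add: algebra_simps)
  moreover have "norm (norm a *\<^sub>R 1 - a) + norm (norm b *\<^sub>R 1 - b) \<le> norm a + norm b"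
    using assms by (intro add_mono cone_normal) auto
  ultimately show "norm ((norm a + norm b) *\<^sub>R 1 - (a + b)) \<le> norm a + norm b"
    by (simp only: norm_triangle_le)
qed

text \<open>Roots obtained from \<open>cone_root\<close> commute with each other, so their product
  is a self-adjoint root of \<open>a * b\<close>.\<close>

lemma cone_mult:
  fixes a b :: "'b::unital_cstar_algebra"
  assumes "cone a" "cone b" "a * b = b * a" shows "cone (a * b)"
proof -
  obtain h where h: "adj h = h" "a = h * h" "\<forall>z. z * a = a * z \<longrightarrow> z * h = h * z"
    by (rule cone_root[OF assms(1)])
  obtain k where k: "adj k = k" "b = k * k" "\<forall>z. z * b = b * z \<longrightarrow> z * k = k * z"
    by (rule cone_root[OF assms(2)])
  have "h * b = b * h" using h(3)[rule_format, of b] assms(3) by simp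
  then have hk: "h * k = k * h" using k(3)[rule_format, of h] by simp
  have "h * (h * k) * k = h * (k * h) * k" by (simp only: hk)
  then have "a * b = h * k * (h * k)" by (simp only: h(2) k(2) mult.assoc)
  moreover have "adj (h * k) = h * k" by (simp add: adj_mult h(1) k(1) hk)
  ultimately show ?thesis unfolding cone_def by blast
qed

lemma cone_one_minus:
  fixes a :: "'b::unital_cstar_algebra"
  assumes "cone a" "norm a \<le> 1" shows "cone (1 - a)"
  using cone_normal[OF assms] norm_one_le assms
  by (intro coneI[of _ 1]) (auto simp: adj_diff cone_selfadj)

text \<open>The roots of \<open>a\<close> and of \<open>1 - a\<close> commute, so they are the real
  and imaginary part of a unitary.\<close>

lemma cone_norm_le_1:
  fixes a :: "'b::unital_cstar_algebra"
  assumes "cone a" "cone (1 - a)" shows "norm a \<le> 1"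
proof -
  obtain h where h: "adj h = h" "a = h * h" "\<forall>z. z * a = a * z \<longrightarrow> z * h = h * z"
    by (rule cone_root[OF assms(1)])
  obtain k where k: "adj k = k" "1 - a = k * k" "\<forall>z. z * (1 - a) = (1 - a) * z \<longrightarrow> z * k = k * z"
    by (rule cone_root[OF assms(2)])
  have "h * (1 - a) = (1 - a) * h" by (simp add: h(2) left_diff_distrib right_diff_distrib mult.assoc)
  then have "h * k = k * h" using k(3) by blast
  then have "norm h \<le> 1" by (intro norm_unitary_parts[OF h(1) k(1)]) (simp_all flip: k(2) h(2))
  then show ?thesis using norm_selfadj_square[OF h(1)] h(2) by (simp add: power_le_one)
qed

text \<open>After scaling to \<open>norm (a + b) \<le> 1\<close>, the element \<open>1 - a\<close>
  is the sum of the positive elements \<open>1 - (a + b)\<close> and \<open>b\<close>, and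
  \<open>cone_norm_le_1\<close> bounds \<open>a\<close>.\<close>

lemma cone_norm_mono:
  fixes a b :: "'b::unital_cstar_algebra"
  assumes "cone a" "cone b" shows "norm a \<le> norm (a + b)"
proof (rule field_le_epsilon)
  fix e :: real assume e: "e > 0"
  \<comment> \<open>Adding \<open>e\<close> keeps the scaling factor positive when
    \<open>a + b = 0\<close>.\<close>
  define t where "t = norm (a + b) + e"
  have t: "t > 0" using e by (simp add: t_def add_nonneg_pos)
  have "norm ((1/t) *\<^sub>R (a + b)) \<le> 1" using t e by (simp add: t_def divide_simps)
  then have "cone (1 - (1/t) *\<^sub>R (a + b))"
    using assms t by (intro cone_one_minus cone_scaleR cone_add) auto
  then have "cone ((1 - (1/t) *\<^sub>R (a + b)) + (1/t) *\<^sub>R b)"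
    using assms t by (intro cone_add[OF _ cone_scaleR]) auto
  then have "cone (1 - (1/t) *\<^sub>R a)" by (simp add: scaleR_add_right)
  then have "norm ((1/t) *\<^sub>R a) \<le> 1" using assms t by (intro cone_norm_le_1 cone_scaleR) auto
  then show "norm a \<le> norm (a + b) + e" using t by (simp add: t_def divide_simps)
qed

section \<open>Positivity of \<open>adj c * c\<close>\<close>

lemma cone_square: "adj h = h \<Longrightarrow> cone (h * h)" unfolding cone_def by blast

lemma cone_sandwich:
  fixes a z :: "'b::unital_cstar_algebra"
  assumes "cone a" "adj z = z" "z * a = a * z" shows "cone (z * a * z)"
proof -
  have "z * z * a = z * (a * z)" by (simp only: mult.assoc assms(3))
  then have "z * a * z = z * z * a" by (simp only: mult.assoc)
  moreover have "z * z * a = a * (z * z)"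
    using \<open>z * z * a = z * (a * z)\<close> by (simp only: assms(3) flip: mult.assoc)
  ultimately show ?thesis using cone_mult[OF cone_square[OF assms(2)] assms(1)] by simp
qed

lemma cone_adj_mult_plus:
  fixes w :: "'b::unital_cstar_algebra"
  shows "cone (adj w * w + w * adj w)"
proof -
  \<comment> \<open>The self-adjoint elements \<open>w + adj w\<close> and
    \<open>\<i> (w - adj w)\<close> have squares that add up to twice the element in
    question.\<close>
  define u where "u = w + adj w"
  define v where "v = \<i> *\<^sub>C (w - adj w)"
  have m: "(-1) *\<^sub>C (x::'b) = - x" for x using scaleR_eq_scaleC[of "-1" x] by simp
  have "adj v = (- \<i>) *\<^sub>C (adj w - w)" by (simp add: v_def adj_scaleC adj_diff adj_adj)
  also have "\<dots> = \<i> *\<^sub>C ((-1) *\<^sub>C (adj w - w))" by (simp add: scaleC_scaleC)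
  finally have sv: "adj v = v" by (simp add: v_def m)
  have su: "adj u = u" by (simp add: u_def adj_add adj_adj add.commute)
  have vv: "v * v = - ((w - adj w) * (w - adj w))"
    by (simp add: v_def mult_scaleC_left mult_scaleC_right scaleC_scaleC m)
  have "u * u + v * v = 2 *\<^sub>R (adj w * w + w * adj w)"
    unfolding vv u_def by (simp add: algebra_simps scaleR_2)
  then have "adj w * w + w * adj w = (1/2) *\<^sub>R (u * u + v * v)" by simp
  then show ?thesis by (simp add: cone_scaleR cone_add cone_square su sv)
qed

text \<open>Positivity of \<open>m - (a + d)\<close> bounds \<open>a\<close> by
  \<open>m - d\<close>. The alternative \<open>a = 0\<close> is for the zero algebra, the only one
  in which \<open>norm 1\<close> differs from 1; the case \<open>d > m\<close> leads there.\<close>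

lemma cone_norm_shift:
  fixes a :: "'b::unital_cstar_algebra"
  assumes "cone a" "norm (a + d *\<^sub>R 1) \<le> m" "0 \<le> d" shows "norm a + d \<le> m \<or> a = 0"
proof (cases "d \<le> m")
  case True
  have one: "cone (1::'b)" using cone_square[of "1::'b"] by simp
  have "cone (m *\<^sub>R 1 - (a + d *\<^sub>R 1))"
  proof (cases "m = 0")
    case True with assms(2) show ?thesis using cone_square[of "0::'b"] by simp
  next
    case False
    then have m: "m > 0" using assms True by linarith
    have "cone (1 - (1/m) *\<^sub>R (a + d *\<^sub>R 1))"
      using assms one m by (intro cone_one_minus cone_scaleR cone_add) (auto simp: divide_simps)
    then have "cone (m *\<^sub>R (1 - (1/m) *\<^sub>R (a + d *\<^sub>R 1)))" using m by (intro cone_scaleR) auto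
    then show ?thesis using m by (simp add: scaleR_diff_right)
  qed
  then have "norm a \<le> norm (a + (m *\<^sub>R 1 - (a + d *\<^sub>R 1)))" using assms by (intro cone_norm_mono) auto
  also have "a + (m *\<^sub>R 1 - (a + d *\<^sub>R 1)) = (m - d) *\<^sub>R 1" by (simp add: algebra_simps)
  also have "norm \<dots> \<le> m - d" using True norm_one_le[where 'b='b] by (simp add: mult_left_le)
  finally show ?thesis by simp
next
  case False
  have one: "cone (1::'b)" using cone_square[of "1::'b"] by simp
  have "norm (d *\<^sub>R 1 :: 'b) \<le> norm (d *\<^sub>R 1 + a)" using assms one by (intro cone_norm_mono cone_scaleR) auto
  also have "\<dots> < d" using False assms by (simp add: add.commute)
  finally have "d * norm (1::'b) < d" using assms by simp
  then have "norm (1::'b) \<noteq> 1" by auto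
  moreover have "norm (1::'b) = (norm (1::'b))\<^sup>2" using cstar_identity[of "1::'b"] by simp
  ultimately have "norm (1::'b) = 0" by (metis mult_cancel_left1 power2_eq_square)
  then have "a = 0" by (metis mult_1 mult_zero_left norm_eq_zero)
  then show ?thesis ..
qed

text \<open>The usual proof compares the spectra of \<open>adj w * w\<close> and
  \<open>w * adj w\<close>. Here \<open>x = w * adj w\<close> and \<open>a = - (adj w * w)\<close>
  are both positive, and \<open>w (1 + s a) = (1 - s x) w\<close> is no longer than
  \<open>w\<close>; but its squared length is that of \<open>(1 + s a) a (1 + s a)\<close>, which
  dominates \<open>a + 2 s a^2\<close>. This leaves room only for \<open>a = 0\<close>.\<close>

lemma cone_flip:
  fixes w :: "'b::unital_cstar_algebra"
  assumes "cone (- (adj w * w))" shows "w = 0"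
proof -
  have c: "cone (w * adj w)"
  proof -
    have "w * adj w = (adj w * w + w * adj w) + - (adj w * w)" by simp
    then show ?thesis using cone_add[OF cone_adj_mult_plus assms] by metis
  qed
  define x where "x = w * adj w"
  define a where "a = - (adj w * w)"
  have ca: "cone a" and cx: "cone x" using assms c by (auto simp: a_def x_def)
  have wa: "w * a = - (x * w)" by (simp add: a_def x_def mult.assoc)
  \<comment> \<open>Makes the norm of \<open>s x\<close> at most 1, so that \<open>1 - s x\<close>
    is a contraction.\<close>
  define s where "s = 1 / (1 + norm x)"
  have s: "s > 0" by (simp add: s_def add_pos_nonneg)
  have "norm (s *\<^sub>R x) \<le> 1" by (simp add: s_def divide_simps add_pos_nonneg)
  then have nx: "norm (1 - s *\<^sub>R x) \<le> 1"
    using cone_normal[OF cone_scaleR[OF cx], of s 1] s by simp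
  have "w * (1 + s *\<^sub>R a) = (1 - s *\<^sub>R x) * w" using wa by (simp add: algebra_simps)
  then have "norm (w * (1 + s *\<^sub>R a)) \<le> norm w"
    using order_trans[OF norm_mult_ineq[of "1 - s *\<^sub>R x" w]] nx by (simp add: mult_left_le_one_le)
  then have "(norm (w * (1 + s *\<^sub>R a)))\<^sup>2 \<le> norm a"
    using cstar_identity[of w] by (simp add: a_def power_mono)
  moreover have "adj (w * (1 + s *\<^sub>R a)) * (w * (1 + s *\<^sub>R a)) = - ((1 + s *\<^sub>R a) * a * (1 + s *\<^sub>R a))"
    
  proof -
    have "adj (1 + s *\<^sub>R a) = 1 + s *\<^sub>R a" by (simp add: adj_add adj_scaleR cone_selfadj[OF ca])
    moreover have "adj w * (w * y) = - (a * y)" for y by (simp add: a_def mult.assoc)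
    ultimately show ?thesis by (simp only: adj_mult mult.assoc mult_minus_right)
  qed
  ultimately have "norm ((1 + s *\<^sub>R a) * a * (1 + s *\<^sub>R a)) \<le> norm a"
    using cstar_identity[of "w * (1 + s *\<^sub>R a)"] by simp
  also have "(1 + s *\<^sub>R a) * a * (1 + s *\<^sub>R a) = (a + (2 * s) *\<^sub>R (a * a)) + (s * s) *\<^sub>R (a * a * a)"
    by (simp add: algebra_simps flip: scaleR_2)
  finally have "norm (a + (2 * s) *\<^sub>R (a * a)) \<le> norm a"
    using cone_norm_mono[of "a + (2 * s) *\<^sub>R (a * a)" "(s * s) *\<^sub>R (a * a * a)"] ca s
      cone_add[OF ca cone_scaleR[OF cone_mult[OF ca ca]], of "2 * s"]
      cone_scaleR[OF cone_mult[OF cone_mult[OF ca ca] ca], of "s * s"]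
    by (simp add: mult.assoc)
  note n1 = this
  \<comment> \<open>Completes the square: as \<open>4 s d = 1\<close>, the square of
    \<open>a + d\<close> is \<open>2 d (a + 2 s a^2) + d^2\<close>. Comparing
    \<open>norm (a + d)\<close>, which is \<open>norm a + d\<close> outside the zero algebra, with
    the bound \<open>n1\<close> forces \<open>norm a = 0\<close>.\<close>
  define d where "d = 1 / (4 * s)"
  have d: "d > 0" using s by (simp add: d_def)
  have "(a + d *\<^sub>R 1) * (a + d *\<^sub>R 1) = (2 * d) *\<^sub>R (a + (2 * s) *\<^sub>R (a * a)) + (d * d) *\<^sub>R 1"
  proof -
    have "2 * d * (2 * s) = 1" using s by (simp add: d_def)
    then have "(2 * d) *\<^sub>R (a + (2 * s) *\<^sub>R (a * a)) = (2 * d) *\<^sub>R a + a * a"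
      by (simp add: scaleR_add_right)
    then show ?thesis by (simp add: algebra_simps flip: scaleR_2)
  qed
  then have "norm ((a + d *\<^sub>R 1) * (a + d *\<^sub>R 1)) \<le> 2 * d * norm a + d * d"
  proof -
    have "norm ((2 * d) *\<^sub>R (a + (2 * s) *\<^sub>R (a * a)) + (d * d) *\<^sub>R 1)
        \<le> (2 * d) * norm (a + (2 * s) *\<^sub>R (a * a)) + (d * d) * norm (1::'b)"
      using d by (intro order_trans[OF norm_triangle_ineq]) simp
    also have "\<dots> \<le> 2 * d * norm a + d * d * 1"
      using d n1 norm_one_le[where 'b='b] by (intro add_mono mult_left_mono) auto
    finally show ?thesis using \<open>(a + d *\<^sub>R 1) * (a + d *\<^sub>R 1) = _\<close> by simp
  qed
  then have "(norm (a + d *\<^sub>R 1))\<^sup>2 \<le> 2 * d * norm a + d * d"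
    using norm_selfadj_square[of "a + d *\<^sub>R 1"] cone_selfadj[OF ca] by (simp add: adj_add adj_scaleR)
  then have "norm (a + d *\<^sub>R 1) \<le> sqrt (2 * d * norm a + d * d)" by (simp add: real_le_rsqrt)
  from cone_norm_shift[OF ca this] d have "a = 0 \<or> norm a + d \<le> sqrt (2 * d * norm a + d * d)" by auto
  then have "a = 0"
  proof
    assume "norm a + d \<le> sqrt (2 * d * norm a + d * d)"
    then have "(norm a + d)\<^sup>2 \<le> 2 * d * norm a + d * d"
      using d by (intro sqrt_ge_absD) (simp add: abs_of_nonneg)
    then have "(norm a)\<^sup>2 \<le> 0" by (simp add: power2_eq_square algebra_simps)
    then show "a = 0" by simp
  qed
  then show "w = 0" using cstar_identity[of w] by (simp add: a_def)
qed

text \<open>Kaplansky's argument: for \<open>a = c\<^sup>* c\<close>, \<open>b = (a\<^sup>2)\<^sup>1\<^sup>/\<^sup>2\<close> and \<open>z = b - a\<close> one has \<open>(c z)\<^sup>* (c z) = - z b z\<close>, which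
  forces \<open>c z = 0\<close> and then \<open>z = 0\<close>.\<close>

theorem cone_adj_mult: "cone (adj c * c)" for c :: "'b::unital_cstar_algebra"
proof -
  define a where "a = adj c * c"
  have sa: "adj a = a" by (simp add: a_def adj_mult adj_adj)
  obtain b where b: "adj b = b" "a * a = b * b" "\<forall>z. z * (a * a) = a * a * z \<longrightarrow> z * b = b * z" and cb: "cone b"
  proof -
    \<comment> \<open>\<open>sqrt_one_minus\<close> is used with \<open>h = 1 - g^2\<close> for the
      contraction \<open>g = a / t\<close>, so that \<open>k\<close> is a root of
      \<open>g^2\<close>; the bound \<open>norm (1 - k) \<le> 1\<close> makes this root
      positive.\<close>
    define t where "t = 1 + norm a"
    have t: "t > 0" by (simp add: t_def add_pos_nonneg)
    let ?g = "(1/t) *\<^sub>R a"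
    have g: "adj ?g = ?g" "norm ?g \<le> 1" using t sa by (auto simp: adj_scaleR t_def divide_simps)
    have g2: "adj (1 - ?g * ?g) = 1 - ?g * ?g" using sa by (simp add: adj_diff adj_scaleR adj_mult)
    have "norm (1 - ?g * ?g) \<le> 1" using cone_normal[OF cone_square[OF g(1)], of 1] g norm_selfadj_square[OF g(1)]
      by (simp add: power_le_one)
    then obtain k where k: "adj k = k" "k * k = 1 - (1 - ?g * ?g)" "norm (1 - k) \<le> 1"
      "\<forall>z. z * (1 - ?g * ?g) = (1 - ?g * ?g) * z \<longrightarrow> z * k = k * z"
      by (rule sqrt_one_minus[OF g2])
    show ?thesis
    proof (rule that[of "t *\<^sub>R k"])
      show "cone (t *\<^sub>R k)" by (intro cone_scaleR coneI[OF k(1), of 1]) (use k(3) t in simp_all)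
      show "adj (t *\<^sub>R k) = t *\<^sub>R k" by (simp add: adj_scaleR k(1))
      show "a * a = t *\<^sub>R k * t *\<^sub>R k" using k(2) t by simp
      show "\<forall>z. z * (a * a) = a * a * z \<longrightarrow> z * t *\<^sub>R k = t *\<^sub>R k * z"
      proof (intro allI impI)
        fix z assume "z * (a * a) = a * a * z"
        then have "z * k = k * z" by (intro k(4)[rule_format]) (simp add: algebra_simps)
        then show "z * t *\<^sub>R k = t *\<^sub>R k * z" by simp
      qed
    qed
  qed
  have ab: "a * b = b * a" using b(3) by (simp add: mult.assoc)
  define z where "z = b - a"
  have sz: "adj z = z" by (simp add: z_def adj_diff sa b)
  have zb: "z * b = b * z" by (simp add: z_def algebra_simps ab)
  have za: "z * a * z = - (z * b * z)"
  proof -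
    have "z * (a + b) = 0" using ab b(2) by (simp add: z_def algebra_simps)
    then have "z * a + z * b = 0" by (simp add: distrib_left)
    then have "z * a * z + z * b * z = 0" by (metis distrib_right mult_zero_left)
    then show ?thesis by (simp add: eq_neg_iff_add_eq_0)
  qed
  have czbz: "cone (z * b * z)" by (rule cone_sandwich[OF cb sz zb])
  have "adj (c * z) * (c * z) = z * a * z" by (simp add: adj_mult sz a_def mult.assoc)
  then have "cone (- (adj (c * z) * (c * z)))" using za czbz by simp
  then have "c * z = 0" by (rule cone_flip)
  then have "z * a * z = 0" by (simp add: a_def mult.assoc)
  then have "z * b * z = 0" using za by simp
  have "z * b * z - z * a * z = z * (b - a) * z" by (simp add: algebra_simps)
  then have "z * z * z = 0" using \<open>z * b * z = 0\<close> \<open>z * a * z = 0\<close> by (simp flip: z_def)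
  then have "(z * z) * (z * z) = 0" by (metis mult.assoc mult_zero_left)
  moreover have "adj (z * z) = z * z" by (simp add: adj_mult sz)
  ultimately have "z * z = 0" by (rule selfadj_square_eq_0[rotated])
  then have "z = 0" by (rule selfadj_square_eq_0[OF sz])
  then show ?thesis using cb by (simp add: z_def a_def)
qed

lemma positive_cone: "positive a \<longleftrightarrow> cone a"
  unfolding positive_def using cone_adj_mult by (metis cone_def)


section \<open>Norm estimates in modules with inner products\<close>

lemma hnorm_nonneg [simp]: "0 \<le> hnorm M x"
  by (simp add: hnorm_def)

text \<open>Positivity is left out so that the module of units fits: its inner product is defined by
  generators, and its norm inequalities come later as limits from the fibres.\<close>

locale sesquilinear_bimodule = bimodule +
  assumes ip_add_right:
      "x \<in> carrier M \<Longrightarrow> y \<in> carrier M \<Longrightarrow> z \<in> carrier M \<Longrightarrow> ip M x (y \<oplus> z) = ip M x y + ip M x z"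
    and ip_ract: "x \<in> carrier M \<Longrightarrow> y \<in> carrier M \<Longrightarrow> ip M x (ract M y b) = ip M x y * b"
    and ip_adj: "x \<in> carrier M \<Longrightarrow> y \<in> carrier M \<Longrightarrow> ip M y x = adj (ip M x y)"
begin

lemma ip_zero_right [simp]: "x \<in> carrier M \<Longrightarrow> ip M x \<zero> = 0"
  using ip_add_right[of x \<zero> \<zero>] by simp

lemma ip_a_inv_right: "x \<in> carrier M \<Longrightarrow> y \<in> carrier M \<Longrightarrow> ip M x (\<ominus> y) = - ip M x y"
  using ip_add_right[of x y "\<ominus> y"] by (simp add: r_neg eq_neg_iff_add_eq_0 add.commute)

lemma ip_minus_right:
  "x \<in> carrier M \<Longrightarrow> y \<in> carrier M \<Longrightarrow> z \<in> carrier M \<Longrightarrow> ip M x (y \<ominus> z) = ip M x y - ip M x z"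
  by (simp add: a_minus_def ip_add_right ip_a_inv_right)

lemma ip_add_left:
  assumes "x \<in> carrier M" "y \<in> carrier M" "z \<in> carrier M"
  shows "ip M (x \<oplus> y) z = ip M x z + ip M y z"
  using ip_adj[of z "x \<oplus> y"] ip_adj[of z x] ip_adj[of z y] assms by (simp add: ip_add_right adj_add)

lemma ip_minus_left:
  assumes "x \<in> carrier M" "y \<in> carrier M" "z \<in> carrier M"
  shows "ip M (x \<ominus> y) z = ip M x z - ip M y z"
  using ip_adj[of z "x \<ominus> y"] ip_adj[of z x] ip_adj[of z y] assms by (simp add: ip_minus_right adj_diff)

lemma ip_zero_left [simp]: "x \<in> carrier M \<Longrightarrow> ip M \<zero> x = 0"
  using ip_adj[of x \<zero>] by simp

lemma ip_ract_left:
  assumes "x \<in> carrier M" "y \<in> carrier M"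
  shows "ip M (ract M x b) y = adj b * ip M x y"
  using ip_adj[of y "ract M x b"] ip_adj[of y x] assms by (simp add: ip_ract ract_closed adj_mult)

lemma ip_lact_add:
  assumes "x \<in> carrier M" "y \<in> carrier M"
  shows "ip M x (lact M (a + b) y) = ip M x (lact M a y) + ip M x (lact M b y)"
  using assms by (simp add: lact_add_left ip_add_right lact_closed)

lemma ip_lact_scaleC:
  assumes "x \<in> carrier M" "y \<in> carrier M"
  shows "ip M x (lact M (c *\<^sub>C b) y) = c *\<^sub>C ip M x (lact M b y)"
proof -
  have "lact M (c *\<^sub>C b) y = lact M (b * (c *\<^sub>C 1)) y" by (simp add: mult_scaleC_right)
  also have "\<dots> = ract M (lact M b y) (c *\<^sub>C 1)"
    using assms by (simp add: lact_mult lact_scalar lact_ract)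
  finally show ?thesis using assms by (simp add: ip_ract lact_closed mult_scaleC_right)
qed

lemma ip_lact_scaleR:
  assumes "x \<in> carrier M" "y \<in> carrier M"
  shows "ip M x (lact M (r *\<^sub>R b) y) = r *\<^sub>R ip M x (lact M b y)"
  using ip_lact_scaleC[OF assms] by (simp add: scaleR_eq_scaleC)

lemma hnorm_square: "(hnorm M x)\<^sup>2 = norm (ip M x x)"
  by (simp add: hnorm_def)

lemma hnorm_zero [simp]: "hnorm M \<zero> = 0"
  by (simp add: hnorm_def)

lemma hnorm_a_inv: "x \<in> carrier M \<Longrightarrow> hnorm M (\<ominus> x) = hnorm M x"
  using ip_minus_left[of \<zero> x "\<zero> \<ominus> x"] by (simp add: hnorm_def ip_minus_right a_minus_def ip_a_inv_right)

lemma minus_minus_swap: "x \<in> carrier M \<Longrightarrow> y \<in> carrier M \<Longrightarrow> x \<ominus> y = \<ominus> (y \<ominus> x)"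
  by (simp add: a_minus_def minus_add a_comm)

lemma hnorm_minus_commute: "x \<in> carrier M \<Longrightarrow> y \<in> carrier M \<Longrightarrow> hnorm M (x \<ominus> y) = hnorm M (y \<ominus> x)"
  using minus_minus_swap[of x y] hnorm_a_inv[of "y \<ominus> x"] by simp

lemma minus_add_cancel: "x \<in> carrier M \<Longrightarrow> y \<in> carrier M \<Longrightarrow> (x \<ominus> y) \<oplus> y = x"
  by (simp add: a_minus_def a_assoc l_neg)

lemma minus_zero_right: "x \<in> carrier M \<Longrightarrow> x \<ominus> \<zero> = x"
  by (simp add: a_minus_def add.inv_one)

lemma minus_add_minus:
  assumes "x \<in> carrier M" "y \<in> carrier M" "z \<in> carrier M"
  shows "(x \<ominus> y) \<oplus> (y \<ominus> z) = x \<ominus> z"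
  using assms by (simp add: a_minus_def a_assoc r_neg2 l_neg flip: a_assoc[of "\<ominus> y" y])

lemma hnorm_minus_square:
  assumes "x \<in> carrier M" "y \<in> carrier M"
  shows "(hnorm M (x \<ominus> y))\<^sup>2 = norm ((ip M x x - ip M x y) - (ip M y x - ip M y y))"
  using assms by (simp add: hnorm_square ip_minus_left ip_minus_right algebra_simps)

lemma hnorm_ract: "x \<in> carrier M \<Longrightarrow> hnorm M (ract M x b) \<le> hnorm M x * norm b"
proof -
  assume x: "x \<in> carrier M"
  have "norm (ip M (ract M x b) (ract M x b)) = norm (adj b * ip M x x * b)"
    using x by (simp add: ip_ract ip_ract_left ract_closed mult.assoc)
  also have "\<dots> \<le> norm (adj b) * norm (ip M x x) * norm b"
    by (intro order_trans[OF norm_mult_ineq] mult_right_mono norm_mult_ineq) auto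
  also have "\<dots> = (hnorm M x * norm b)\<^sup>2" by (simp add: power_mult_distrib hnorm_square) (simp add: power2_eq_square)
  finally show ?thesis by (simp add: hnorm_def real_le_lsqrt)
qed

end

text \<open>The two inequalities are axioms because they hold for different reasons: by positivity
  in Hilbert modules, as limits from the fibres in the module of units, by inheritance in its
  quotient.\<close>

locale semi_inner_bimodule = sesquilinear_bimodule +
  assumes ip_cauchy_schwarz: "x \<in> carrier M \<Longrightarrow> y \<in> carrier M \<Longrightarrow> norm (ip M x y) \<le> hnorm M x * hnorm M y"
    and hnorm_lact: "x \<in> carrier M \<Longrightarrow> hnorm M (lact M b x) \<le> norm b * hnorm M x"
begin

lemma hnorm_triangle:
  assumes "x \<in> carrier M" "y \<in> carrier M"
  shows "hnorm M (x \<oplus> y) \<le> hnorm M x + hnorm M y"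
proof -
  have "ip M (x \<oplus> y) (x \<oplus> y) = (ip M x x + ip M x y) + (ip M y x + ip M y y)"
    using assms by (simp add: ip_add_left ip_add_right algebra_simps)
  then have "norm (ip M (x \<oplus> y) (x \<oplus> y)) \<le> (norm (ip M x x) + norm (ip M x y)) + (norm (ip M y x) + norm (ip M y y))"
    by (simp only:) (intro order_trans[OF norm_triangle_ineq] add_mono norm_triangle_ineq)
  also have "\<dots> \<le> ((hnorm M x)\<^sup>2 + hnorm M x * hnorm M y) + (hnorm M y * hnorm M x + (hnorm M y)\<^sup>2)"
    using assms by (intro add_mono ip_cauchy_schwarz) (simp_all add: hnorm_square)
  also have "\<dots> = (hnorm M x + hnorm M y)\<^sup>2" by (simp add: power2_eq_square algebra_simps)
  finally show ?thesis by (simp add: hnorm_def real_le_lsqrt)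
qed

lemma hnorm_minus_triangle:
  assumes "x \<in> carrier M" "y \<in> carrier M" "z \<in> carrier M"
  shows "hnorm M (x \<ominus> z) \<le> hnorm M (x \<ominus> y) + hnorm M (y \<ominus> z)"
  using hnorm_triangle[of "x \<ominus> y" "y \<ominus> z"] assms by (simp add: minus_add_minus)

end

sublocale pre_hilbert_bimodule \<subseteq> sesquilinear_bimodule
  by unfold_locales (fact ip_add_right ip_ract ip_adj)+

context pre_hilbert_bimodule
begin

lemma cone_ip: "x \<in> carrier M \<Longrightarrow> cone (ip M x x)"
  using ip_positive positive_cone by blast

lemma ip_cauchy_schwarz_square:
  assumes x: "x \<in> carrier M" and y: "y \<in> carrier M"
  shows "(norm (ip M x y))\<^sup>2 \<le> norm (ip M x x) * norm (ip M y y)"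
proof -
  let ?w = "ip M x y" and ?p = "ip M x x" and ?r = "ip M y y"
  have key: "(norm ?w)\<^sup>2 \<le> t * norm ?r" if t: "norm ?p < t" for t
  proof -
    have t0: "t > 0" using t norm_ge_zero[of ?p] by linarith
    have "cone ((1/t) *\<^sub>R ?p)" using t0 x by (intro cone_scaleR cone_ip) auto
    moreover have "norm ((1/t) *\<^sub>R ?p) \<le> 1" using t t0 by (simp add: divide_simps)
    ultimately have "cone (1 - (1/t) *\<^sub>R ?p)" by (rule cone_one_minus)
    then obtain k where k: "adj k = k" "1 - (1/t) *\<^sub>R ?p = k * k" by (auto simp: cone_def)
    define w' where "w' = (1/t) *\<^sub>R ?w"
    \<comment> \<open>Expand the positive element \<open>ip M z z\<close>. With
      \<open>1 - ip M x x / t = k * k\<close> it shows that \<open>ip M y y\<close> exceeds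
      \<open>(adj w * w) / t\<close>, where \<open>w = ip M x y\<close>, by a sum of positive
      elements. At the end \<open>t\<close> decreases to the norm of
      \<open>ip M x x\<close>.\<close>
    define z where "z = ract M x w' \<ominus> y"
    have z: "z \<in> carrier M" using x y by (simp add: z_def ract_closed)
    have yx: "ip M y x = adj ?w" by (rule ip_adj[OF x y])
    have "ip M z z = adj w' * ?p * w' - adj w' * ?w - adj ?w * w' + ?r"
      using x y by (simp add: z_def ip_minus_left ip_minus_right ip_ract ip_ract_left ract_closed yx algebra_simps)
    moreover have "adj w' * ?w = (1/t) *\<^sub>R (adj ?w * ?w)" "adj ?w * w' = (1/t) *\<^sub>R (adj ?w * ?w)"
      by (simp_all add: w'_def adj_scaleR)
    moreover have "adj w' * ?p * w' = (1/t) *\<^sub>R (adj ?w * ?w) - (1/t) *\<^sub>R (adj (k * ?w) * (k * ?w))"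
    proof -
      have "(1/t) *\<^sub>R ?p = 1 - k * k" using k(2) by (simp add: algebra_simps)
      moreover have "adj ?w * (1 - k * k) * ?w = adj ?w * ?w - adj (k * ?w) * (k * ?w)"
        by (simp add: adj_mult k(1) algebra_simps)
      ultimately have "adj ?w * ((1/t) *\<^sub>R ?p) * ?w = adj ?w * ?w - adj (k * ?w) * (k * ?w)" by (simp only:)
      then show ?thesis by (simp add: w'_def adj_scaleR flip: scaleR_diff_right)
    qed
    ultimately have r: "?r = (1/t) *\<^sub>R (adj ?w * ?w) + (ip M z z + (1/t) *\<^sub>R (adj (k * ?w) * (k * ?w)))"
      by simp
    have "norm ((1/t) *\<^sub>R (adj ?w * ?w)) \<le> norm ?r"
      using t0 z by (subst r) (intro cone_norm_mono cone_add cone_scaleR cone_adj_mult cone_ip, auto)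
    then show ?thesis using t0 by (simp add: cstar_identity divide_simps mult.commute)
  qed
  have "((\<lambda>t. t * norm ?r) \<longlongrightarrow> norm ?p * norm ?r) (at_right (norm ?p))" by (intro tendsto_intros)
  moreover have "eventually (\<lambda>t. (norm ?w)\<^sup>2 \<le> t * norm ?r) (at_right (norm ?p))"
    using key by (auto simp: eventually_at_right_field intro: exI[of _ "norm ?p + 1"])
  ultimately show ?thesis by (intro tendsto_lowerbound) auto
qed

lemma ip_cauchy_schwarz:
  assumes "x \<in> carrier M" "y \<in> carrier M"
  shows "norm (ip M x y) \<le> hnorm M x * hnorm M y"
  using ip_cauchy_schwarz_square[OF assms]
  by (simp add: hnorm_def real_le_rsqrt flip: real_sqrt_mult)

text \<open>For \<open>t > norm b\<close> the positive element \<open>1 - (adj b * b) / t^2\<close>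
  is a square \<open>k * k\<close>; so \<open>ip M x x\<close> splits into the positive
  contributions of \<open>b x\<close>, scaled by \<open>1 / t^2\<close>, and of
  \<open>k x\<close>.\<close>

lemma hnorm_lact:
  assumes x: "x \<in> carrier M"
  shows "hnorm M (lact M b x) \<le> norm b * hnorm M x"
proof -
  have key: "norm (ip M (lact M b x) (lact M b x)) \<le> t\<^sup>2 * norm (ip M x x)" if t: "norm b < t" for t
  proof -
    have t0: "t > 0" using t norm_ge_zero[of b] by linarith
    let ?g = "(1/t\<^sup>2) *\<^sub>R (adj b * b)"
    have "cone ?g" using t0 by (intro cone_scaleR cone_adj_mult) auto
    moreover have "norm ?g \<le> 1"
      using t t0 by (simp add: cstar_identity divide_simps power_mono)
    ultimately have "cone (1 - ?g)" by (rule cone_one_minus)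
    then obtain k where k: "adj k = k" "1 - ?g = k * k" by (auto simp: cone_def)
    have "ip M x x = ip M x (lact M (?g + k * k) x)" using k(2) x by (simp add: lact_one flip: k(2))
    also have "\<dots> = (1/t\<^sup>2) *\<^sub>R ip M x (lact M (adj b * b) x) + ip M x (lact M (k * k) x)"
      using x by (simp add: ip_lact_add ip_lact_scaleR)
    also have "ip M x (lact M (adj b * b) x) = ip M (lact M b x) (lact M b x)"
      using x by (simp add: ip_lact lact_mult lact_closed)
    also have "ip M x (lact M (k * k) x) = ip M (lact M k x) (lact M k x)"
      using x k by (simp add: ip_lact lact_mult lact_closed)
    finally have "norm ((1/t\<^sup>2) *\<^sub>R ip M (lact M b x) (lact M b x)) \<le> norm (ip M x x)"
      using x t0 by (metis cone_norm_mono cone_scaleR cone_ip lact_closed zero_le_power2 divide_nonneg_nonneg zero_le_one)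
    then show ?thesis using t0 by (simp add: divide_simps mult.commute)
  qed
  have "((\<lambda>t. t\<^sup>2 * norm (ip M x x)) \<longlongrightarrow> (norm b)\<^sup>2 * norm (ip M x x)) (at_right (norm b))" by (intro tendsto_intros)
  moreover have "eventually (\<lambda>t. norm (ip M (lact M b x) (lact M b x)) \<le> t\<^sup>2 * norm (ip M x x)) (at_right (norm b))"
    using key by (auto simp: eventually_at_right_field intro: exI[of _ "norm b + 1"])
  ultimately have "norm (ip M (lact M b x) (lact M b x)) \<le> (norm b)\<^sup>2 * norm (ip M x x)"
    by (intro tendsto_lowerbound) auto
  also have "\<dots> = (norm b * hnorm M x)\<^sup>2" by (simp add: hnorm_square power_mult_distrib)
  finally show ?thesis by (simp add: hnorm_def real_le_lsqrt)
qed

end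

sublocale pre_hilbert_bimodule \<subseteq> semi_inner_bimodule
  by unfold_locales (fact ip_cauchy_schwarz hnorm_lact)+

context pre_hilbert_bimodule
begin

lemma hnorm_eq_0: "x \<in> carrier M \<Longrightarrow> hnorm M x = 0 \<Longrightarrow> x = \<zero>"
  by (simp add: hnorm_def ip_definite)

lemma eq_iff_hnorm_minus: "x \<in> carrier M \<Longrightarrow> y \<in> carrier M \<Longrightarrow> hnorm M (x \<ominus> y) = 0 \<Longrightarrow> x = y"
  using hnorm_eq_0[of "x \<ominus> y"] minus_add_cancel[of x y] by simp

lemma norm_ip_lact:
  assumes "x \<in> carrier M" "y \<in> carrier M"
  shows "norm (ip M x (lact M b y)) \<le> hnorm M x * hnorm M y * norm b"
proof -
  have "norm (ip M x (lact M b y)) \<le> hnorm M x * hnorm M (lact M b y)"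
    using assms by (intro ip_cauchy_schwarz lact_closed)
  also have "\<dots> \<le> hnorm M x * (norm b * hnorm M y)"
    using assms by (intro mult_left_mono hnorm_lact) auto
  finally show ?thesis by (simp add: mult.commute mult.left_commute)
qed

lemma h_lim_eqI:
  assumes "\<And>n. f n \<in> carrier M" "l \<in> carrier M" "h_tendsto M f l"
  shows "h_lim M f = l"
  unfolding h_lim_def
proof (rule the_equality)
  fix l' assume l': "l' \<in> carrier M \<and> h_tendsto M f l'"
  have "(\<lambda>n. hnorm M (f n \<ominus> l) + hnorm M (f n \<ominus> l')) \<longlonglongrightarrow> 0 + 0"
    using assms l' unfolding h_tendsto_def by (intro tendsto_add) auto
  moreover have "hnorm M (l' \<ominus> l) \<le> hnorm M (f n \<ominus> l) + hnorm M (f n \<ominus> l')" for n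
    using hnorm_minus_triangle[of l' "f n" l] hnorm_minus_commute[of l' "f n"] assms l' by simp
  ultimately have "hnorm M (l' \<ominus> l) \<le> 0" by (intro LIMSEQ_le_const) auto
  then show "l' = l" using assms l' by (intro eq_iff_hnorm_minus) (auto intro: antisym)
qed (use assms in auto)

lemma norm_ip_lact_diff:
  assumes "x \<in> carrier M" "y \<in> carrier M" "x' \<in> carrier M" "y' \<in> carrier M"
  shows "norm (ip M x (lact M b y) - ip M x' (lact M b y'))
    \<le> (hnorm M (x \<ominus> x') * hnorm M y + hnorm M x' * hnorm M (y \<ominus> y')) * norm b"
proof -
  have "lact M b (y \<ominus> y') = lact M b y \<ominus> lact M b y'"
  proof -
    have "lact M b (y \<ominus> y') \<oplus> lact M b y' = lact M b ((y \<ominus> y') \<oplus> y')"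
      using assms by (simp add: lact_add_right)
    also have "(y \<ominus> y') \<oplus> y' = y" using assms by (simp add: minus_add_cancel)
    finally show ?thesis using assms by (metis a_minus_def add.inv_solve_right lact_closed minus_closed)
  qed
  then have "ip M x (lact M b y) - ip M x' (lact M b y')
      = ip M (x \<ominus> x') (lact M b y) + ip M x' (lact M b (y \<ominus> y'))"
    using assms by (simp add: ip_minus_left ip_minus_right lact_closed)
  also have "norm \<dots> \<le> hnorm M (x \<ominus> x') * hnorm M y * norm b + hnorm M x' * hnorm M (y \<ominus> y') * norm b"
    using assms by (intro order_trans[OF norm_triangle_ineq] add_mono norm_ip_lact) auto
  finally show ?thesis by (simp add: algebra_simps)
qed

lemma hnorm_tendsto:
  assumes "\<And>n. f n \<in> carrier M" "l \<in> carrier M" "((\<lambda>n. hnorm M (f n \<ominus> l)) \<longlongrightarrow> 0) F"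
  shows "((\<lambda>n. hnorm M (f n)) \<longlongrightarrow> hnorm M l) F"
proof (rule Lim_null_comparison[THEN LIM_zero_cancel])
  have "\<bar>hnorm M (f n) - hnorm M l\<bar> \<le> hnorm M (f n \<ominus> l)" for n
    using hnorm_minus_triangle[of "f n" l \<zero>] hnorm_minus_triangle[of l "f n" \<zero>]
      hnorm_minus_commute[of l "f n"] assms by (simp add: minus_zero_right)
  then show "eventually (\<lambda>n. norm (hnorm M (f n) - hnorm M l) \<le> hnorm M (f n \<ominus> l)) F" by simp
qed (rule assms(3))

lemma ip_lact_tendsto:
  assumes "\<And>n. f n \<in> carrier M" "x \<in> carrier M" "((\<lambda>n. hnorm M (f n \<ominus> x)) \<longlongrightarrow> 0) F"
    and "\<And>n. g n \<in> carrier M" "y \<in> carrier M" "((\<lambda>n. hnorm M (g n \<ominus> y)) \<longlongrightarrow> 0) F"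
  shows "((\<lambda>n. ip M (f n) (lact M b (g n))) \<longlongrightarrow> ip M x (lact M b y)) F"
proof (rule Lim_null_comparison[THEN LIM_zero_cancel])
  show "eventually (\<lambda>n. norm (ip M (f n) (lact M b (g n)) - ip M x (lact M b y))
      \<le> (hnorm M (f n \<ominus> x) * hnorm M (g n) + hnorm M x * hnorm M (g n \<ominus> y)) * norm b) F"
    using assms by (intro always_eventually allI norm_ip_lact_diff)
  have "((\<lambda>n. (hnorm M (f n \<ominus> x) * hnorm M (g n) + hnorm M x * hnorm M (g n \<ominus> y)) * norm b)
      \<longlongrightarrow> (0 * hnorm M y + hnorm M x * 0) * norm b) F"
    using assms by (intro tendsto_intros hnorm_tendsto)
  then show "((\<lambda>n. (hnorm M (f n \<ominus> x) * hnorm M (g n) + hnorm M x * hnorm M (g n \<ominus> y)) * norm b) \<longlongrightarrow> 0) F"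
    by simp
qed

end

section \<open>Products of near-identity operators\<close>

text \<open>Each factor is bounded by \<open>1 + (\<alpha> + \<epsilon>) s\<close>, so the product
  has an exponential majorant; removing the first-order part \<open>1 + \<alpha> S\<close> leaves
  the second-order terms and the accumulated errors. In this closed form the bound reproduces itself
  under induction.\<close>

lemma fold_first_order:
  fixes A :: "'a::real_normed_vector \<Rightarrow> 'a"
  assumes A: "bounded_linear A" "\<And>b. norm (A b) \<le> \<alpha> * norm b" and nn: "0 \<le> \<alpha>" "0 \<le> \<epsilon>"
    and "\<And>i. i \<in> set is \<Longrightarrow> 0 \<le> s i"
    and "\<And>i b. i \<in> set is \<Longrightarrow> norm (\<phi> i b - b - s i *\<^sub>R A b) \<le> \<epsilon> * s i * norm b"
  shows "norm (fold \<phi> is b - b - sum_list (map s is) *\<^sub>R A b)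
    \<le> (exp ((\<alpha> + \<epsilon>) * sum_list (map s is)) - 1 - \<alpha> * sum_list (map s is)) * norm b"
  using assms(5,6)
proof (induction "is" arbitrary: b)
  case (Cons i "is")
  interpret A: bounded_linear A by (rule A(1))
  define r where "r = s i"
  define S where "S = sum_list (map s is)"
  define \<gamma> where "\<gamma> = \<alpha> + \<epsilon>"
  define e where "e = \<phi> i b - b - r *\<^sub>R A b"
  have r: "0 \<le> r" and S: "0 \<le> S" using Cons.prems by (auto simp: r_def S_def intro!: sum_list_nonneg)
  have e: "norm e \<le> \<epsilon> * r * norm b" using Cons.prems(2)[of i b] by (simp add: e_def r_def)
  have \<phi>: "\<phi> i b = b + r *\<^sub>R A b + e" by (simp add: e_def)
  have diff: "norm (r *\<^sub>R A b + e) \<le> \<gamma> * r * norm b"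
  proof -
    have "norm (r *\<^sub>R A b) \<le> r * (\<alpha> * norm b)" using A(2) r by (simp add: mult_left_mono)
    then show ?thesis using norm_triangle_ineq[of "r *\<^sub>R A b" e] e by (simp add: \<gamma>_def algebra_simps)
  qed
  have n: "norm (\<phi> i b) \<le> (1 + \<gamma> * r) * norm b"
    using norm_triangle_ineq[of b "r *\<^sub>R A b + e"] diff by (simp add: \<phi> add.assoc algebra_simps)
  define X where "X = exp (\<gamma> * S) - 1 - \<alpha> * S"
  have X: "0 \<le> X"
  proof -
    have "1 + \<gamma> * S \<le> exp (\<gamma> * S)" by (rule exp_ge_add_one_self)
    moreover have "\<alpha> * S \<le> \<gamma> * S" using S nn by (simp add: \<gamma>_def mult_right_mono)
    ultimately show ?thesis unfolding X_def by linarith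
  qed
  have "fold \<phi> (i # is) b - b - (r + S) *\<^sub>R A b
      = (fold \<phi> is (\<phi> i b) - \<phi> i b - S *\<^sub>R A (\<phi> i b)) + (e + S *\<^sub>R A (r *\<^sub>R A b + e))"
    by (simp add: \<phi> A.add algebra_simps)
  also have "norm \<dots> \<le> X * ((1 + \<gamma> * r) * norm b) + (\<epsilon> * r * norm b + S * (\<alpha> * (\<gamma> * r * norm b)))"
  proof (intro order_trans[OF norm_triangle_ineq] add_mono)
    have "norm (fold \<phi> is (\<phi> i b) - \<phi> i b - S *\<^sub>R A (\<phi> i b)) \<le> X * norm (\<phi> i b)"
      unfolding X_def S_def \<gamma>_def using Cons.prems by (intro Cons.IH) auto
    also have "\<dots> \<le> X * ((1 + \<gamma> * r) * norm b)" by (rule mult_left_mono[OF n X])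
    finally show "norm (fold \<phi> is (\<phi> i b) - \<phi> i b - S *\<^sub>R A (\<phi> i b)) \<le> X * ((1 + \<gamma> * r) * norm b)" .
    have "norm (A (r *\<^sub>R A b + e)) \<le> \<alpha> * (\<gamma> * r * norm b)"
      using order_trans[OF A(2) mult_left_mono[OF diff nn(1)]] .
    then show "norm (S *\<^sub>R A (r *\<^sub>R A b + e)) \<le> S * (\<alpha> * (\<gamma> * r * norm b))"
      using S by (simp add: mult_left_mono)
  qed (rule e)
  also have "\<dots> = (exp (\<gamma> * S) * (1 + \<gamma> * r) - 1 - \<alpha> * (r + S)) * norm b"
    by (simp add: X_def \<gamma>_def algebra_simps)
  also have "\<dots> \<le> (exp (\<gamma> * (r + S)) - 1 - \<alpha> * (r + S)) * norm b"
  proof -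
    have "exp (\<gamma> * S) * (1 + \<gamma> * r) \<le> exp (\<gamma> * S) * exp (\<gamma> * r)"
      by (intro mult_left_mono exp_ge_add_one_self) auto
    then show ?thesis by (intro mult_right_mono) (auto simp: exp_add[symmetric] algebra_simps)
  qed
  finally show ?case by (simp add: r_def S_def \<gamma>_def)
qed simp

text \<open>Factors are exchanged one at a time: the error made at the first factor is carried on by
  the remaining \<open>\<psi>\<close>, hence the additivity of \<open>\<psi>\<close>, and the rest
  is the induction hypothesis.\<close>

lemma fold_compare:
  fixes \<phi> \<psi> :: "'i \<Rightarrow> 'a::real_normed_vector \<Rightarrow> 'a"
  assumes "0 \<le> \<eta>" "\<And>i. i \<in> set is \<Longrightarrow> 0 \<le> s i"
    and "\<And>i b. i \<in> set is \<Longrightarrow> norm (\<phi> i b) \<le> exp (M * s i) * norm b"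
    and "\<And>i b. i \<in> set is \<Longrightarrow> norm (\<psi> i b) \<le> exp (M * s i) * norm b"
    and "\<And>i b c. i \<in> set is \<Longrightarrow> \<psi> i (b - c) = \<psi> i b - \<psi> i c"
    and "\<And>i b. i \<in> set is \<Longrightarrow> norm (\<phi> i b - \<psi> i b) \<le> \<eta> * s i * norm b"
    and "0 \<le> M"
  shows "norm (fold \<phi> is b - fold \<psi> is b)
    \<le> \<eta> * sum_list (map s is) * exp (M * sum_list (map s is)) * norm b"
  using assms(2-6)
proof (induction "is" arbitrary: b)
  case (Cons i "is")
  define r where "r = s i"
  define S where "S = sum_list (map s is)"
  have r: "0 \<le> r" and S: "0 \<le> S" using Cons.prems by (auto simp: r_def S_def intro!: sum_list_nonneg)
  have bd: "norm (fold \<psi> js b) \<le> exp (M * sum_list (map s js)) * norm b" if "set js \<subseteq> set is" for js b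
    using that
  proof (induction js arbitrary: b)
    case (Cons j js)
    have "norm (fold \<psi> js (\<psi> j b)) \<le> exp (M * sum_list (map s js)) * norm (\<psi> j b)" using Cons by auto
    also have "\<dots> \<le> exp (M * sum_list (map s js)) * (exp (M * s j) * norm b)"
      using Cons.prems \<open>\<And>i b. i \<in> set (_ # is) \<Longrightarrow> norm (\<psi> i b) \<le> _\<close> by (intro mult_left_mono) auto
    finally show ?case by (simp add: exp_add algebra_simps)
  qed simp
  have lin: "fold \<psi> js (b - c) = fold \<psi> js b - fold \<psi> js c" if "set js \<subseteq> set is" for js b c
    using that by (induction js arbitrary: b c) (use Cons.prems(4) in auto)
  have "fold \<phi> (i # is) b - fold \<psi> (i # is) b
      = (fold \<phi> is (\<phi> i b) - fold \<psi> is (\<phi> i b)) + fold \<psi> is (\<phi> i b - \<psi> i b)"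
    by (simp add: lin)
  also have "norm \<dots> \<le> \<eta> * S * exp (M * S) * (exp (M * r) * norm b) + exp (M * S) * (\<eta> * r * (exp (M * r) * norm b))"
  proof (intro order_trans[OF norm_triangle_ineq] add_mono)
    have "norm (fold \<phi> is (\<phi> i b) - fold \<psi> is (\<phi> i b)) \<le> \<eta> * S * exp (M * S) * norm (\<phi> i b)"
      unfolding S_def using Cons.prems by (intro Cons.IH) auto
    also have "\<dots> \<le> \<eta> * S * exp (M * S) * (exp (M * r) * norm b)"
      using Cons.prems(2)[of i b] assms(1) S by (intro mult_left_mono) (auto simp: r_def)
    finally show "norm (fold \<phi> is (\<phi> i b) - fold \<psi> is (\<phi> i b)) \<le> \<eta> * S * exp (M * S) * (exp (M * r) * norm b)" .
    have "norm (fold \<psi> is (\<phi> i b - \<psi> i b)) \<le> exp (M * S) * norm (\<phi> i b - \<psi> i b)"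
      using bd[of "is"] by (simp add: S_def)
    also have "\<dots> \<le> exp (M * S) * (\<eta> * r * norm b)"
      using Cons.prems(5)[of i b] by (simp add: r_def)
    also have "\<dots> \<le> exp (M * S) * (\<eta> * r * (exp (M * r) * norm b))"
    proof -
      have "1 * norm b \<le> exp (M * r) * norm b" using r assms(7) by (intro mult_right_mono) auto
      then show ?thesis using r assms(1) by (intro mult_left_mono) auto
    qed
    finally show "norm (fold \<psi> is (\<phi> i b - \<psi> i b)) \<le> exp (M * S) * (\<eta> * r * (exp (M * r) * norm b))" .
  qed
  also have "\<dots> = \<eta> * (r + S) * exp (M * (r + S)) * norm b" by (simp add: exp_add algebra_simps)
  finally show ?case by (simp add: r_def S_def)
qed simp

lemma norm_first_order_le_exp:
  fixes A :: "'a::real_normed_vector \<Rightarrow> 'a"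
  assumes "norm (z - b - s *\<^sub>R A b) \<le> \<epsilon> * s * norm b" "norm (A b) \<le> \<alpha> * norm b" "0 \<le> s"
  shows "norm z \<le> exp ((\<alpha> + \<epsilon>) * s) * norm b"
proof -
  have "norm (s *\<^sub>R A b) \<le> s * (\<alpha> * norm b)" using assms by (simp add: mult_left_mono)
  moreover have "z = (z - b - s *\<^sub>R A b) + (b + s *\<^sub>R A b)" by simp
  then have "norm z \<le> norm (z - b - s *\<^sub>R A b) + (norm b + norm (s *\<^sub>R A b))"
    by (metis norm_triangle_mono norm_triangle_ineq order_refl)
  ultimately have "norm z \<le> (1 + (\<alpha> + \<epsilon>) * s) * norm b" using assms(1) by (simp add: algebra_simps)
  also have "\<dots> \<le> exp ((\<alpha> + \<epsilon>) * s) * norm b" by (intro mult_right_mono exp_ge_add_one_self) auto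
  finally show ?thesis .
qed

text \<open>Used with \<open>\<eta> = 0\<close> to compare tensor products along partitions, and
  with arbitrarily small \<open>\<epsilon>\<close> to compare semigroups whose generators are
  close.\<close>

lemma fold_compare_first_order:
  fixes \<phi> \<psi> :: "'i \<Rightarrow> 'a::real_normed_vector \<Rightarrow> 'a"
  assumes s: "\<And>i. i \<in> set is \<Longrightarrow> 0 \<le> s i" and nn: "0 \<le> \<eta>" "0 \<le> \<epsilon>" "0 \<le> M"
    and \<phi>: "\<And>i b. i \<in> set is \<Longrightarrow> norm (\<phi> i b - b - s i *\<^sub>R A b) \<le> \<epsilon> * s i * norm b"
    and \<psi>: "\<And>i b. i \<in> set is \<Longrightarrow> norm (\<psi> i b - b - s i *\<^sub>R B b) \<le> \<epsilon> * s i * norm b"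
    and lin: "\<And>i. i \<in> set is \<Longrightarrow> linear (\<psi> i)"
    and A: "\<And>b. norm (A b) \<le> M * norm b" and B: "\<And>b. norm (B b) \<le> M * norm b"
    and AB: "\<And>b. norm (A b - B b) \<le> \<eta> * norm b"
  shows "norm (fold \<phi> is b - fold \<psi> is b)
    \<le> (\<eta> + 2 * \<epsilon>) * sum_list (map s is) * exp ((M + \<epsilon>) * sum_list (map s is)) * norm b"
proof (rule fold_compare)
  fix i b c assume i: "i \<in> set is"
  show "norm (\<phi> i b) \<le> exp ((M + \<epsilon>) * s i) * norm b"
    by (rule norm_first_order_le_exp[where A=A, OF \<phi>[OF i] A s[OF i]])
  show "norm (\<psi> i b) \<le> exp ((M + \<epsilon>) * s i) * norm b"
    by (rule norm_first_order_le_exp[where A=B, OF \<psi>[OF i] B s[OF i]])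
  show "\<psi> i (b - c) = \<psi> i b - \<psi> i c" by (rule linear_diff[OF lin[OF i]])
  have eq: "\<phi> i b - \<psi> i b = ((\<phi> i b - b - s i *\<^sub>R A b) - (\<psi> i b - b - s i *\<^sub>R B b)) + s i *\<^sub>R (A b - B b)"
    by (simp add: algebra_simps)
  have "norm (s i *\<^sub>R (A b - B b)) \<le> s i * (\<eta> * norm b)" using AB s[OF i] by (simp add: mult_left_mono)
  then have "norm (\<phi> i b - \<psi> i b) \<le> (\<epsilon> * s i * norm b + \<epsilon> * s i * norm b) + s i * (\<eta> * norm b)"
    unfolding eq by (intro order_trans[OF norm_triangle_ineq] add_mono order_trans[OF norm_triangle_ineq4] \<phi>[OF i] \<psi>[OF i])
  then show "norm (\<phi> i b - \<psi> i b) \<le> (\<eta> + 2 * \<epsilon>) * s i * norm b" by (simp add: algebra_simps)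
qed (use nn s in auto)

lemma exp_first_order_bound:
  fixes \<alpha> \<epsilon> :: real
  assumes "0 \<le> \<alpha>" "0 < \<epsilon>"
  obtains \<delta> where "0 < \<delta>" "\<And>s. 0 \<le> s \<Longrightarrow> s \<le> \<delta> \<Longrightarrow> exp ((\<alpha> + \<epsilon>) * s) - 1 - \<alpha> * s \<le> 2 * \<epsilon> * s"
proof -
  define \<gamma> where "\<gamma> = \<alpha> + \<epsilon>"
  have \<gamma>: "\<gamma> > 0" using assms by (simp add: \<gamma>_def)
  \<comment> \<open>The first bound permits the quadratic estimate of \<open>exp\<close>, the second
    turns the quadratic term into at most \<open>\<epsilon> * s\<close>.\<close>
  define \<delta> where "\<delta> = min (1 / \<gamma>) (\<epsilon> / \<gamma>\<^sup>2)"
  have "0 < \<delta>" using \<gamma> assms by (simp add: \<delta>_def)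
  moreover have "exp (\<gamma> * s) - 1 - \<alpha> * s \<le> 2 * \<epsilon> * s" if s: "0 \<le> s" "s \<le> \<delta>" for s
  proof -
    have "\<gamma> * s \<le> 1" "\<gamma>\<^sup>2 * s \<le> \<epsilon>" using s \<gamma> by (auto simp: \<delta>_def field_simps)
    then have "exp (\<gamma> * s) \<le> 1 + \<gamma> * s + (\<gamma> * s)\<^sup>2" using s \<gamma> by (intro exp_bound) auto
    moreover have "(\<gamma> * s)\<^sup>2 \<le> \<epsilon> * s"
      using mult_right_mono[OF \<open>\<gamma>\<^sup>2 * s \<le> \<epsilon>\<close> s(1)] by (simp add: power2_eq_square algebra_simps)
    ultimately show ?thesis by (simp add: \<gamma>_def algebra_simps)
  qed
  ultimately show ?thesis using that by (simp add: \<gamma>_def)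
qed

section \<open>Matrix elements of product systems\<close>

text \<open>For units this is the kernel at time \<open>t\<close>. Tensor products of vectors turn
  into compositions of these maps (\<open>mel_prd\<close>), which reduces norm questions in the
  fibres to products of operators on the algebra.\<close>

definition mel :: "('b::unital_cstar_algebra, 'e) prodsys \<Rightarrow> real \<Rightarrow> 'e \<Rightarrow> 'e \<Rightarrow> 'b \<Rightarrow> 'b" where
  "mel E t x y b = ip (fibre E t) x (lact (fibre E t) b y)"

definition hdist :: "('b::unital_cstar_algebra, 'e) prodsys \<Rightarrow> real \<Rightarrow> 'e \<Rightarrow> 'e \<Rightarrow> real" where
  "hdist E t x y = hnorm (fibre E t) (x \<ominus>\<^bsub>fibre E t\<^esub> y)"

text \<open>Factors carry their times, since \<open>prd\<close> depends on them; this allows unequal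
  parts. The power \<open>tensor_power\<close>, nested to the left, is the case of equal parts
  (\<open>tensor_power_eq_tens\<close>).\<close>

primrec tens :: "('b::unital_cstar_algebra, 'e) prodsys \<Rightarrow> (real \<times> 'e) list \<Rightarrow> 'e" where
  "tens E [] = triv E 1"
| "tens E (p # ps) = prd E (fst p) (sum_list (map fst ps)) (snd p) (tens E ps)"

definition timed :: "('b::unital_cstar_algebra, 'e) prodsys \<Rightarrow> (real \<times> 'e) list \<Rightarrow> bool" where
  "timed E ps \<longleftrightarrow> (\<forall>p\<in>set ps. 0 \<le> fst p \<and> snd p \<in> carrier (fibre E (fst p)))"

lemma timed_simps [simp]:
  "timed E []"
  "timed E (p # ps) \<longleftrightarrow> 0 \<le> fst p \<and> snd p \<in> carrier (fibre E (fst p)) \<and> timed E ps"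
  "timed E (ps @ qs) \<longleftrightarrow> timed E ps \<and> timed E qs"
  "timed E (concat pss) \<longleftrightarrow> (\<forall>ps\<in>set pss. timed E ps)"
  by (auto simp: timed_def)

lemma timed_sum_nonneg: "timed E ps \<Longrightarrow> 0 \<le> sum_list (map fst ps)"
  by (auto simp: timed_def intro!: sum_list_nonneg)

context product_system
begin

lemma pre: "0 \<le> t \<Longrightarrow> pre_hilbert_bimodule (fibre E t)"
  using hilbert hilbert_bimodule.axioms(1) by blast

lemma bim: "0 \<le> t \<Longrightarrow> bimodule (fibre E t)"
  using pre pre_hilbert_bimodule.axioms(1) by blast

lemma rmod: "0 \<le> t \<Longrightarrow> right_module (fibre E t)"
  using bim bimodule.axioms(1) by blast

lemma abg: "0 \<le> t \<Longrightarrow> abelian_group (fibre E t)"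
  using rmod right_module.axioms(1) by blast

lemma tensD:
  assumes "0 \<le> t" "0 \<le> s"
  shows prd_closed: "u \<in> carrier (fibre E t) \<Longrightarrow> v \<in> carrier (fibre E s) \<Longrightarrow> prd E t s u v \<in> carrier (fibre E (t + s))"
    and prd_add_left: "u \<in> carrier (fibre E t) \<Longrightarrow> u' \<in> carrier (fibre E t) \<Longrightarrow> v \<in> carrier (fibre E s) \<Longrightarrow>
      prd E t s (u \<oplus>\<^bsub>fibre E t\<^esub> u') v = prd E t s u v \<oplus>\<^bsub>fibre E (t + s)\<^esub> prd E t s u' v"
    and prd_add_right: "u \<in> carrier (fibre E t) \<Longrightarrow> v \<in> carrier (fibre E s) \<Longrightarrow> v' \<in> carrier (fibre E s) \<Longrightarrow>
      prd E t s u (v \<oplus>\<^bsub>fibre E s\<^esub> v') = prd E t s u v \<oplus>\<^bsub>fibre E (t + s)\<^esub> prd E t s u v'"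
    and prd_lact: "u \<in> carrier (fibre E t) \<Longrightarrow> v \<in> carrier (fibre E s) \<Longrightarrow>
      prd E t s (lact (fibre E t) b u) v = lact (fibre E (t + s)) b (prd E t s u v)"
    and prd_ip: "u \<in> carrier (fibre E t) \<Longrightarrow> u' \<in> carrier (fibre E t) \<Longrightarrow> v \<in> carrier (fibre E s) \<Longrightarrow> v' \<in> carrier (fibre E s) \<Longrightarrow>
      ip (fibre E (t + s)) (prd E t s u v) (prd E t s u' v') = ip (fibre E s) v (lact (fibre E s) (ip (fibre E t) u u') v')"
  using tensor[OF assms] unfolding inner_tensor_def by simp_all

lemma triv_closed: "triv E b \<in> carrier (fibre E 0)"
  using triv_bij by (auto simp: bij_betw_def)

lemma mel_prd:
  assumes "0 \<le> t" "0 \<le> s" "u \<in> carrier (fibre E t)" "u' \<in> carrier (fibre E t)"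
    "v \<in> carrier (fibre E s)" "v' \<in> carrier (fibre E s)"
  shows "mel E (t + s) (prd E t s u v) (prd E t s u' v') b = mel E s v v' (mel E t u u' b)"
proof -
  have "lact (fibre E t) b u' \<in> carrier (fibre E t)" using bimodule.lact_closed[OF bim] assms by blast
  then show ?thesis using assms by (simp add: mel_def prd_ip flip: prd_lact)
qed

lemma mel_triv: "mel E 0 (triv E a) (triv E c) b = adj a * (b * c)"
  by (simp add: mel_def triv_ip flip: triv_lact)

context
  fixes t :: real
  assumes t: "0 \<le> t"
begin

interpretation M: pre_hilbert_bimodule "fibre E t" by (rule pre[OF t])

lemma mel_add: 
  assumes "x \<in> carrier (fibre E t)" "y \<in> carrier (fibre E t)"
  shows "mel E t x y (a + b) = mel E t x y a + mel E t x y b"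
  using assms by (simp add: mel_def M.ip_lact_add)

lemma mel_scaleR: 
  assumes "x \<in> carrier (fibre E t)" "y \<in> carrier (fibre E t)"
  shows "mel E t x y (r *\<^sub>R b) = r *\<^sub>R mel E t x y b"
  using assms by (simp add: mel_def M.ip_lact_scaleR)

lemma mel_scaleC: 
  assumes "x \<in> carrier (fibre E t)" "y \<in> carrier (fibre E t)"
  shows "mel E t x y (c *\<^sub>C b) = c *\<^sub>C mel E t x y b"
  using assms by (simp add: mel_def M.ip_lact_scaleC)

lemma norm_mel:
  assumes "x \<in> carrier (fibre E t)" "y \<in> carrier (fibre E t)"
  shows "norm (mel E t x y b) \<le> hnorm (fibre E t) x * hnorm (fibre E t) y * norm b"
  using assms by (simp add: mel_def M.norm_ip_lact)

lemma bounded_linear_mel: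
  assumes "x \<in> carrier (fibre E t)" "y \<in> carrier (fibre E t)"
  shows "bounded_linear (mel E t x y)"
  using norm_mel[OF assms] mel_add[OF assms] mel_scaleR[OF assms]
  by (intro bounded_linear_intro[where K = "hnorm (fibre E t) x * hnorm (fibre E t) y"]) (auto simp: mult.commute)

lemma linear_mel: "x \<in> carrier (fibre E t) \<Longrightarrow> y \<in> carrier (fibre E t) \<Longrightarrow> linear (mel E t x y)"
  by (intro bounded_linear.linear bounded_linear_mel)

lemma adj_mel:
  assumes "x \<in> carrier (fibre E t)" "y \<in> carrier (fibre E t)"
  shows "adj (mel E t x y b) = mel E t y x (adj b)"
  using assms M.ip_adj[of x "lact (fibre E t) b y"] M.ip_lact[of y x b]
  by (simp add: mel_def M.lact_closed flip: M.ip_adj)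

lemma mel_lact_left:
  assumes "x \<in> carrier (fibre E t)" "y \<in> carrier (fibre E t)"
  shows "mel E t (lact (fibre E t) a x) y b = mel E t x y (adj a * b)"
  using assms by (simp add: mel_def M.ip_lact M.lact_closed M.lact_mult)

lemma mel_ract_left:
  assumes "x \<in> carrier (fibre E t)" "y \<in> carrier (fibre E t)"
  shows "mel E t (ract (fibre E t) x a) y b = adj a * mel E t x y b"
  using assms by (simp add: mel_def M.ip_ract_left M.lact_closed)

lemma mel_add_left:
  assumes "x \<in> carrier (fibre E t)" "x' \<in> carrier (fibre E t)" "y \<in> carrier (fibre E t)"
  shows "mel E t (x \<oplus>\<^bsub>fibre E t\<^esub> x') y b = mel E t x y b + mel E t x' y b"
  using assms by (simp add: mel_def M.ip_add_left M.lact_closed)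

lemma mel_minus_left:
  assumes "x \<in> carrier (fibre E t)" "x' \<in> carrier (fibre E t)" "y \<in> carrier (fibre E t)"
  shows "mel E t (x \<ominus>\<^bsub>fibre E t\<^esub> x') y b = mel E t x y b - mel E t x' y b"
  using assms by (simp add: mel_def M.ip_minus_left M.lact_closed)

lemma norm_mel_diff:
  assumes "x \<in> carrier (fibre E t)" "y \<in> carrier (fibre E t)" "x' \<in> carrier (fibre E t)" "y' \<in> carrier (fibre E t)"
  shows "norm (mel E t x y b - mel E t x' y' b)
    \<le> (hdist E t x x' * hnorm (fibre E t) y + hnorm (fibre E t) x' * hdist E t y y') * norm b"
  using assms by (simp add: mel_def hdist_def M.norm_ip_lact_diff)

lemma mel_tendsto:
  assumes "\<And>n. f n \<in> carrier (fibre E t)" "x \<in> carrier (fibre E t)" "((\<lambda>n. hdist E t (f n) x) \<longlongrightarrow> 0) F"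
    and "\<And>n. g n \<in> carrier (fibre E t)" "y \<in> carrier (fibre E t)" "((\<lambda>n. hdist E t (g n) y) \<longlongrightarrow> 0) F"
  shows "((\<lambda>n. mel E t (f n) (g n) b) \<longlongrightarrow> mel E t x y b) F"
  using assms by (simp add: mel_def hdist_def M.ip_lact_tendsto)

text \<open>Grouped so that each difference keeps the left vector and exchanges the right one; such
  differences are what comparisons of kernels bound.\<close>

lemma hdist_square:
  assumes "x \<in> carrier (fibre E t)" "y \<in> carrier (fibre E t)"
  shows "(hdist E t x y)\<^sup>2 = norm ((mel E t x x 1 - mel E t x y 1) - (mel E t y x 1 - mel E t y y 1))"
  using assms by (simp add: mel_def hdist_def M.hnorm_minus_square M.lact_one)

lemma hdist_commute:
  "x \<in> carrier (fibre E t) \<Longrightarrow> y \<in> carrier (fibre E t) \<Longrightarrow> hdist E t x y = hdist E t y x"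
  by (simp add: hdist_def M.hnorm_minus_commute)

lemma hdist_triangle:
  "x \<in> carrier (fibre E t) \<Longrightarrow> y \<in> carrier (fibre E t) \<Longrightarrow> z \<in> carrier (fibre E t) \<Longrightarrow>
    hdist E t x z \<le> hdist E t x y + hdist E t y z"
  by (simp add: hdist_def M.hnorm_minus_triangle)

lemma hdist_nonneg [simp]: "0 \<le> hdist E t x y"
  by (simp add: hdist_def)

lemma hdist_eq_0: "x \<in> carrier (fibre E t) \<Longrightarrow> y \<in> carrier (fibre E t) \<Longrightarrow> hdist E t x y = 0 \<Longrightarrow> x = y"
  by (simp add: hdist_def M.eq_iff_hnorm_minus)

lemma hdist_self [simp]: "x \<in> carrier (fibre E t) \<Longrightarrow> hdist E t x x = 0"
  by (simp add: hdist_def a_minus_def M.r_neg)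

lemma hnorm_square_mel: "x \<in> carrier (fibre E t) \<Longrightarrow> (hnorm (fibre E t) x)\<^sup>2 = norm (mel E t x x 1)"
  by (simp add: mel_def M.hnorm_square M.lact_one)

lemma hnorm_le_hdist:
  assumes "x \<in> carrier (fibre E t)" "y \<in> carrier (fibre E t)"
  shows "hnorm (fibre E t) x \<le> hdist E t x y + hnorm (fibre E t) y"
  using M.hnorm_triangle[of "x \<ominus>\<^bsub>fibre E t\<^esub> y" y] assms by (simp add: hdist_def M.minus_add_cancel)

end

lemma hnorm_prd:
  assumes "0 \<le> t" "0 \<le> s" "u \<in> carrier (fibre E t)" "v \<in> carrier (fibre E s)"
  shows "hnorm (fibre E (t + s)) (prd E t s u v) \<le> hnorm (fibre E t) u * hnorm (fibre E s) v"
proof -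
  have "(hnorm (fibre E (t + s)) (prd E t s u v))\<^sup>2 = norm (mel E s v v (mel E t u u 1))"
    using assms by (simp add: hnorm_square_mel prd_closed mel_prd)
  also have "\<dots> \<le> hnorm (fibre E s) v * hnorm (fibre E s) v * norm (mel E t u u 1)"
    using assms by (intro norm_mel)
  also have "\<dots> = (hnorm (fibre E t) u * hnorm (fibre E s) v)\<^sup>2"
    using assms by (simp add: power_mult_distrib hnorm_square_mel[symmetric]) (simp add: power2_eq_square)
  finally show ?thesis using assms hnorm_nonneg by (meson mult_nonneg_nonneg power2_le_imp_le)
qed

lemma hdist_prd:
  assumes ts: "0 \<le> t" "0 \<le> s" and u: "u \<in> carrier (fibre E t)" "u' \<in> carrier (fibre E t)"
    and v: "v \<in> carrier (fibre E s)" "v' \<in> carrier (fibre E s)"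
  shows "hdist E (t + s) (prd E t s u v) (prd E t s u' v')
    \<le> hdist E t u u' * hnorm (fibre E s) v + hnorm (fibre E t) u' * hdist E s v v'"
proof -
  interpret T: pre_hilbert_bimodule "fibre E t" by (rule pre[OF ts(1)])
  interpret S: pre_hilbert_bimodule "fibre E s" by (rule pre[OF ts(2)])
  interpret R: pre_hilbert_bimodule "fibre E (t + s)" by (rule pre) (use ts in simp)
  have c: "prd E t s a b \<in> carrier (fibre E (t + s))" if "a \<in> carrier (fibre E t)" "b \<in> carrier (fibre E s)" for a b
    using that ts prd_closed by blast
  have 1: "prd E t s u v \<ominus>\<^bsub>fibre E (t + s)\<^esub> prd E t s u' v = prd E t s (u \<ominus>\<^bsub>fibre E t\<^esub> u') v"
  proof -
    have "prd E t s (u \<ominus>\<^bsub>fibre E t\<^esub> u') v \<oplus>\<^bsub>fibre E (t + s)\<^esub> prd E t s u' v = prd E t s u v"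
      using ts u v by (simp add: T.minus_add_cancel flip: prd_add_left)
    then show ?thesis using c u v by (metis T.minus_closed R.minus_eq R.add.inv_solve_right)
  qed
  have 2: "prd E t s u' v \<ominus>\<^bsub>fibre E (t + s)\<^esub> prd E t s u' v' = prd E t s u' (v \<ominus>\<^bsub>fibre E s\<^esub> v')"
  proof -
    have "prd E t s u' (v \<ominus>\<^bsub>fibre E s\<^esub> v') \<oplus>\<^bsub>fibre E (t + s)\<^esub> prd E t s u' v' = prd E t s u' v"
      using ts u v by (simp add: S.minus_add_cancel flip: prd_add_right)
    then show ?thesis using c u v by (metis S.minus_closed R.minus_eq R.add.inv_solve_right)
  qed
  have "hdist E (t + s) (prd E t s u v) (prd E t s u' v')
      \<le> hdist E (t + s) (prd E t s u v) (prd E t s u' v) + hdist E (t + s) (prd E t s u' v) (prd E t s u' v')"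
    using ts u v by (intro hdist_triangle c) auto
  also have "\<dots> \<le> hdist E t u u' * hnorm (fibre E s) v + hnorm (fibre E t) u' * hdist E s v v'"
    unfolding hdist_def 1 2 using ts u v by (intro add_mono hnorm_prd) auto
  finally show ?thesis .
qed

lemma tens_closed: "timed E ps \<Longrightarrow> tens E ps \<in> carrier (fibre E (sum_list (map fst ps)))"
  by (induction ps) (simp_all add: triv_closed prd_closed timed_sum_nonneg[where E=E])

lemma tens_append:
  assumes "timed E ps" "timed E qs"
  shows "tens E (ps @ qs) = prd E (sum_list (map fst ps)) (sum_list (map fst qs)) (tens E ps) (tens E qs)"
  using assms(1)
proof (induction ps)
  case Nil
  have q: "tens E qs \<in> carrier (fibre E (sum_list (map fst qs)))" by (rule tens_closed[OF assms(2)])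
  have n: "0 \<le> sum_list (map fst qs)" by (rule timed_sum_nonneg[OF assms(2)])
  from triv_prd_left[OF n q, of 1] q show ?case by (simp add: bimodule.lact_one[OF bim[OF n]])
next
  case (Cons p ps)
  then show ?case using assms(2) by (simp add: assoc tens_closed timed_sum_nonneg[where E=E])
qed

text \<open>The left action reaches the leftmost tensor factor first, so the maps are applied in
  list order.\<close>

lemma mel_tens:
  assumes "\<And>i. i \<in> set is \<Longrightarrow> 0 \<le> s i \<and> u i \<in> carrier (fibre E (s i)) \<and> v i \<in> carrier (fibre E (s i))"
  shows "mel E (sum_list (map s is)) (tens E (map (\<lambda>i. (s i, u i)) is)) (tens E (map (\<lambda>i. (s i, v i)) is)) b
    = fold (\<lambda>i. mel E (s i) (u i) (v i)) is b"
  using assms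
proof (induction "is" arbitrary: b)
  case Nil show ?case by (simp add: mel_triv)
next
  case (Cons i "is")
  have t: "timed E (map (\<lambda>i. (s i, u i)) is)" "timed E (map (\<lambda>i. (s i, v i)) is)"
    using Cons.prems by (auto simp: timed_def)
  show ?case using Cons tens_closed[OF t(1)] tens_closed[OF t(2)] timed_sum_nonneg[OF t(1)]
    by (simp add: comp_def mel_prd)
qed

text \<open>By associativity each group of a refined partition can be read as one factor; this gives
  a partition and its refinement the same number of factors.\<close>

lemma tens_concat:
  "timed E (concat pss) \<Longrightarrow> tens E (concat pss) = tens E (map (\<lambda>ps. (sum_list (map fst ps), tens E ps)) pss)"
proof (induction pss)
  case (Cons ps pss)
  have "sum_list (map fst (concat pss)) = sum_list (map (\<lambda>ps. sum_list (map fst ps)) pss)"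
    by (induction pss) auto
  then show ?case using Cons by (simp add: comp_def tens_append[of ps "concat pss"])
qed simp

lemma tens_singleton: "0 \<le> s \<Longrightarrow> u \<in> carrier (fibre E s) \<Longrightarrow> tens E [(s, u)] = u"
  using triv_prd_right[of s u 1] right_module.ract_one[OF rmod] by simp

lemma tensor_power_eq_tens:
  assumes "0 \<le> s" "u \<in> carrier (fibre E s)"
  shows "tensor_power E s u m = tens E (replicate m (s, u))"
proof (induction m)
  case (Suc m)
  have "replicate (Suc m) (s, u) = replicate m (s, u) @ [(s, u)]" by (simp add: replicate_append_same)
  moreover have "sum_list (map fst (replicate m (s, u))) = real m * s" by (simp add: sum_list_replicate)
  moreover have "timed E (replicate m (s, u))" using assms by (auto simp: timed_def)
  ultimately show ?case using Suc assms tens_append[of "replicate m (s, u)" "[(s, u)]"] tens_singleton[of s u] by simp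
qed simp

end

section \<open>Uniformly continuous semigroups\<close>

definition op_semigroup :: "(real \<Rightarrow> 'x::real_normed_vector \<Rightarrow>\<^sub>L 'x) \<Rightarrow> bool" where
  "op_semigroup K \<longleftrightarrow> K 0 = id_blinfun \<and> (\<forall>s\<ge>0. \<forall>t\<ge>0. K (s + t) = K s o\<^sub>L K t)"

lemma id_blinfun_compose [simp]: "id_blinfun o\<^sub>L X = X" "X o\<^sub>L id_blinfun = X"
  by (auto intro!: blinfun_eqI)

lemmas blinfun_compose_simps =
  bounded_bilinear.diff_right[OF bounded_bilinear_blinfun_compose]
  bounded_bilinear.diff_left[OF bounded_bilinear_blinfun_compose]
  bounded_bilinear.scaleR_right[OF bounded_bilinear_blinfun_compose]
  bounded_bilinear.scaleR_left[OF bounded_bilinear_blinfun_compose]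

lemma at_0_within_atLeast: "at (0::real) within {0..} = at_right 0"
proof -
  have "{0..} \<inter> {..<1} - {0} = {0..1} \<inter> {..<1} - {0::real}" by auto
  then have "at (0::real) within {0..} = at 0 within {0..1}" by (intro at_within_nhd[of _ "{..<1}"]) auto
  then show ?thesis by (simp add: at_within_Icc_at_right)
qed

text \<open>Near 0 the operators are bounded by 2, hence by some power of 2 on every bounded
  interval; the difference of two values then factors into the value at the smaller time and a
  difference near 0.\<close>

lemma op_semigroup_continuous:
  assumes K: "op_semigroup K" and lim: "(K \<longlongrightarrow> id_blinfun) (at_right 0)"
  shows "continuous_on {0..} K"
proof -
  have K0: "K 0 = id_blinfun" and Kadd: "\<And>s t. 0 \<le> s \<Longrightarrow> 0 \<le> t \<Longrightarrow> K (s + t) = K s o\<^sub>L K t"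
    using K by (auto simp: op_semigroup_def)
  have near: "\<exists>d>0. \<forall>h. 0 \<le> h \<and> h < d \<longrightarrow> norm (K h - id_blinfun) < e" if "e > 0" for e
  proof -
    from lim that obtain d where "d > 0" "\<And>h. 0 < h \<Longrightarrow> h < d \<Longrightarrow> dist (K h) id_blinfun < e"
      unfolding tendsto_iff eventually_at_right_field by (metis add_0)
    then show ?thesis using K0 that by (intro exI[of _ d]) (auto simp: dist_norm le_less)
  qed
  obtain d where d: "d > 0" "\<And>h. 0 \<le> h \<Longrightarrow> h < d \<Longrightarrow> norm (K h - id_blinfun) < 1" using near[of 1] by auto
  have 2: "norm (K h) \<le> 2" if "0 \<le> h" "h < d" for h
    using d(2)[OF that] norm_triangle_ineq[of "K h - id_blinfun" id_blinfun] norm_blinfun_id_le[where 'a='a] by simp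
  have bd: "norm (K t) \<le> 2 ^ n" if "0 \<le> t" "t \<le> real n * (d / 2)" for n t
    using that
  proof (induction n arbitrary: t)
    case 0 then show ?case using K0 norm_blinfun_id_le[where 'a='a] by simp
  next
    case (Suc n)
    show ?case
    proof (cases "t \<le> d / 2")
      case True
      have "norm (K t) \<le> 2" using 2[of t] True Suc.prems d by auto
      moreover have "(2::real) * 1 \<le> 2 * 2 ^ n" by (intro mult_left_mono) auto
      ultimately show ?thesis unfolding power_Suc by linarith
    next
      case False
      then have "K t = K (d/2) o\<^sub>L K (t - d/2)" using Kadd[of "d/2" "t - d/2"] d by simp
      then have "norm (K t) \<le> norm (K (d/2)) * norm (K (t - d/2))" by (simp add: norm_blinfun_compose)
      also have "\<dots> \<le> 2 * 2 ^ n"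
        using Suc.IH[of "t - d/2"] 2[of "d/2"] d False Suc.prems by (intro mult_mono) (auto simp: algebra_simps)
      finally show ?thesis by simp
    qed
  qed
  show ?thesis
    unfolding continuous_on_iff
  proof (intro ballI allI impI)
    fix t e :: real assume t: "t \<in> {0..}" and e: "e > 0"
    obtain n where n: "t \<le> real n * (d / 2)"
      using d real_arch_simple[of "t / (d / 2)"] by (auto simp: field_simps)
    obtain c where c: "c > 0" "\<And>h. 0 \<le> h \<Longrightarrow> h < c \<Longrightarrow> norm (K h - id_blinfun) < e / 2 ^ n"
      using near[of "e / 2 ^ n"] e by auto
    have "dist (K s) (K t) < e" if s: "s \<ge> 0" "dist s t < c" for s
    proof -
      define m h where "m = min s t" and "h = \<bar>s - t\<bar>"
      have m: "0 \<le> m" "m \<le> real n * (d / 2)" "0 \<le> h" "h < c" using s t n by (auto simp: m_def h_def dist_real_def)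
      have "norm (K s - K t) = norm (K (m + h) - K m)"
        by (cases "s \<le> t") (simp_all add: m_def h_def norm_minus_commute)
      also have "K (m + h) - K m = K m o\<^sub>L (K h - id_blinfun)"
        using Kadd[OF m(1,3)] by (simp add: blinfun_compose_simps)
      also have "norm \<dots> \<le> norm (K m) * norm (K h - id_blinfun)" by (rule norm_blinfun_compose)
      also have "\<dots> \<le> 2 ^ n * norm (K h - id_blinfun)" using bd[OF m(1,2)] by (intro mult_right_mono) auto
      also have "\<dots> < 2 ^ n * (e / 2 ^ n)" using c(2)[OF m(3,4)] by (intro mult_strict_left_mono) auto
      finally show ?thesis by (simp add: dist_norm)
    qed
    then show "\<exists>c>0. \<forall>s\<in>{0..}. dist s t < c \<longrightarrow> dist (K s) (K t) < e" using c(1) by auto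
  qed
qed

text \<open>The equation for \<open>W\<close> is the fixed point equation
  \<open>W = 1 + (1 - V) W\<close> of a contraction with factor 1/2 on the bounded
  operators.\<close>

lemma blinfun_right_inverse:
  fixes V :: "'x::banach \<Rightarrow>\<^sub>L 'x"
  assumes "norm (id_blinfun - V) \<le> 1/2"
  obtains W where "V o\<^sub>L W = id_blinfun"
proof -
  have "\<exists>!W. id_blinfun + ((id_blinfun - V) o\<^sub>L W) = W"
  proof (rule banach_fix_type[of "1/2"])
    show "\<forall>X Y. dist (id_blinfun + ((id_blinfun - V) o\<^sub>L X)) (id_blinfun + ((id_blinfun - V) o\<^sub>L Y)) \<le> 1/2 * dist X Y"
    proof (intro allI)
      fix X Y :: "'x \<Rightarrow>\<^sub>L 'x"
      have "norm ((id_blinfun - V) o\<^sub>L (X - Y)) \<le> norm (id_blinfun - V) * norm (X - Y)" by (rule norm_blinfun_compose)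
      also have "\<dots> \<le> 1/2 * norm (X - Y)" using assms by (intro mult_right_mono) auto
      finally show "dist (id_blinfun + ((id_blinfun - V) o\<^sub>L X)) (id_blinfun + ((id_blinfun - V) o\<^sub>L Y)) \<le> 1/2 * dist X Y"
        by (simp add: dist_norm blinfun_compose_simps)
    qed
  qed auto
  then obtain W where "id_blinfun + ((id_blinfun - V) o\<^sub>L W) = W" by blast
  then have "V o\<^sub>L W = id_blinfun" by (simp add: blinfun_compose_simps)
  then show ?thesis by (rule that)
qed

text \<open>Smoothing by \<open>V = (1/d) \<integral>\<^sub>0\<^sup>d K\<close>, which is invertible for small \<open>d\<close>, makes the semigroup differentiable.\<close>

lemma op_semigroup_differentiable:
  fixes K :: "real \<Rightarrow> 'x::banach \<Rightarrow>\<^sub>L 'x"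
  assumes K: "op_semigroup K" and cont: "continuous_on {0..} K"
  obtains L where "(K has_vector_derivative L) (at 0 within {0..})"
proof -
  have K0: "K 0 = id_blinfun" and Kadd: "\<And>s t. 0 \<le> s \<Longrightarrow> 0 \<le> t \<Longrightarrow> K (s + t) = K s o\<^sub>L K t"
    using K by (auto simp: op_semigroup_def)
  obtain c where c: "c > 0" "\<And>s. s \<in> {0..} \<Longrightarrow> dist s 0 < c \<Longrightarrow> dist (K s) (K 0) < 1/2"
    using cont[unfolded continuous_on_iff, rule_format, of 0 "1/2"] by auto
  define d where "d = c / 2"
  have d: "d > 0" "\<And>s. 0 \<le> s \<Longrightarrow> s \<le> d \<Longrightarrow> norm (K s - id_blinfun) \<le> 1/2"
    using c K0 by (auto simp: d_def dist_norm intro!: less_imp_le)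
  define \<Phi> where "\<Phi> x = integral {0..x} K" for x
  have int: "K integrable_on {a..b}" if "0 \<le> a" for a b
    by (rule integrable_continuous_interval, rule continuous_on_subset[OF cont]) (use that in auto)
  define V where "V = (1/d) *\<^sub>R \<Phi> d"
  have "norm (integral {0..d} (\<lambda>s. K s - id_blinfun)) \<le> 1/2 * (d - 0)"
    using d by (intro integral_bound continuous_intros continuous_on_subset[OF cont]) auto
  moreover have "integral {0..d} (\<lambda>s. K s - id_blinfun) = \<Phi> d - d *\<^sub>R id_blinfun"
    using d int[of 0 d] by (subst integral_diff) (auto simp: \<Phi>_def)
  ultimately have "norm (\<Phi> d - d *\<^sub>R id_blinfun) \<le> d / 2" by simp
  moreover have "id_blinfun - V = (- 1/d) *\<^sub>R (\<Phi> d - d *\<^sub>R id_blinfun)"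
    using d by (simp add: V_def scaleR_diff_right)
  ultimately have "norm (id_blinfun - V) \<le> 1/2" using d by (simp add: divide_simps)
  then obtain W where W: "V o\<^sub>L W = id_blinfun" by (rule blinfun_right_inverse)
  have shift: "K h o\<^sub>L \<Phi> d = \<Phi> (h + d) - \<Phi> h" if h: "0 \<le> h" for h
  proof -
    have "K h o\<^sub>L \<Phi> d = integral {0..d} (\<lambda>s. K h o\<^sub>L K s)"
      unfolding \<Phi>_def using int[of 0 d]
        integral_linear[of K "{0..d}" "\<lambda>X. K h o\<^sub>L X"]
      by (simp add: comp_def bounded_bilinear.bounded_linear_right[OF bounded_bilinear_blinfun_compose])
    also have "\<dots> = integral {0..d} (K \<circ> (+) h)" using h by (intro integral_cong) (auto simp: Kadd)
    also have "\<dots> = integral {h..h + d} K" by (simp add: integral_shift_Icc_real add.commute)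
    also have "\<dots> = \<Phi> (h + d) - \<Phi> h"
      using Henstock_Kurzweil_Integration.integral_combine[of 0 h "h + d" K] h d int[of 0 "h + d"] by (simp add: \<Phi>_def algebra_simps)
    finally show ?thesis .
  qed
  \<comment> \<open>\<open>K h\<close> is recovered from its integrals by composing with the right
    inverse \<open>W\<close> of \<open>V\<close>, and the right side is differentiable in
    \<open>h\<close> by the fundamental theorem of calculus.\<close>
  have rep: "K h = (1/d) *\<^sub>R ((\<Phi> (h + d) - \<Phi> h) o\<^sub>L W)" if "h \<in> {0..}" for h
  proof -
    have "K h = (K h o\<^sub>L V) o\<^sub>L W" 
    proof -
      have "(K h o\<^sub>L V) o\<^sub>L W = K h o\<^sub>L (V o\<^sub>L W)" by (rule blinfun_eqI) simp
      then show ?thesis using W by simp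
    qed
    also have "K h o\<^sub>L V = (1/d) *\<^sub>R (K h o\<^sub>L \<Phi> d)" by (simp add: V_def blinfun_compose_simps)
    finally show ?thesis using shift that by (simp add: blinfun_compose_simps)
  qed
  have D: "(\<Phi> has_vector_derivative K x) (at x within {0..2 * d})" if "x \<in> {0..2 * d}" for x
    unfolding \<Phi>_def using that by (intro integral_has_vector_derivative continuous_on_subset[OF cont]) auto
  have D0: "(\<Phi> has_vector_derivative K 0) (at 0 within {0..})"
    using D[of 0] d by (simp add: at_0_within_atLeast at_within_Icc_at_right)
  have "(\<Phi> has_vector_derivative K d) (at d)"
    using D[of d] d at_within_interior[of d "{0..2 * d}"] by simp
  then have "(\<Phi> \<circ> (\<lambda>h. h + d) has_vector_derivative 1 *\<^sub>R K d) (at 0)"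
    by (intro vector_diff_chain_at) (auto intro!: derivative_eq_intros)
  then have Dd: "((\<lambda>h. \<Phi> (h + d)) has_vector_derivative K d) (at 0 within {0..})"
    by (simp add: comp_def has_vector_derivative_at_within)
  have "bounded_linear (\<lambda>X. (1/d) *\<^sub>R (X o\<^sub>L W))"
    by (intro bounded_linear_const_scaleR bounded_bilinear.bounded_linear_left[OF bounded_bilinear_blinfun_compose])
  from bounded_linear.has_vector_derivative[OF this has_vector_derivative_diff[OF Dd D0]]
  have "((\<lambda>h. (1/d) *\<^sub>R ((\<Phi> (h + d) - \<Phi> h) o\<^sub>L W)) has_vector_derivative (1/d) *\<^sub>R ((K d - K 0) o\<^sub>L W)) (at 0 within {0..})" .
  then have "(K has_vector_derivative (1/d) *\<^sub>R ((K d - K 0) o\<^sub>L W)) (at 0 within {0..})"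
    by (rule has_vector_derivative_transform[rotated 2]) (use rep in auto)
  then show ?thesis by (rule that)
qed

section \<open>Units and their kernels\<close>

text \<open>Uniformity over a set \<open>T s\<close> of right vectors is what tensor powers require:
  there \<open>T s\<close> consists of all products along partitions of \<open>s\<close>. For
  kernels it is a singleton. \<open>A0\<close> is kept general because the single terms of a
  combination of units do not start at the identity.\<close>

definition first_order :: "('b::unital_cstar_algebra, 'e) prodsys \<Rightarrow> (real \<Rightarrow> 'e) \<Rightarrow> (real \<Rightarrow> 'e set)
    \<Rightarrow> ('b \<Rightarrow> 'b) \<Rightarrow> ('b \<Rightarrow> 'b) \<Rightarrow> bool" where
  "first_order E y T A0 A1 \<longleftrightarrow> (\<forall>\<epsilon>>0. \<exists>\<delta>>0. \<forall>s. 0 < s \<and> s < \<delta> \<longrightarrow> (\<forall>v\<in>T s. \<forall>b.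
     norm (mel E s (y s) v b - A0 b - s *\<^sub>R A1 b) \<le> \<epsilon> * s * norm b))"

lemma first_orderE:
  assumes "first_order E y T A0 A1" "0 < \<epsilon>"
  obtains \<delta> where "0 < \<delta>" "\<And>s v b. 0 < s \<Longrightarrow> s < \<delta> \<Longrightarrow> v \<in> T s \<Longrightarrow>
    norm (mel E s (y s) v b - A0 b - s *\<^sub>R A1 b) \<le> \<epsilon> * s * norm b"
  using assms unfolding first_order_def by meson

lemma first_order_singletonE:
  assumes "first_order E y (\<lambda>s. {z s}) A0 A1" "0 < \<epsilon>"
  obtains \<delta> where "0 < \<delta>" "\<And>s b. 0 < s \<Longrightarrow> s < \<delta> \<Longrightarrow>
    norm (mel E s (y s) (z s) b - A0 b - s *\<^sub>R A1 b) \<le> \<epsilon> * s * norm b"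
proof -
  obtain \<delta> where d: "0 < \<delta>" "\<And>s v b. 0 < s \<Longrightarrow> s < \<delta> \<Longrightarrow> v \<in> {z s} \<Longrightarrow>
      norm (mel E s (y s) v b - A0 b - s *\<^sub>R A1 b) \<le> \<epsilon> * s * norm b"
    by (rule first_orderE[OF assms]) auto
  show ?thesis by (rule that[OF d(1) d(2)]) auto
qed

lemma first_orderI:
  assumes "\<And>\<epsilon>. 0 < \<epsilon> \<Longrightarrow> \<exists>\<delta>>0. \<forall>s v b. 0 < s \<longrightarrow> s < \<delta> \<longrightarrow> v \<in> T s \<longrightarrow>
    norm (mel E s (y s) v b - A0 b - s *\<^sub>R A1 b) \<le> \<epsilon> * s * norm b"
  shows "first_order E y T A0 A1"
  using assms unfolding first_order_def by meson

context product_system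
begin

lemma unit_closed: "u \<in> units E \<Longrightarrow> 0 \<le> t \<Longrightarrow> u t \<in> carrier (fibre E t)"
  by (auto simp: units_def PiE_def Pi_def)

lemma unit_0: "u \<in> units E \<Longrightarrow> u 0 = triv E 1"
  by (simp add: units_def)

lemma unit_prd: "u \<in> units E \<Longrightarrow> 0 \<le> t \<Longrightarrow> 0 \<le> s \<Longrightarrow> prd E t s (u t) (u s) = u (t + s)"
  by (simp add: units_def)

lemma unitI:
  assumes "u \<in> extensional {0..}" "\<And>t. 0 \<le> t \<Longrightarrow> u t \<in> carrier (fibre E t)" "u 0 = triv E 1"
    and "\<And>t s. 0 \<le> t \<Longrightarrow> 0 \<le> s \<Longrightarrow> prd E t s (u t) (u s) = u (t + s)"
  shows "u \<in> units E"
  using assms by (auto simp: units_def PiE_def)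

lemma unit_ext:
  assumes "u \<in> units E" "v \<in> units E" "\<And>t. 0 \<le> t \<Longrightarrow> u t = v t"
  shows "u = v"
proof (rule PiE_ext)
  show "u \<in> (\<Pi>\<^sub>E t\<in>{0..}. carrier (fibre E t))" "v \<in> (\<Pi>\<^sub>E t\<in>{0..}. carrier (fibre E t))"
    using assms(1,2) by (simp_all add: units_def)
qed (use assms(3) in auto)

lemma tens_unit:
  assumes u: "u \<in> units E" and "\<And>r. r \<in> set rs \<Longrightarrow> 0 \<le> r"
  shows "tens E (map (\<lambda>r. (r, u r)) rs) = u (sum_list rs)"
  using assms(2) by (induction rs) (simp_all add: comp_def unit_0[OF u] unit_prd[OF u] sum_list_nonneg)

lemma mel_unit_add:
  assumes "u \<in> units E" "v \<in> units E" "0 \<le> t" "0 \<le> s"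
  shows "mel E (t + s) (u (t + s)) (v (t + s)) b = mel E s (u s) (v s) (mel E t (u t) (v t) b)"
  using assms by (simp add: mel_prd unit_closed flip: unit_prd)

lemma mel_unit_0: "u \<in> units E \<Longrightarrow> v \<in> units E \<Longrightarrow> mel E 0 (u 0) (v 0) b = b"
  by (simp add: unit_0 mel_triv)

lemma kern_apply:
  assumes "u \<in> units E" "v \<in> units E" "0 \<le> t"
  shows "blinfun_apply (kern E u v t) b = mel E t (u t) (v t) b"
  using bounded_linear_mel[of t "u t" "v t"] assms
  by (simp add: kern_def bounded_linear_Blinfun_apply unit_closed flip: mel_def)

lemma op_semigroup_kern:
  assumes u: "u \<in> units E" "v \<in> units E"
  shows "op_semigroup (kern E u v)"
proof -
  have "kern E u v (s + t) = kern E u v s o\<^sub>L kern E u v t" if "0 \<le> s" "0 \<le> t" for s t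
    using that u mel_unit_add[OF u that(2,1)] by (intro blinfun_eqI) (simp add: kern_apply add.commute)
  moreover have "kern E u v 0 = id_blinfun"
    using u by (intro blinfun_eqI) (simp add: kern_apply mel_unit_0)
  ultimately show ?thesis by (simp add: op_semigroup_def)
qed

lemma gen_has_derivative:
  assumes u: "u \<in> units E" "v \<in> units E" and "continuous_on {0..} (kern E u v)"
  shows "(kern E u v has_vector_derivative gen E u v) (at 0 within {0..})"
proof -
  obtain L where L: "(kern E u v has_vector_derivative L) (at 0 within {0..})"
    using op_semigroup_differentiable[OF op_semigroup_kern[OF u] assms(3)] .
  have "at (0::real) within {0..} \<noteq> bot"
    unfolding at_0_within_atLeast by (rule trivial_limit_at_right_real)
  with L show ?thesis unfolding gen_def by (simp add: vector_derivative_works[symmetric] differentiableI_vector)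
qed

end

section \<open>Units close to the reference unit\<close>

locale product_system_unit = product_system E
  for E :: "('b::unital_cstar_algebra, 'e) prodsys" +
  fixes \<omega> :: "real \<Rightarrow> 'e"
  assumes continuous_unit: "continuous_units E {\<omega>}"
begin

lemma omega_unit: "\<omega> \<in> units E"
  using continuous_unit by (simp add: continuous_units_def)

lemma mel_one_tendsto:
  assumes u: "u \<in> units E" "v \<in> units E" and c: "continuous_on {0..} (kern E u v)"
  shows "((\<lambda>t. mel E t (u t) (v t) b) \<longlongrightarrow> b) (at_right 0)"
proof -
  have "(kern E u v \<longlongrightarrow> kern E u v 0) (at_right 0)"
    using c by (auto simp: continuous_on_def simp flip: at_0_within_atLeast)
  then have "((\<lambda>t. blinfun_apply (kern E u v t) b) \<longlongrightarrow> blinfun_apply (kern E u v 0) b) (at_right 0)"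
    by (intro tendsto_intros)
  also have "blinfun_apply (kern E u v 0) b = b" using u by (simp add: kern_apply mel_unit_0)
  finally show ?thesis
    by (rule Lim_transform_eventually)
      (use u in \<open>auto simp: kern_apply eventually_at_right_field intro: exI[of _ 1]\<close>)
qed

lemma hdist_tendsto_0:
  assumes u: "u \<in> units E" "v \<in> units E" and c: "continuous_units E {u, v}"
  shows "((\<lambda>t. hdist E t (u t) (v t)) \<longlongrightarrow> 0) (at_right 0)"
proof -
  have c': "\<And>x y. x \<in> {u, v} \<Longrightarrow> y \<in> {u, v} \<Longrightarrow> continuous_on {0..} (kern E x y)"
    using c by (auto simp: continuous_units_def)
  have "((\<lambda>t. sqrt (norm ((mel E t (u t) (u t) 1 - mel E t (u t) (v t) 1) - (mel E t (v t) (u t) 1 - mel E t (v t) (v t) 1))))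
      \<longlongrightarrow> sqrt (norm ((1 - 1) - (1 - (1::'b))))) (at_right 0)"
    using u by (intro tendsto_intros mel_one_tendsto c') auto
  then have "((\<lambda>t. sqrt (norm ((mel E t (u t) (u t) 1 - mel E t (u t) (v t) 1) - (mel E t (v t) (u t) 1 - mel E t (v t) (v t) 1))))
      \<longlongrightarrow> 0) (at_right 0)" by simp
  then show ?thesis
    by (rule Lim_transform_eventually)
      (use u in \<open>auto simp: eventually_at_right_field unit_closed simp flip: hdist_square intro: exI[of _ 1]\<close>)
qed

lemma hnorm_omega_tendsto: "((\<lambda>t. hnorm (fibre E t) (\<omega> t)) \<longlongrightarrow> sqrt (norm (1::'b))) (at_right 0)"
proof -
  have "continuous_on {0..} (kern E \<omega> \<omega>)" using continuous_unit by (simp add: continuous_units_def)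
  then have "((\<lambda>t. sqrt (norm (mel E t (\<omega> t) (\<omega> t) 1))) \<longlongrightarrow> sqrt (norm (1::'b))) (at_right 0)"
    using omega_unit by (intro tendsto_intros mel_one_tendsto)
  then show ?thesis
    by (rule Lim_transform_eventually)
      (use omega_unit in \<open>auto simp: eventually_at_right_field unit_closed hnorm_nonneg
         simp flip: hnorm_square_mel intro!: exI[of _ 1]\<close>)
qed

text \<open>By \<open>norm_mel_diff\<close> the kernel of \<open>x\<close> and \<open>y\<close>
  differs from that of \<open>\<omega>\<close> by an amount that vanishes at 0, and for a semigroup
  continuity at 0 is enough.\<close>

lemma continuous_kern:
  assumes x: "x \<in> units E" "((\<lambda>t. hdist E t (x t) (\<omega> t)) \<longlongrightarrow> 0) (at_right 0)"
    and y: "y \<in> units E" "((\<lambda>t. hdist E t (y t) (\<omega> t)) \<longlongrightarrow> 0) (at_right 0)"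
  shows "continuous_on {0..} (kern E x y)"
proof (rule op_semigroup_continuous[OF op_semigroup_kern[OF x(1) y(1)]])
  let ?n = "\<lambda>t. hnorm (fibre E t) (\<omega> t)"
  let ?dx = "\<lambda>t. hdist E t (x t) (\<omega> t)" and ?dy = "\<lambda>t. hdist E t (y t) (\<omega> t)"
  have "((\<lambda>t. ?dx t * (?dy t + ?n t) + ?n t * ?dy t) \<longlongrightarrow> 0 * (0 + sqrt (norm (1::'b))) + sqrt (norm (1::'b)) * 0) (at_right 0)"
    by (intro tendsto_intros x y hnorm_omega_tendsto)
  then have lim: "((\<lambda>t. ?dx t * (?dy t + ?n t) + ?n t * ?dy t) \<longlongrightarrow> 0) (at_right 0)" by simp
  have "norm (kern E x y t - kern E \<omega> \<omega> t) \<le> ?dx t * (?dy t + ?n t) + ?n t * ?dy t" if t: "0 < t" for t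
  proof (rule norm_blinfun_bound)
    have nn: "0 \<le> ?n t" using hnorm_nonneg t by simp
    show "0 \<le> ?dx t * (?dy t + ?n t) + ?n t * ?dy t" using t nn by (simp add: hdist_nonneg)
    fix b
    have "norm (blinfun_apply (kern E x y t - kern E \<omega> \<omega> t) b)
        = norm (mel E t (x t) (y t) b - mel E t (\<omega> t) (\<omega> t) b)"
      using t x y omega_unit by (simp add: blinfun.diff_left kern_apply)
    also have "\<dots> \<le> (?dx t * hnorm (fibre E t) (y t) + ?n t * ?dy t) * norm b"
      using t x y omega_unit by (intro norm_mel_diff) (auto simp: unit_closed)
    also have "\<dots> \<le> (?dx t * (?dy t + ?n t) + ?n t * ?dy t) * norm b"
      using t x y omega_unit by (intro mult_right_mono add_right_mono mult_left_mono hnorm_le_hdist) (auto simp: unit_closed hdist_nonneg)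
    finally show "norm (blinfun_apply (kern E x y t - kern E \<omega> \<omega> t) b) \<le> (?dx t * (?dy t + ?n t) + ?n t * ?dy t) * norm b" .
  qed
  then have "((\<lambda>t. kern E x y t - kern E \<omega> \<omega> t) \<longlongrightarrow> 0) (at_right 0)"
    by (intro Lim_null_comparison[OF _ lim]) (auto simp: eventually_at_right_field intro: exI[of _ 1])
  moreover have "(kern E \<omega> \<omega> \<longlongrightarrow> kern E \<omega> \<omega> 0) (at_right 0)"
    using continuous_unit by (auto simp: continuous_units_def continuous_on_def simp flip: at_0_within_atLeast)
  moreover have "kern E \<omega> \<omega> 0 = id_blinfun" using op_semigroup_kern[OF omega_unit omega_unit] by (simp add: op_semigroup_def)
  ultimately show "(kern E x y \<longlongrightarrow> id_blinfun) (at_right 0)" 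
    using tendsto_add[of "\<lambda>t. kern E x y t - kern E \<omega> \<omega> t" 0 "at_right 0" "kern E \<omega> \<omega>" id_blinfun] by simp
qed

abbreviation U where "U \<equiv> max_units E \<omega>"

text \<open>Turns membership into a condition on the fibres near 0. Any two such units have a
  continuous kernel by \<open>continuous_kern\<close>, so generators exist for all pairs in
  \<open>U\<close>.\<close>

lemma max_units_iff: "x \<in> U \<longleftrightarrow> x \<in> units E \<and> ((\<lambda>t. hdist E t (x t) (\<omega> t)) \<longlongrightarrow> 0) (at_right 0)"
proof
  assume "x \<in> U"
  then have "x \<in> units E" "continuous_units E {x, \<omega>}"
    by (auto simp: max_units_def continuous_units_def)
  then show "x \<in> units E \<and> ((\<lambda>t. hdist E t (x t) (\<omega> t)) \<longlongrightarrow> 0) (at_right 0)"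
    using omega_unit by (auto intro: hdist_tendsto_0)
next
  assume x: "x \<in> units E \<and> ((\<lambda>t. hdist E t (x t) (\<omega> t)) \<longlongrightarrow> 0) (at_right 0)"
  have w: "((\<lambda>t. hdist E t (\<omega> t) (\<omega> t)) \<longlongrightarrow> 0) (at_right 0)"
    using continuous_unit omega_unit by (intro hdist_tendsto_0) (auto simp: insert_absorb)
  show "x \<in> U"
    using x w omega_unit continuous_kern by (auto simp: max_units_def continuous_units_def)
qed

lemma U_unit: "x \<in> U \<Longrightarrow> x \<in> units E"
  by (simp add: max_units_iff)

lemma U_closed: "x \<in> U \<Longrightarrow> 0 \<le> t \<Longrightarrow> x t \<in> carrier (fibre E t)"
  by (simp add: U_unit unit_closed)

lemma omega_U: "\<omega> \<in> U"
  using continuous_unit by (simp add: max_units_def insert_absorb)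

lemma gen_first_order:
  assumes x: "x \<in> U" and y: "y \<in> U"
  shows "first_order E x (\<lambda>s. {y s}) (\<lambda>b. b) (blinfun_apply (gen E x y))"
  unfolding first_order_def
proof (intro allI impI)
  fix \<epsilon> :: real assume \<epsilon>: "\<epsilon> > 0"
  have "(kern E x y has_vector_derivative gen E x y) (at 0 within {0..})"
    using x y by (intro gen_has_derivative continuous_kern) (auto simp: max_units_iff)
  then obtain \<delta> where \<delta>: "\<delta> > 0" "\<And>s. s \<in> {0..} \<Longrightarrow> norm (s - 0) < \<delta> \<Longrightarrow>
      norm (kern E x y s - kern E x y 0 - (s - 0) *\<^sub>R gen E x y) \<le> \<epsilon> * norm (s - 0)"
    unfolding has_vector_derivative_def has_derivative_within_alt using \<epsilon> by blast
  have "norm (mel E s (x s) v b - b - s *\<^sub>R blinfun_apply (gen E x y) b) \<le> \<epsilon> * s * norm b"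
    if s: "0 < s \<and> s < \<delta>" and v: "v \<in> {y s}" for s v b
  proof -
    have "mel E s (x s) v b - b - s *\<^sub>R blinfun_apply (gen E x y) b
        = blinfun_apply (kern E x y s - kern E x y 0 - (s - 0) *\<^sub>R gen E x y) b"
      using s v x y by (simp add: blinfun.bilinear_simps kern_apply U_unit mel_unit_0)
    also have "norm \<dots> \<le> norm (kern E x y s - kern E x y 0 - (s - 0) *\<^sub>R gen E x y) * norm b"
      by (rule norm_blinfun)
    also have "\<dots> \<le> \<epsilon> * s * norm b" using \<delta>(2)[of s] s by (intro mult_right_mono) auto
    finally show ?thesis .
  qed
  then show "\<exists>\<delta>>0. \<forall>s. 0 < s \<and> s < \<delta> \<longrightarrow> (\<forall>v\<in>{y s}. \<forall>b.
      norm (mel E s (x s) v b - b - s *\<^sub>R blinfun_apply (gen E x y) b) \<le> \<epsilon> * s * norm b)"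
    using \<delta>(1) by blast
qed

lemma first_order_unique:
  assumes "first_order E x T A0 A" "first_order E x T A0 B" and T: "\<And>s. 0 < s \<Longrightarrow> T s \<noteq> {}"
  shows "A b = B b"
proof (rule ccontr)
  assume ne: "A b \<noteq> B b"
  then have n: "norm (A b - B b) > 0" by simp
  define \<epsilon> where "\<epsilon> = norm (A b - B b) / (4 * (1 + norm b))"
  have \<epsilon>: "\<epsilon> > 0" using n by (simp add: \<epsilon>_def add_pos_nonneg)
  obtain d1 where d1: "0 < d1" "\<And>s v b. 0 < s \<Longrightarrow> s < d1 \<Longrightarrow> v \<in> T s \<Longrightarrow> norm (mel E s (x s) v b - A0 b - s *\<^sub>R A b) \<le> \<epsilon> * s * norm b"
    by (rule first_orderE[OF assms(1) \<epsilon>]) auto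
  obtain d2 where d2: "0 < d2" "\<And>s v b. 0 < s \<Longrightarrow> s < d2 \<Longrightarrow> v \<in> T s \<Longrightarrow> norm (mel E s (x s) v b - A0 b - s *\<^sub>R B b) \<le> \<epsilon> * s * norm b"
    by (rule first_orderE[OF assms(2) \<epsilon>]) auto
  define s where "s = min d1 d2 / 2"
  have s: "0 < s" "s < d1" "s < d2" using d1 d2 by (auto simp: s_def)
  obtain v where v: "v \<in> T s" using T[OF s(1)] by blast
  have "s *\<^sub>R (A b - B b) = (mel E s (x s) v b - A0 b - s *\<^sub>R B b) - (mel E s (x s) v b - A0 b - s *\<^sub>R A b)"
    by (simp add: scaleR_diff_right)
  then have "norm (s *\<^sub>R (A b - B b)) \<le> \<epsilon> * s * norm b + \<epsilon> * s * norm b"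
    by (simp only:) (intro order_trans[OF norm_triangle_ineq4] add_mono d1(2)[OF s(1,2) v] d2(2)[OF s(1,3) v])
  also have "\<dots> = s * (2 * \<epsilon> * norm b)" by simp
  finally have "norm (A b - B b) \<le> 2 * \<epsilon> * norm b" using s by simp
  also have "\<dots> < norm (A b - B b)" using n by (simp add: \<epsilon>_def field_simps add_pos_nonneg)
  finally show False by simp
qed

lemma gen_eqI:
  assumes "x \<in> U" "y \<in> U" "first_order E x (\<lambda>s. {y s}) (\<lambda>b. b) A"
  shows "blinfun_apply (gen E x y) b = A b"
  by (rule first_order_unique[OF gen_first_order[OF assms(1,2)] assms(3)]) simp

lemma first_order_adj:
  assumes fo: "first_order E x (\<lambda>s. {y s}) (\<lambda>b. b) A"
    and x: "\<And>s. 0 < s \<Longrightarrow> x s \<in> carrier (fibre E s)" and y: "\<And>s. 0 < s \<Longrightarrow> y s \<in> carrier (fibre E s)"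
  shows "first_order E y (\<lambda>s. {x s}) (\<lambda>b. b) (\<lambda>b. adj (A (adj b)))"
  unfolding first_order_def
proof (intro allI impI)
  fix \<epsilon> :: real assume "\<epsilon> > 0"
  then obtain \<delta> where \<delta>: "0 < \<delta>" "\<And>s b. 0 < s \<Longrightarrow> s < \<delta> \<Longrightarrow> norm (mel E s (x s) (y s) b - b - s *\<^sub>R A b) \<le> \<epsilon> * s * norm b"
    by (rule first_order_singletonE[OF fo]) auto
  have "norm (mel E s (y s) (x s) b - b - s *\<^sub>R adj (A (adj b))) \<le> \<epsilon> * s * norm b" if "0 < s" "s < \<delta>" for s b
  proof -
    have "mel E s (y s) (x s) b - b - s *\<^sub>R adj (A (adj b)) = adj (mel E s (x s) (y s) (adj b) - adj b - s *\<^sub>R A (adj b))"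
      using that x y by (simp add: adj_diff adj_scaleR adj_mel adj_adj)
    then show ?thesis using \<delta>(2)[OF that, of "adj b"] by simp
  qed
  then show "\<exists>\<delta>>0. \<forall>s. 0 < s \<and> s < \<delta> \<longrightarrow> (\<forall>v\<in>{x s}. \<forall>b. norm (mel E s (y s) v b - b - s *\<^sub>R adj (A (adj b))) \<le> \<epsilon> * s * norm b)"
    using \<delta>(1) by blast
qed

lemma gen_adj:
  assumes "x \<in> U" "y \<in> U"
  shows "blinfun_apply (gen E y x) b = adj (blinfun_apply (gen E x y) (adj b))"
  using assms by (intro gen_eqI first_order_adj gen_first_order) (auto simp: U_closed)

text \<open>The operators are real-linear by their type, so complex homogeneity has to be recovered:
  \<open>b \<mapsto> c A (b / c)\<close> is a linear term of the same kernel, and linear terms are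
  unique.\<close>

lemma gen_scaleC:
  assumes x: "x \<in> U" "y \<in> U"
  shows "blinfun_apply (gen E x y) (c *\<^sub>C b) = c *\<^sub>C blinfun_apply (gen E x y) b"
proof (cases "c = 0")
  case True
  have "(0::complex) *\<^sub>C (z::'b) = 0" for z using scaleR_eq_scaleC[of 0 z] by simp
  then show ?thesis using True by (simp add: blinfun.zero_right)
next
  case False
  have inv: "c *\<^sub>C inverse c *\<^sub>C z = z" for z :: 'b
    using False scaleR_eq_scaleC[of 1 z] by (simp add: scaleC_scaleC)
  have diff: "c *\<^sub>C (z - w) = c *\<^sub>C z - c *\<^sub>C w" for z w :: 'b
    using scaleC_add_right[of c "z - w" w] by (simp add: eq_diff_eq)
  have sr: "c *\<^sub>C r *\<^sub>R z = r *\<^sub>R c *\<^sub>C z" for r and z :: 'b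
    by (simp add: scaleR_eq_scaleC scaleC_scaleC mult.commute)
  have "first_order E x (\<lambda>s. {y s}) (\<lambda>b. b) (\<lambda>b. c *\<^sub>C blinfun_apply (gen E x y) (inverse c *\<^sub>C b))"
    unfolding first_order_def
  proof (intro allI impI)
    fix \<epsilon> :: real assume "\<epsilon> > 0"
    then obtain \<delta> where \<delta>: "0 < \<delta>" "\<And>s b. 0 < s \<Longrightarrow> s < \<delta> \<Longrightarrow>
        norm (mel E s (x s) (y s) b - b - s *\<^sub>R blinfun_apply (gen E x y) b) \<le> \<epsilon> * s * norm b"
      by (rule first_order_singletonE[OF gen_first_order[OF x]]) auto
    have "norm (mel E s (x s) (y s) b - b - s *\<^sub>R c *\<^sub>C blinfun_apply (gen E x y) (inverse c *\<^sub>C b)) \<le> \<epsilon> * s * norm b"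
      if s: "0 < s" "s < \<delta>" for s b
    proof -
      have "mel E s (x s) (y s) b = c *\<^sub>C mel E s (x s) (y s) (inverse c *\<^sub>C b)"
        using s x inv[of b] by (simp add: U_closed flip: mel_scaleC)
      then have "mel E s (x s) (y s) b - b - s *\<^sub>R c *\<^sub>C blinfun_apply (gen E x y) (inverse c *\<^sub>C b)
          = c *\<^sub>C (mel E s (x s) (y s) (inverse c *\<^sub>C b) - inverse c *\<^sub>C b - s *\<^sub>R blinfun_apply (gen E x y) (inverse c *\<^sub>C b))"
        by (simp add: diff inv sr)
      also have "norm \<dots> \<le> cmod c * (\<epsilon> * s * norm (inverse c *\<^sub>C b))"
        by (subst norm_scaleC) (intro mult_left_mono \<delta>(2)[OF s] norm_ge_zero)
      also have "\<dots> = \<epsilon> * s * norm b" using False by (simp add: norm_scaleC norm_inverse)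
      finally show ?thesis .
    qed
    then show "\<exists>\<delta>>0. \<forall>s. 0 < s \<and> s < \<delta> \<longrightarrow> (\<forall>v\<in>{y s}. \<forall>b.
        norm (mel E s (x s) v b - b - s *\<^sub>R c *\<^sub>C blinfun_apply (gen E x y) (inverse c *\<^sub>C b)) \<le> \<epsilon> * s * norm b)"
      using \<delta>(1) by blast
  qed
  from gen_eqI[OF x this, of "c *\<^sub>C b"] False scaleR_eq_scaleC[of 1 b] show ?thesis by (simp add: scaleC_scaleC)
qed

section \<open>Kernels of units as products over partitions\<close>

lemma mel_unit_fold:
  assumes x: "x \<in> units E" "y \<in> units E" and "\<And>r. r \<in> set rs \<Longrightarrow> 0 \<le> r"
  shows "mel E (sum_list rs) (x (sum_list rs)) (y (sum_list rs)) b = fold (\<lambda>r. mel E r (x r) (y r)) rs b"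
  using mel_tens[of rs "\<lambda>r. r" x y b] assms by (simp add: tens_unit unit_closed)

lemma partition_exists:
  fixes t \<delta> :: real
  assumes "0 < t" "0 < \<delta>"
  obtains rs where "sum_list rs = t" "\<And>r. r \<in> set rs \<Longrightarrow> 0 < r \<and> r < \<delta>"
proof -
  obtain n where n: "t / \<delta> < real n" using reals_Archimedean2 by blast
  have "0 < t / \<delta>" using assms by simp
  then have n0: "0 < real n" using n by linarith
  show ?thesis
  proof (rule that[of "replicate n (t / real n)"])
    show "sum_list (replicate n (t / real n)) = t" using n0 by (simp add: sum_list_replicate)
    have "0 < t / real n \<and> t / real n < \<delta>" using n n0 assms by (simp add: field_simps)
    then show "0 < r \<and> r < \<delta>" if "r \<in> set (replicate n (t / real n))" for r using that by simp
  qed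
qed

text \<open>Takes the place of the series for \<open>exp (t L)\<close>: the kernel is a product over
  a fine partition of the interval up to \<open>t\<close>, and the error rate
  \<open>\<epsilon>\<close> of the factors tends to 0.\<close>

lemma mel_exp_bound:
  assumes x: "x \<in> U" "y \<in> U" and \<alpha>: "\<And>b. norm (blinfun_apply (gen E x y) b) \<le> \<alpha> * norm b" "0 \<le> \<alpha>" and t: "0 < t"
  shows "norm (mel E t (x t) (y t) b - b - t *\<^sub>R blinfun_apply (gen E x y) b) \<le> (exp (\<alpha> * t) - 1 - \<alpha> * t) * norm b"
proof -
  have key: "norm (mel E t (x t) (y t) b - b - t *\<^sub>R blinfun_apply (gen E x y) b) \<le> (exp ((\<alpha> + \<epsilon>) * t) - 1 - \<alpha> * t) * norm b"
    if \<epsilon>: "\<epsilon> > 0" for \<epsilon>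
  proof -
    obtain \<delta> where \<delta>: "0 < \<delta>" "\<And>s b. 0 < s \<Longrightarrow> s < \<delta> \<Longrightarrow>
        norm (mel E s (x s) (y s) b - b - s *\<^sub>R blinfun_apply (gen E x y) b) \<le> \<epsilon> * s * norm b"
      by (rule first_order_singletonE[OF gen_first_order[OF x] \<epsilon>]) auto
    obtain rs where rs: "sum_list rs = t" "\<And>r. r \<in> set rs \<Longrightarrow> 0 < r \<and> r < \<delta>" using partition_exists[OF t \<delta>(1)] by blast
    have "norm (fold (\<lambda>r. mel E r (x r) (y r)) rs b - b - sum_list (map (\<lambda>r. r) rs) *\<^sub>R blinfun_apply (gen E x y) b)
        \<le> (exp ((\<alpha> + \<epsilon>) * sum_list (map (\<lambda>r. r) rs)) - 1 - \<alpha> * sum_list (map (\<lambda>r. r) rs)) * norm b"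
      using \<alpha> \<epsilon> \<delta>(2) rs(2) by (intro fold_first_order) (auto simp: less_imp_le blinfun.bounded_linear_right)
    then show ?thesis using mel_unit_fold[of x y rs b] x rs by (simp add: U_unit less_imp_le)
  qed
  have "((\<lambda>\<epsilon>. (exp ((\<alpha> + \<epsilon>) * t) - 1 - \<alpha> * t) * norm b) \<longlongrightarrow> (exp ((\<alpha> + 0) * t) - 1 - \<alpha> * t) * norm b) (at_right 0)"
    by (intro tendsto_intros)
  moreover have "eventually (\<lambda>\<epsilon>. norm (mel E t (x t) (y t) b - b - t *\<^sub>R blinfun_apply (gen E x y) b) \<le> (exp ((\<alpha> + \<epsilon>) * t) - 1 - \<alpha> * t) * norm b) (at_right 0)"
    using key by (auto simp: eventually_at_right_field intro: exI[of _ 1])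
  ultimately show ?thesis by (intro tendsto_lowerbound[where F="at_right (0::real)"]) auto
qed

lemma mel_compare:
  assumes x: "x \<in> U" "y \<in> U" "x' \<in> U" "y' \<in> U"
    and M: "\<And>b. norm (blinfun_apply (gen E x y) b) \<le> M * norm b" "\<And>b. norm (blinfun_apply (gen E x' y') b) \<le> M * norm b" "0 \<le> M"
    and \<eta>: "\<And>b. norm (blinfun_apply (gen E x y) b - blinfun_apply (gen E x' y') b) \<le> \<eta> * norm b" "0 \<le> \<eta>"
    and t: "0 < t"
  shows "norm (mel E t (x t) (y t) b - mel E t (x' t) (y' t) b) \<le> \<eta> * t * exp (M * t) * norm b"
proof -
  have key: "norm (mel E t (x t) (y t) b - mel E t (x' t) (y' t) b) \<le> (\<eta> + 2 * \<epsilon>) * t * exp ((M + \<epsilon>) * t) * norm b"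
    if \<epsilon>: "\<epsilon> > 0" for \<epsilon>
  proof -
    obtain d1 where d1: "0 < d1" "\<And>s b. 0 < s \<Longrightarrow> s < d1 \<Longrightarrow>
        norm (mel E s (x s) (y s) b - b - s *\<^sub>R blinfun_apply (gen E x y) b) \<le> \<epsilon> * s * norm b"
      by (rule first_order_singletonE[OF gen_first_order[OF x(1,2)] \<epsilon>]) auto
    obtain d2 where d2: "0 < d2" "\<And>s b. 0 < s \<Longrightarrow> s < d2 \<Longrightarrow>
        norm (mel E s (x' s) (y' s) b - b - s *\<^sub>R blinfun_apply (gen E x' y') b) \<le> \<epsilon> * s * norm b"
      by (rule first_order_singletonE[OF gen_first_order[OF x(3,4)] \<epsilon>]) auto
    obtain rs where rs: "sum_list rs = t" "\<And>r. r \<in> set rs \<Longrightarrow> 0 < r \<and> r < min d1 d2"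
      using partition_exists[OF t, of "min d1 d2"] d1 d2 by auto
    have "norm (fold (\<lambda>r. mel E r (x r) (y r)) rs b - fold (\<lambda>r. mel E r (x' r) (y' r)) rs b)
        \<le> (\<eta> + 2 * \<epsilon>) * sum_list (map (\<lambda>r. r) rs) * exp ((M + \<epsilon>) * sum_list (map (\<lambda>r. r) rs)) * norm b"
      using rs(2) d1(2) d2(2) M \<eta> \<epsilon> x
      by (intro fold_compare_first_order[where A="blinfun_apply (gen E x y)" and B="blinfun_apply (gen E x' y')"])
        (auto simp: U_closed less_imp_le intro: linear_mel)
    then show ?thesis using mel_unit_fold[of x y rs b] mel_unit_fold[of x' y' rs b] x rs by (simp add: U_unit less_imp_le)
  qed
  have "((\<lambda>\<epsilon>. (\<eta> + 2 * \<epsilon>) * t * exp ((M + \<epsilon>) * t) * norm b) \<longlongrightarrow> (\<eta> + 2 * 0) * t * exp ((M + 0) * t) * norm b) (at_right 0)"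
    by (intro tendsto_intros)
  moreover have "eventually (\<lambda>\<epsilon>. norm (mel E t (x t) (y t) b - mel E t (x' t) (y' t) b) \<le> (\<eta> + 2 * \<epsilon>) * t * exp ((M + \<epsilon>) * t) * norm b) (at_right 0)"
    using key by (auto simp: eventually_at_right_field intro: exI[of _ 1])
  ultimately show ?thesis by (intro tendsto_lowerbound[where F="at_right (0::real)"]) auto
qed

text \<open>Closeness of generators in the second argument becomes closeness of vectors, with the
  factor \<open>t\<close> that later permits division by \<open>t\<close>.\<close>

lemma hdist_compare:
  assumes x: "x \<in> U" "y \<in> U"
    and M: "\<And>b. norm (blinfun_apply (gen E x x) b) \<le> M * norm b" "\<And>b. norm (blinfun_apply (gen E x y) b) \<le> M * norm b"
      "\<And>b. norm (blinfun_apply (gen E y x) b) \<le> M * norm b" "\<And>b. norm (blinfun_apply (gen E y y) b) \<le> M * norm b" "0 \<le> M"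
    and \<eta>: "\<And>b. norm (blinfun_apply (gen E x x) b - blinfun_apply (gen E x y) b) \<le> \<eta> * norm b"
      "\<And>b. norm (blinfun_apply (gen E y x) b - blinfun_apply (gen E y y) b) \<le> \<eta> * norm b" "0 \<le> \<eta>"
    and t: "0 < t"
  shows "(hdist E t (x t) (y t))\<^sup>2 \<le> 2 * \<eta> * t * exp (M * t)"
proof -
  have "(hdist E t (x t) (y t))\<^sup>2
      \<le> norm (mel E t (x t) (x t) 1 - mel E t (x t) (y t) 1) + norm (mel E t (y t) (x t) 1 - mel E t (y t) (y t) 1)"
    using x t by (simp add: hdist_square U_closed norm_triangle_ineq4)
  also have "\<dots> \<le> \<eta> * t * exp (M * t) * norm (1::'b) + \<eta> * t * exp (M * t) * norm (1::'b)"
    using assms by (intro add_mono mel_compare) auto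
  also have "\<dots> \<le> \<eta> * t * exp (M * t) * 1 + \<eta> * t * exp (M * t) * 1"
    using \<eta>(3) t norm_one_le[where 'b='b] by (intro add_mono mult_left_mono) auto
  finally show ?thesis by simp
qed

text \<open>Choosing \<open>\<xi>\<close> as \<open>x\<close> and as \<open>y\<close> and passing to
  adjoints makes the four generators among \<open>x\<close> and \<open>y\<close> equal; then
  \<open>hdist_compare\<close> holds with \<open>\<eta> = 0\<close>.\<close>

lemma unit_eqI:
  assumes x: "x \<in> U" "y \<in> U" and eq: "\<And>\<xi> b. \<xi> \<in> U \<Longrightarrow> blinfun_apply (gen E x \<xi>) b = blinfun_apply (gen E y \<xi>) b"
  shows "x = y"
proof (rule unit_ext)
  fix t :: real assume t: "0 \<le> t"
  show "x t = y t"
  proof (cases "t = 0")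
    case False
    have yx: "gen E y x = gen E x x" and yy: "gen E y y = gen E x y"
      using eq[OF x(1)] eq[OF x(2)] by (simp_all add: blinfun_eqI)
    moreover have "gen E x x = gen E x y"
      by (rule blinfun_eqI) (simp add: gen_adj[OF x(2,1)] yx, simp flip: gen_adj[OF x(1,1)])
    ultimately have eq': "gen E x y = gen E x x" "gen E y x = gen E x x" "gen E y y = gen E x x" by simp_all
    have "(hdist E t (x t) (y t))\<^sup>2 \<le> 2 * 0 * t * exp (norm (gen E x x) * t)"
      using x False t by (intro hdist_compare) (simp_all add: eq' norm_blinfun)
    then show ?thesis using x t by (intro hdist_eq_0[of t]) (auto simp: U_closed)
  qed (use x in \<open>simp add: unit_0 U_unit\<close>)
qed (use x in \<open>simp_all add: U_unit\<close>)


lemma eventually_at_right_0I: "0 < \<delta> \<Longrightarrow> (\<And>s. 0 < s \<Longrightarrow> s < \<delta> \<Longrightarrow> P s) \<Longrightarrow> eventually P (at_right (0::real))"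
  unfolding eventually_at_right_field by blast

lemma first_order_tendsto:
  assumes "first_order E x (\<lambda>s. {y s}) (\<lambda>b. b) A"
  shows "((\<lambda>s. mel E s (x s) (y s) b) \<longlongrightarrow> b) (at_right 0)"
proof -
  obtain \<delta> where \<delta>: "0 < \<delta>" "\<And>s b. 0 < s \<Longrightarrow> s < \<delta> \<Longrightarrow> norm (mel E s (x s) (y s) b - b - s *\<^sub>R A b) \<le> 1 * s * norm b"
    by (rule first_order_singletonE[OF assms zero_less_one]) auto
  have "((\<lambda>s. s * norm b) \<longlongrightarrow> 0 * norm b) (at_right 0)" by (intro tendsto_intros)
  then have lim: "((\<lambda>s. s * norm b) \<longlongrightarrow> 0) (at_right 0)" by simp
  have "((\<lambda>s. mel E s (x s) (y s) b - b - s *\<^sub>R A b) \<longlongrightarrow> 0) (at_right 0)"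

  proof (rule Lim_null_comparison[OF _ lim])
    show "\<forall>\<^sub>F s in at_right 0. norm (mel E s (x s) (y s) b - b - s *\<^sub>R A b) \<le> s * norm b"
      by (rule eventually_at_right_0I[OF \<delta>(1)]) (use \<delta>(2) in simp)
  qed
  moreover have "((\<lambda>s. b + s *\<^sub>R A b) \<longlongrightarrow> b + 0 *\<^sub>R A b) (at_right 0)" by (intro tendsto_intros)
  ultimately have "((\<lambda>s. (mel E s (x s) (y s) b - b - s *\<^sub>R A b) + (b + s *\<^sub>R A b)) \<longlongrightarrow> 0 + (b + 0 *\<^sub>R A b)) (at_right 0)"
    by (rule tendsto_add)
  then show ?thesis by simp
qed

text \<open>The error depends on the total length of the partition, whatever the number and sizes of
  its parts; all limits along partitions rest on this.\<close>

lemma first_order_fold: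
  assumes fo: "first_order E x (\<lambda>s. {y s}) (\<lambda>b. b) A" and A: "bounded_linear A" and \<epsilon>: "0 < \<epsilon>"
  obtains \<delta> where "0 < \<delta>" "\<And>rs b. (\<forall>r\<in>set rs. 0 < r) \<Longrightarrow> sum_list rs < \<delta> \<Longrightarrow>
    norm (fold (\<lambda>r. mel E r (x r) (y r)) rs b - b - sum_list rs *\<^sub>R A b) \<le> \<epsilon> * sum_list rs * norm b"
proof -
  obtain \<alpha> where \<alpha>: "0 \<le> \<alpha>" "\<And>b. norm (A b) \<le> \<alpha> * norm b"
    using bounded_linear.nonneg_bounded[OF A] by (auto simp: mult.commute)
  \<comment> \<open>Halved because \<open>exp_first_order_bound\<close> returns twice the
    rate.\<close>
  have \<epsilon>2: "0 < \<epsilon> / 2" using \<epsilon> by simp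
  obtain d1 where d1: "0 < d1" "\<And>s b. 0 < s \<Longrightarrow> s < d1 \<Longrightarrow> norm (mel E s (x s) (y s) b - b - s *\<^sub>R A b) \<le> (\<epsilon> / 2) * s * norm b"
    by (rule first_order_singletonE[OF fo \<epsilon>2]) auto
  obtain d2 where d2: "0 < d2" "\<And>s. 0 \<le> s \<Longrightarrow> s \<le> d2 \<Longrightarrow> exp ((\<alpha> + \<epsilon> / 2) * s) - 1 - \<alpha> * s \<le> 2 * (\<epsilon> / 2) * s"
    using exp_first_order_bound[OF \<alpha>(1) \<epsilon>2] by auto
  show ?thesis
  proof (rule that[of "min d1 d2"])
    fix rs b assume rs: "\<forall>r\<in>set rs. 0 < r" "sum_list rs < min d1 d2"
    have lt: "r < d1" if "r \<in> set rs" for r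
      using member_le_sum_list[of r rs] that rs by (auto simp: less_imp_le)
    have "norm (fold (\<lambda>r. mel E r (x r) (y r)) rs b - b - sum_list (map (\<lambda>r. r) rs) *\<^sub>R A b)
        \<le> (exp ((\<alpha> + \<epsilon> / 2) * sum_list (map (\<lambda>r. r) rs)) - 1 - \<alpha> * sum_list (map (\<lambda>r. r) rs)) * norm b"
      using A \<alpha> \<epsilon>2 d1(2) rs lt by (intro fold_first_order) (auto simp: less_imp_le)
    also have "\<dots> \<le> (\<epsilon> * sum_list rs) * norm b"
      using d2(2)[of "sum_list rs"] rs sum_list_nonneg[of rs] by (intro mult_right_mono) (auto simp: less_imp_le)
    finally show "norm (fold (\<lambda>r. mel E r (x r) (y r)) rs b - b - sum_list rs *\<^sub>R A b) \<le> \<epsilon> * sum_list rs * norm b"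
      by simp
  qed (use d1 d2 in auto)
qed

end

section \<open>Partitions of an interval as lists of lengths\<close>

lemma sum_list_concat: "sum_list (concat pss) = sum_list (map sum_list pss)" for pss :: "real list list"
  by (induction pss) auto

lemma sum_list_pos: "\<forall>r\<in>set rs. 0 < r \<Longrightarrow> rs \<noteq> [] \<Longrightarrow> 0 < sum_list rs" for rs :: "real list"
proof (cases rs)
  case (Cons a list)
  assume "\<forall>r\<in>set rs. 0 < r"
  then have "0 < a" "0 \<le> sum_list list" using Cons sum_list_nonneg[of list] by (auto simp: less_imp_le)
  then show ?thesis using Cons by simp
qed simp

definition refines :: "real list list \<Rightarrow> real list list \<Rightarrow> real list \<Rightarrow> real list \<Rightarrow> bool" where
  "refines pss qss ps qs \<longleftrightarrow> map sum_list pss = ps \<and> map sum_list qss = qs \<and> concat pss = concat qss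
     \<and> (\<forall>r\<in>set (concat pss). 0 < r) \<and> (\<forall>r\<in>set (concat qss). 0 < r)"

text \<open>Cut the shorter of the two first parts off the longer one: the remaining lists have
  fewer parts in total.\<close>

lemma common_refinement:
  fixes ps qs :: "real list"
  assumes "\<forall>r\<in>set ps. 0 < r" "\<forall>r\<in>set qs. 0 < r" "sum_list ps = sum_list qs"
  shows "\<exists>pss qss. refines pss qss ps qs"
  using assms
proof (induction "length ps + length qs" arbitrary: ps qs rule: less_induct)
  case less
  show ?case
  proof (cases ps)
    case Nil
    then have "qs = []" using less.prems sum_list_pos[of qs] by auto
    with Nil show ?thesis by (intro exI[of _ "[]"]) (simp add: refines_def)
  next
    case p: (Cons a ps')
    have "qs \<noteq> []" using p less.prems sum_list_pos[of ps] by auto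
    then obtain b qs' where q: "qs = b # qs'" by (cases qs) auto
    consider "a < b" | "a = b" | "b < a" by linarith
    then show ?thesis
    proof cases
      case 1
      have "\<exists>pss qss. refines pss qss ps' ((b - a) # qs')"
        using less.prems p q 1 by (intro less.hyps) auto
      then obtain pss qss0 where r: "refines pss qss0 ps' ((b - a) # qs')" by blast
      then obtain h qss where "qss0 = h # qss" by (cases qss0) (auto simp: refines_def)
      with r have "refines ([a] # pss) ((a # h) # qss) ps qs"
        using p q less.prems by (auto simp: refines_def)
      then show ?thesis by blast
    next
      case 2
      have "\<exists>pss qss. refines pss qss ps' qs'"
        using less.prems p q 2 by (intro less.hyps) auto
      then obtain pss qss where "refines pss qss ps' qs'" by blast
      then have "refines ([a] # pss) ([b] # qss) ps qs"
        using p q 2 less.prems by (auto simp: refines_def)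
      then show ?thesis by blast
    next
      case 3
      have "\<exists>pss qss. refines pss qss ((a - b) # ps') qs'"
        using less.prems p q 3 by (intro less.hyps) auto
      then obtain pss0 qss where r: "refines pss0 qss ((a - b) # ps') qs'" by blast
      then obtain h pss where "pss0 = h # pss" by (cases pss0) (auto simp: refines_def)
      with r have "refines ((b # h) # pss) ([b] # qss) ps qs"
        using p q less.prems by (auto simp: refines_def)
      then show ?thesis by blast
    qed
  qed
qed

section \<open>Existence of power limits\<close>

text \<open>For \<open>y = \<Sum>\<^sub>j a\<^sub>j x\<^sup>j c\<^sub>j\<close> with \<open>x\<^sup>j\<close> in \<open>U\<close>, the functional is \<open>\<Phi> A b = \<Sum>\<^sub>j c\<^sub>j\<^sup>* A\<^sub>x\<^sub>j (a\<^sub>j\<^sup>* b)\<close>;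
  \<open>y\<close> is tangent if moreover \<open>\<Sum>\<^sub>j a\<^sub>j c\<^sub>j = 1\<close>.\<close>

context product_system_unit
begin

text \<open>Describes a combination of units by its effect on expansions. The quantifier over
  \<open>T\<close> permits a second use, with tensor products of \<open>y\<close> itself on the
  right, after a first use against units.\<close>

definition expands :: "(real \<Rightarrow> 'e) \<Rightarrow> ('b \<Rightarrow> 'b) \<Rightarrow> (((real \<Rightarrow> 'e) \<Rightarrow> 'b \<Rightarrow> 'b) \<Rightarrow> 'b \<Rightarrow> 'b) \<Rightarrow> bool" where
  "expands y P \<Phi> \<longleftrightarrow> (\<forall>s>0. y s \<in> carrier (fibre E s)) \<and>
    (\<forall>T A. (\<forall>s>0. T s \<subseteq> carrier (fibre E s)) \<longrightarrow> (\<forall>x\<in>U. bounded_linear (A x)) \<longrightarrow>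
       (\<forall>x\<in>U. first_order E x T (\<lambda>b. b) (A x)) \<longrightarrow>
       bounded_linear (\<Phi> A) \<and> first_order E y T P (\<Phi> A))"

definition tangent :: "(real \<Rightarrow> 'e) \<Rightarrow> (((real \<Rightarrow> 'e) \<Rightarrow> 'b \<Rightarrow> 'b) \<Rightarrow> 'b \<Rightarrow> 'b) \<Rightarrow> bool" where
  "tangent y \<Phi> \<longleftrightarrow> y 0 = triv E 1 \<and> expands y (\<lambda>b. b) \<Phi>"

lemma expandsI:
  assumes "\<And>s. 0 < s \<Longrightarrow> y s \<in> carrier (fibre E s)"
    and "\<And>A. (\<And>x. x \<in> U \<Longrightarrow> bounded_linear (A x)) \<Longrightarrow> bounded_linear (\<Phi> A)"
    and "\<And>T A. (\<And>s. 0 < s \<Longrightarrow> T s \<subseteq> carrier (fibre E s)) \<Longrightarrow> (\<And>x. x \<in> U \<Longrightarrow> bounded_linear (A x)) \<Longrightarrow>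
      (\<And>x. x \<in> U \<Longrightarrow> first_order E x T (\<lambda>b. b) (A x)) \<Longrightarrow> first_order E y T P (\<Phi> A)"
  shows "expands y P \<Phi>"
  unfolding expands_def
proof (intro conjI allI impI)
  fix T A assume *: "\<forall>s>0. T s \<subseteq> carrier (fibre E s)" "\<forall>x\<in>U. bounded_linear (A x)"
    "\<forall>x\<in>U. first_order E x T (\<lambda>b. b) (A x)"
  show "bounded_linear (\<Phi> A)" by (rule assms(2)) (use * in simp)
  show "first_order E y T P (\<Phi> A)" by (rule assms(3)) (use * in simp_all)
qed (rule assms(1))

lemma expandsD:
  assumes "expands y P \<Phi>" "\<And>s. 0 < s \<Longrightarrow> T s \<subseteq> carrier (fibre E s)" "\<And>x. x \<in> U \<Longrightarrow> bounded_linear (A x)"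
    "\<And>x. x \<in> U \<Longrightarrow> first_order E x T (\<lambda>b. b) (A x)"
  shows "bounded_linear (\<Phi> A)" "first_order E y T P (\<Phi> A)"
proof -
  have "(\<forall>s>0. T s \<subseteq> carrier (fibre E s)) \<longrightarrow> (\<forall>x\<in>U. bounded_linear (A x)) \<longrightarrow>
       (\<forall>x\<in>U. first_order E x T (\<lambda>b. b) (A x)) \<longrightarrow> bounded_linear (\<Phi> A) \<and> first_order E y T P (\<Phi> A)"
    using assms(1) unfolding expands_def by (elim conjE, elim allE)
  with assms(2-) show "bounded_linear (\<Phi> A)" "first_order E y T P (\<Phi> A)" by simp_all
qed

lemma expands_bounded_linear:
  assumes "expands y P \<Phi>" "\<And>x. x \<in> U \<Longrightarrow> bounded_linear (A x)"
  shows "bounded_linear (\<Phi> A)"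
  \<comment> \<open>With no right vectors at all the expansions hold vacuously, which leaves the
    boundedness.\<close>
  by (rule expandsD(1)[OF assms(1), where T="\<lambda>s. {}"]) (auto simp: assms(2) first_order_def intro: zero_less_one)

lemma expands_closed: "expands y P \<Phi> \<Longrightarrow> 0 < s \<Longrightarrow> y s \<in> carrier (fibre E s)"
  by (simp add: expands_def)

end

section \<open>Tensor powers of a tangent family and their limit\<close>

locale tangent_family = product_system_unit +
  fixes y :: "real \<Rightarrow> 'b" and \<Phi>
  assumes tangent: "tangent y \<Phi>"
begin

lemma y_closed: "0 < s \<Longrightarrow> y s \<in> carrier (fibre E s)"
  using tangent expands_closed by (auto simp: tangent_def)

lemma y_expands: "expands y (\<lambda>b. b) \<Phi>"
  using tangent by (simp add: tangent_def)

definition Y where "Y rs = tens E (map (\<lambda>r. (r, y r)) rs)"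

definition B where "B \<xi> = \<Phi> (\<lambda>x. blinfun_apply (gen E x \<xi>))"

definition B' where "B' \<xi> b = adj (B \<xi> (adj b))"

text \<open>Here \<open>\<Phi>\<close> is applied a second time: \<open>B' x\<close> expands the
  unit \<open>x\<close> against \<open>y\<close>, and inserting these linear terms on the left
  expands \<open>y\<close> against \<open>y\<close>.\<close>

definition A where "A = \<Phi> B'"

definition pos :: "real list \<Rightarrow> bool" where "pos rs \<longleftrightarrow> (\<forall>r\<in>set rs. 0 < r)"

lemma Y_closed: "pos rs \<Longrightarrow> Y rs \<in> carrier (fibre E (sum_list rs))"
  unfolding Y_def using tens_closed[of "map (\<lambda>r. (r, y r)) rs"]
  by (auto simp: timed_def pos_def comp_def y_closed less_imp_le)

lemma mel_Y_unit:
  assumes "pos rs" "\<xi> \<in> units E"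
  shows "mel E (sum_list rs) (Y rs) (\<xi> (sum_list rs)) b = fold (\<lambda>r. mel E r (y r) (\<xi> r)) rs b"
  using mel_tens[of rs "\<lambda>r. r" y \<xi> b] assms by (simp add: Y_def pos_def tens_unit unit_closed y_closed less_imp_le)

lemma mel_unit_Y:
  assumes "pos rs" "\<xi> \<in> units E"
  shows "mel E (sum_list rs) (\<xi> (sum_list rs)) (Y rs) b = fold (\<lambda>r. mel E r (\<xi> r) (y r)) rs b"
  using mel_tens[of rs "\<lambda>r. r" \<xi> y b] assms by (simp add: Y_def pos_def tens_unit unit_closed y_closed less_imp_le)

lemma mel_Y_Y:
  assumes "pos rs"
  shows "mel E (sum_list rs) (Y rs) (Y rs) b = fold (\<lambda>r. mel E r (y r) (y r)) rs b"
  using mel_tens[of rs "\<lambda>r. r" y y b] assms by (simp add: Y_def pos_def y_closed less_imp_le)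

lemma B_expansion:
  assumes "\<xi> \<in> U"
  shows "bounded_linear (B \<xi>)" "first_order E y (\<lambda>s. {\<xi> s}) (\<lambda>b. b) (B \<xi>)"
  unfolding B_def using assms
  by (auto intro!: expandsD[OF y_expands, where T="\<lambda>s. {\<xi> s}"] simp: U_closed blinfun.bounded_linear_right gen_first_order)

lemma B'_expansion: assumes "\<xi> \<in> U" shows "bounded_linear (B' \<xi>)" "first_order E \<xi> (\<lambda>s. {y s}) (\<lambda>b. b) (B' \<xi>)"
proof -
  have "bounded_linear (\<lambda>b. adj (B \<xi> (adj b)))"
    by (intro bounded_linear_compose[OF bounded_linear_adj] bounded_linear_compose[OF B_expansion(1)[OF assms]] bounded_linear_adj)
  then show "bounded_linear (B' \<xi>)" by (simp add: B'_def[abs_def])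
  show "first_order E \<xi> (\<lambda>s. {y s}) (\<lambda>b. b) (B' \<xi>)"
    unfolding B'_def[abs_def] using B_expansion(2)[OF assms] assms by (intro first_order_adj) (auto simp: U_closed y_closed)
qed

text \<open>A unit \<open>x\<close> splits along every partition \<open>rs\<close> of
  \<open>s\<close>, so against \<open>Y rs\<close> it is a product with linear term
  \<open>s B' x\<close>, whatever the partition. The family \<open>y\<close> does not split, but
  inherits the expansion from the units through \<open>\<Phi>\<close>.\<close>

lemma A_expansion: "bounded_linear A" "first_order E y (\<lambda>s. {Y rs |rs. pos rs \<and> sum_list rs = s}) (\<lambda>b. b) A"
proof -
  let ?T = "\<lambda>s. {Y rs |rs. pos rs \<and> sum_list rs = s}"
  have fo: "first_order E x ?T (\<lambda>b. b) (B' x)" if x: "x \<in> U" for x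
  proof -
    show "first_order E x ?T (\<lambda>b. b) (B' x)"
    proof (rule first_orderI)
      fix \<epsilon> :: real assume "0 < \<epsilon>"
      then obtain \<delta> where \<delta>: "0 < \<delta>" "\<And>rs b. (\<forall>r\<in>set rs. 0 < r) \<Longrightarrow> sum_list rs < \<delta> \<Longrightarrow>
          norm (fold (\<lambda>r. mel E r (x r) (y r)) rs b - b - sum_list rs *\<^sub>R B' x b) \<le> \<epsilon> * sum_list rs * norm b"
        using first_order_fold[OF B'_expansion(2,1)[OF x]] by metis
      have "norm (mel E s (x s) v b - b - s *\<^sub>R B' x b) \<le> \<epsilon> * s * norm b"
        if s: "s < \<delta>" and v: "v \<in> ?T s" for s v b
      proof -
        obtain rs where rs: "v = Y rs" "pos rs" "sum_list rs = s" using v by auto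
        have "mel E s (x s) v b = fold (\<lambda>r. mel E r (x r) (y r)) rs b"
          using mel_unit_Y[OF rs(2) U_unit[OF x]] rs by simp
        then show ?thesis using \<delta>(2)[of rs b] rs s by (simp add: pos_def)
      qed
      then show "\<exists>\<delta>>0. \<forall>s v b. 0 < s \<longrightarrow> s < \<delta> \<longrightarrow> v \<in> ?T s \<longrightarrow> norm (mel E s (x s) v b - b - s *\<^sub>R B' x b) \<le> \<epsilon> * s * norm b"
        using \<delta>(1) by (intro exI[of _ \<delta>]) auto
    qed
  qed
  have T: "0 < s \<Longrightarrow> ?T s \<subseteq> carrier (fibre E s)" for s using Y_closed by auto
  show "bounded_linear A" "first_order E y ?T (\<lambda>b. b) A"
    unfolding A_def by (rule expandsD[OF y_expands T B'_expansion(1) fo]; assumption)+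
qed

lemma Y_singleton: "0 < s \<Longrightarrow> Y [s] = y s"
  by (simp add: Y_def tens_singleton y_closed del: tens.simps)

lemma A_self: "first_order E y (\<lambda>s. {y s}) (\<lambda>b. b) A"
proof (rule first_orderI)
  fix \<epsilon> :: real assume "0 < \<epsilon>"
  then obtain \<delta> where \<delta>: "0 < \<delta>" "\<And>s v b. 0 < s \<Longrightarrow> s < \<delta> \<Longrightarrow> v \<in> {Y rs |rs. pos rs \<and> sum_list rs = s} \<Longrightarrow>
      norm (mel E s (y s) v b - b - s *\<^sub>R A b) \<le> \<epsilon> * s * norm b"
    by (rule first_orderE[OF A_expansion(2)]) auto
  have "y s \<in> {Y rs |rs. pos rs \<and> sum_list rs = s}" if "0 < s" for s
    using that Y_singleton[OF that] by (auto simp: pos_def intro!: exI[of _ "[s]"])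
  then show "\<exists>\<delta>>0. \<forall>s v b. 0 < s \<longrightarrow> s < \<delta> \<longrightarrow> v \<in> {y s} \<longrightarrow> norm (mel E s (y s) v b - b - s *\<^sub>R A b) \<le> \<epsilon> * s * norm b"
    using \<delta> by (intro exI[of _ \<delta>]) auto
qed

text \<open>Both vectors are products over the coarse parts, with factors
  \<open>y (sum_list p)\<close> and \<open>Y p\<close>. The kernels between such factors share the
  linear term \<open>A\<close>, so their products differ by a multiple of
  \<open>\<eta>\<close>.\<close>

lemma refinement_close:
  assumes t: "0 < t" and \<epsilon>: "0 < \<epsilon>"
  obtains \<delta> where "0 < \<delta>" "\<And>pss. pos (concat pss) \<Longrightarrow> \<forall>p\<in>set pss. p \<noteq> [] \<and> sum_list p < \<delta> \<Longrightarrow>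
    sum_list (map sum_list pss) = t \<Longrightarrow> hdist E t (Y (map sum_list pss)) (Y (concat pss)) \<le> \<epsilon>"
proof -
  obtain \<alpha> where \<alpha>: "0 \<le> \<alpha>" "\<And>b. norm (A b) \<le> \<alpha> * norm b"
    using bounded_linear.nonneg_bounded[OF A_expansion(1)] by (auto simp: mult.commute)
  \<comment> \<open>The squared distance is at most two terms
    \<open>2 \<eta> t exp ((\<alpha> + \<eta>) t)\<close>; the minimum with 1 replaces
    \<open>\<alpha> + \<eta>\<close> by \<open>\<alpha> + 1\<close> in the exponent.\<close>
  define \<eta> where "\<eta> = min 1 (\<epsilon>\<^sup>2 / (4 * t * exp ((\<alpha> + 1) * t)))"
  have \<eta>: "0 < \<eta>" "\<eta> \<le> 1" "4 * \<eta> * t * exp ((\<alpha> + 1) * t) \<le> \<epsilon>\<^sup>2"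
    using t \<epsilon> by (auto simp: \<eta>_def field_simps min_def)
  obtain d1 where d1: "0 < d1" "\<And>s v b. 0 < s \<Longrightarrow> s < d1 \<Longrightarrow> v \<in> {Y rs |rs. pos rs \<and> sum_list rs = s} \<Longrightarrow>
      norm (mel E s (y s) v b - b - s *\<^sub>R A b) \<le> \<eta> * s * norm b"
    by (rule first_orderE[OF A_expansion(2) \<eta>(1)]) auto
  obtain d2 where d2: "0 < d2" "\<And>s b. 0 < s \<Longrightarrow> s < d2 \<Longrightarrow> norm (mel E s (y s) (y s) b - b - s *\<^sub>R A b) \<le> \<eta> * s * norm b"
    by (rule first_order_singletonE[OF A_self \<eta>(1)]) auto
  obtain d3 where d3: "0 < d3" "\<And>rs b. (\<forall>r\<in>set rs. 0 < r) \<Longrightarrow> sum_list rs < d3 \<Longrightarrow>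
      norm (fold (\<lambda>r. mel E r (y r) (y r)) rs b - b - sum_list rs *\<^sub>R A b) \<le> \<eta> * sum_list rs * norm b"
    using first_order_fold[OF A_self A_expansion(1) \<eta>(1)] by metis
  define \<delta> where "\<delta> = min d1 (min d2 d3)"
  show ?thesis
  proof (rule that[of \<delta>])
    show "0 < \<delta>" using d1 d2 d3 by (simp add: \<delta>_def)
    fix pss assume pss: "pos (concat pss)" "\<forall>p\<in>set pss. p \<noteq> [] \<and> sum_list p < \<delta>" "sum_list (map sum_list pss) = t"
    let ?r = "map sum_list pss" and ?c = "concat pss"
    have pp: "pos p" "0 < sum_list p" if "p \<in> set pss" for p
    proof -
      show "pos p" using pss(1) that by (auto simp: pos_def)
      moreover have "p \<noteq> []" using pss that by blast
      ultimately show "0 < sum_list p"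
        using \<open>pos p\<close> by (auto simp: pos_def intro: sum_list_pos)
    qed
    have sumc: "sum_list ?c = t" using pss(3) by (simp add: sum_list_concat)
    have posr: "pos ?r" using pp by (auto simp: pos_def)
    have Yr: "Y ?r = tens E (map (\<lambda>p. (sum_list p, y (sum_list p))) pss)" by (simp add: Y_def comp_def)
    have Yc: "Y ?c = tens E (map (\<lambda>p. (sum_list p, Y p)) pss)"
    proof -
      have "timed E (concat (map (map (\<lambda>r. (r, y r))) pss))"
        using pss(1) by (auto simp: timed_def pos_def y_closed less_imp_le)
      from tens_concat[OF this] show ?thesis by (simp add: Y_def map_concat comp_def)
    qed
    have c: "y (sum_list p) \<in> carrier (fibre E (sum_list p))" "Y p \<in> carrier (fibre E (sum_list p))" "0 \<le> sum_list p"
      if "p \<in> set pss" for p using pp[OF that] Y_closed y_closed by auto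
    have rr: "mel E t (Y ?r) (Y ?r) b = fold (\<lambda>p. mel E (sum_list p) (y (sum_list p)) (y (sum_list p))) pss b" for b
      using mel_tens[of pss sum_list "\<lambda>p. y (sum_list p)" "\<lambda>p. y (sum_list p)" b] c pss(3) by (simp add: Yr)
    have rc: "mel E t (Y ?r) (Y ?c) b = fold (\<lambda>p. mel E (sum_list p) (y (sum_list p)) (Y p)) pss b" for b
      using mel_tens[of pss sum_list "\<lambda>p. y (sum_list p)" Y b] c pss(3) by (simp add: Yr Yc)
    have cc: "mel E t (Y ?c) (Y ?c) b = fold (\<lambda>p. mel E (sum_list p) (Y p) (Y p)) pss b" for b
      using mel_tens[of pss sum_list Y Y b] c pss(3) by (simp add: Yc)
    have fo: "norm (mel E (sum_list p) (y (sum_list p)) (y (sum_list p)) b - b - sum_list p *\<^sub>R A b) \<le> \<eta> * sum_list p * norm b"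
        "norm (mel E (sum_list p) (y (sum_list p)) (Y p) b - b - sum_list p *\<^sub>R A b) \<le> \<eta> * sum_list p * norm b"
        "norm (mel E (sum_list p) (Y p) (Y p) b - b - sum_list p *\<^sub>R A b) \<le> \<eta> * sum_list p * norm b"
      if p: "p \<in> set pss" for p b
    proof -
      have lt: "sum_list p < d1" "sum_list p < d2" "sum_list p < d3" using pss(2) p by (auto simp: \<delta>_def)
      show "norm (mel E (sum_list p) (y (sum_list p)) (y (sum_list p)) b - b - sum_list p *\<^sub>R A b) \<le> \<eta> * sum_list p * norm b"
        by (rule d2(2)[OF pp(2)[OF p] lt(2)])
      show "norm (mel E (sum_list p) (y (sum_list p)) (Y p) b - b - sum_list p *\<^sub>R A b) \<le> \<eta> * sum_list p * norm b"
        using pp(1)[OF p] by (intro d1(2)[OF pp(2)[OF p] lt(1)]) auto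
      show "norm (mel E (sum_list p) (Y p) (Y p) b - b - sum_list p *\<^sub>R A b) \<le> \<eta> * sum_list p * norm b"
        using d3(2)[of p b] lt(3) pp(1)[OF p] by (simp add: mel_Y_Y pos_def)
    qed
    have cmp: "norm (fold (\<lambda>p. mel E (sum_list p) (u p) (v p)) pss 1 - fold (\<lambda>p. mel E (sum_list p) (u' p) (v' p)) pss 1)
        \<le> 2 * \<eta> * t * exp ((\<alpha> + \<eta>) * t) * norm (1::'a)"
      if uv: "\<And>p b. p \<in> set pss \<Longrightarrow> norm (mel E (sum_list p) (u p) (v p) b - b - sum_list p *\<^sub>R A b) \<le> \<eta> * sum_list p * norm b"
        "\<And>p b. p \<in> set pss \<Longrightarrow> norm (mel E (sum_list p) (u' p) (v' p) b - b - sum_list p *\<^sub>R A b) \<le> \<eta> * sum_list p * norm b"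
        "\<And>p. p \<in> set pss \<Longrightarrow> u' p \<in> carrier (fibre E (sum_list p)) \<and> v' p \<in> carrier (fibre E (sum_list p))"
      for u v u' v'
      using fold_compare_first_order[of pss sum_list 0 \<eta> \<alpha> "\<lambda>p. mel E (sum_list p) (u p) (v p)" A "\<lambda>p. mel E (sum_list p) (u' p) (v' p)" A 1]
        uv c(3) \<eta> \<alpha> by (simp add: pss(3) linear_mel)
    have Yr_c: "Y ?r \<in> carrier (fibre E t)" using Y_closed[OF posr] pss(3) by simp
    have Yc_c: "Y ?c \<in> carrier (fibre E t)" using Y_closed[OF pss(1)] sumc by simp
    have b1: "norm (mel E t (Y ?r) (Y ?r) 1 - mel E t (Y ?r) (Y ?c) 1) \<le> 2 * \<eta> * t * exp ((\<alpha> + \<eta>) * t) * norm (1::'a)"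
      using cmp[of "\<lambda>p. y (sum_list p)" "\<lambda>p. y (sum_list p)" "\<lambda>p. y (sum_list p)" Y, OF fo(1) fo(2)] c
      by (simp add: rr rc)
    have b2: "norm (mel E t (Y ?r) (Y ?c) 1 - mel E t (Y ?c) (Y ?c) 1) \<le> 2 * \<eta> * t * exp ((\<alpha> + \<eta>) * t) * norm (1::'a)"
      using cmp[of "\<lambda>p. y (sum_list p)" Y Y Y, OF fo(2) fo(3)] c
      by (simp add: cc rc)
    \<comment> \<open>\<open>A_expansion\<close> has a single factor on the left; the kernel with
      the fine product on the left and the coarse one on the right is reached by adjoints.\<close>
    have "norm (mel E t (Y ?c) (Y ?r) 1 - mel E t (Y ?c) (Y ?c) 1) = norm (adj (mel E t (Y ?r) (Y ?c) 1 - mel E t (Y ?c) (Y ?c) 1))"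
      using t Yr_c Yc_c by (simp add: adj_diff adj_mel del: norm_adj)
    with b2 have b3: "norm (mel E t (Y ?c) (Y ?r) 1 - mel E t (Y ?c) (Y ?c) 1) \<le> 2 * \<eta> * t * exp ((\<alpha> + \<eta>) * t) * norm (1::'a)"
      by simp
    have "(hdist E t (Y ?r) (Y ?c))\<^sup>2 \<le> norm (mel E t (Y ?r) (Y ?r) 1 - mel E t (Y ?r) (Y ?c) 1) + norm (mel E t (Y ?c) (Y ?r) 1 - mel E t (Y ?c) (Y ?c) 1)"
      using t Yr_c Yc_c by (simp add: hdist_square norm_triangle_ineq4)
    also have "\<dots> \<le> 2 * \<eta> * t * exp ((\<alpha> + \<eta>) * t) * norm (1::'a) + 2 * \<eta> * t * exp ((\<alpha> + \<eta>) * t) * norm (1::'a)"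
      by (rule add_mono[OF b1 b3])
    also have "\<dots> \<le> 2 * \<eta> * t * exp ((\<alpha> + 1) * t) * 1 + 2 * \<eta> * t * exp ((\<alpha> + 1) * t) * 1"
      using \<eta> t \<alpha> norm_one_le[where 'b='a] by (intro add_mono mult_mono) auto
    also have "\<dots> \<le> \<epsilon>\<^sup>2" using \<eta>(3) by simp
    finally show "hdist E t (Y ?r) (Y ?c) \<le> \<epsilon>" by (rule power2_le_imp_le) (use \<epsilon> in simp)
  qed
qed

lemma partitions_close:
  assumes t: "0 < t" and \<epsilon>: "0 < \<epsilon>"
  obtains \<delta> where "0 < \<delta>" "\<And>ps qs. pos ps \<Longrightarrow> pos qs \<Longrightarrow> \<forall>r\<in>set ps. r < \<delta> \<Longrightarrow> \<forall>r\<in>set qs. r < \<delta> \<Longrightarrow>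
    sum_list ps = t \<Longrightarrow> sum_list qs = t \<Longrightarrow> hdist E t (Y ps) (Y qs) \<le> \<epsilon>"
proof -
  have "0 < \<epsilon> / 2" using \<epsilon> by simp
  then obtain \<delta> where \<delta>: "0 < \<delta>" "\<And>pss. pos (concat pss) \<Longrightarrow> \<forall>p\<in>set pss. p \<noteq> [] \<and> sum_list p < \<delta> \<Longrightarrow>
      sum_list (map sum_list pss) = t \<Longrightarrow> hdist E t (Y (map sum_list pss)) (Y (concat pss)) \<le> \<epsilon> / 2"
    using refinement_close[OF t] by metis
  show ?thesis
  proof (rule that[OF \<delta>(1)])
    fix ps qs assume pq: "pos ps" "pos qs" "\<forall>r\<in>set ps. r < \<delta>" "\<forall>r\<in>set qs. r < \<delta>" "sum_list ps = t" "sum_list qs = t"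
    obtain pss qss where R: "map sum_list pss = ps" "map sum_list qss = qs" "concat pss = concat qss" "\<forall>r\<in>set (concat pss). 0 < r"
    proof -
      have "\<exists>pss qss. refines pss qss ps qs" using pq by (intro common_refinement) (auto simp: pos_def)
      then show ?thesis using that unfolding refines_def by blast
    qed
    have n: "p \<noteq> [] \<and> sum_list p < \<delta>" if "p \<in> set pss" for p
    proof -
      have "sum_list p \<in> set ps" using that by (auto simp flip: R(1))
      then show ?thesis using pq(1,3) by (auto simp: pos_def)
    qed
    have n': "p \<noteq> [] \<and> sum_list p < \<delta>" if "p \<in> set qss" for p
    proof -
      have "sum_list p \<in> set qs" using that by (auto simp flip: R(2))
      then show ?thesis using pq(2,4) by (auto simp: pos_def)
    qed
    have 1: "hdist E t (Y ps) (Y (concat pss)) \<le> \<epsilon> / 2"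
      using \<delta>(2)[of pss] R n pq by (simp add: pos_def)
    have 2: "hdist E t (Y qs) (Y (concat pss)) \<le> \<epsilon> / 2"
      using \<delta>(2)[of qss] R n' pq by (simp add: pos_def)
    have c: "Y ps \<in> carrier (fibre E t)" "Y qs \<in> carrier (fibre E t)" "Y (concat pss) \<in> carrier (fibre E t)"
      using Y_closed[OF pq(1)] Y_closed[OF pq(2)] Y_closed[of "concat pss"] pq R by (auto simp: pos_def sum_list_concat)
    show "hdist E t (Y ps) (Y qs) \<le> \<epsilon>"
      using hdist_triangle[of t "Y ps" "Y (concat pss)" "Y qs"] hdist_commute[of t "Y qs" "Y (concat pss)"] c t 1 2 by simp
  qed
qed

text \<open>The shift to \<open>Suc m\<close> is that of \<open>power_limit\<close>, where it avoids
  division by 0.\<close>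

definition part where "part t m = replicate (Suc m) (t / real (Suc m))"

lemma part: "0 < t \<Longrightarrow> pos (part t m)" "sum_list (part t m) = t"
  by (auto simp: part_def pos_def sum_list_replicate simp del: replicate_Suc of_nat_Suc)

lemma part_mesh: "0 < \<delta> \<Longrightarrow> \<exists>M. \<forall>m\<ge>M. \<forall>r\<in>set (part t m). r < \<delta>"
proof -
  assume \<delta>: "0 < \<delta>"
  have "(\<lambda>m. t / real (Suc m)) \<longlonglongrightarrow> 0" by (rule LIMSEQ_Suc) (rule lim_const_over_n)
  then have "eventually (\<lambda>m. t / real (Suc m) < \<delta>) sequentially" using \<delta> by (rule order_tendstoD)
  then show ?thesis by (auto simp: eventually_sequentially part_def simp del: replicate_Suc of_nat_Suc)
qed

definition Z where "Z = power_limit E y"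

lemma Z_limit:
  assumes t: "0 < t"
  shows "Z t \<in> carrier (fibre E t)" "(\<lambda>m. hdist E t (Y (part t m)) (Z t)) \<longlonglongrightarrow> 0"
proof -
  interpret M: hilbert_bimodule "fibre E t" by (rule hilbert) (use t in simp)
  let ?f = "\<lambda>m. Y (part t m)"
  have c: "?f m \<in> carrier (fibre E t)" for m using Y_closed[OF part(1)[OF t]] part(2) by simp
  have f: "?f = (\<lambda>m. tensor_power E (t / real (Suc m)) (y (t / real (Suc m))) (Suc m))"
    using t by (subst tensor_power_eq_tens) (auto simp: Y_def part_def y_closed simp del: replicate_Suc of_nat_Suc tensor_power.simps)
  have "h_Cauchy (fibre E t) ?f"
    unfolding h_Cauchy_def
  proof (intro conjI allI impI c)
    fix e :: real assume "e > 0"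
    then have "e / 2 > 0" by simp
    then obtain \<delta> where \<delta>: "0 < \<delta>" "\<And>ps qs. pos ps \<Longrightarrow> pos qs \<Longrightarrow> \<forall>r\<in>set ps. r < \<delta> \<Longrightarrow> \<forall>r\<in>set qs. r < \<delta> \<Longrightarrow>
        sum_list ps = t \<Longrightarrow> sum_list qs = t \<Longrightarrow> hdist E t (Y ps) (Y qs) \<le> e / 2"
      using partitions_close[OF t] by metis
    obtain M where "\<forall>m\<ge>M. \<forall>r\<in>set (part t m). r < \<delta>" using part_mesh[OF \<delta>(1)] by blast
    then have "hdist E t (?f m) (?f n) \<le> e / 2" if "m \<ge> M" "n \<ge> M" for m n
      using that t by (intro \<delta>(2)) (auto simp: part)
    then show "\<exists>M. \<forall>m\<ge>M. \<forall>n\<ge>M. hnorm (fibre E t) (?f m \<ominus>\<^bsub>fibre E t\<^esub> ?f n) < e"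
      using \<open>e > 0\<close> by (intro exI[of _ M]) (fastforce simp: hdist_def)
  qed
  then obtain l where l: "l \<in> carrier (fibre E t)" "h_tendsto (fibre E t) ?f l" using M.complete by blast
  have "Z t = l" using t M.h_lim_eqI[OF c l] by (simp add: Z_def power_limit_def f)
  then show "Z t \<in> carrier (fibre E t)" "(\<lambda>m. hdist E t (Y (part t m)) (Z t)) \<longlonglongrightarrow> 0"
    using l by (auto simp: h_tendsto_def hdist_def)
qed

lemma Z_0: "Z 0 = triv E 1"
proof -
  interpret M: hilbert_bimodule "fibre E 0" by (rule hilbert) simp
  have "tensor_power E 0 (y 0) (Suc m) = triv E 1" for m
  proof -
    have "tensor_power E 0 (y 0) (Suc m) = tens E (replicate (Suc m) (0, y 0))"
      using tangent triv_closed by (intro tensor_power_eq_tens) (auto simp: tangent_def)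
    \<comment> \<open>At time 0 the family agrees with \<open>\<omega>\<close>, so the power is read
      off from the unit property of \<open>\<omega>\<close>.\<close>
    also have "\<dots> = tens E (map (\<lambda>r. (r, \<omega> r)) (replicate (Suc m) 0))"
      using tangent unit_0[OF omega_unit] by (simp add: tangent_def del: replicate_Suc)
    also have "\<dots> = \<omega> (sum_list (replicate (Suc m) 0))" by (rule tens_unit[OF omega_unit]) auto
    finally show ?thesis using unit_0[OF omega_unit] by (simp add: sum_list_replicate del: replicate_Suc)
  qed
  then have "Z 0 = h_lim (fibre E 0) (\<lambda>m. triv E 1)" by (simp add: Z_def power_limit_def del: tensor_power.simps)
  also have "\<dots> = triv E 1"
    using triv_closed by (intro M.h_lim_eqI) (auto simp: h_tendsto_def a_minus_def M.r_neg)
  finally show ?thesis .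
qed

text \<open>Equal parts of \<open>t\<close> and of \<open>s\<close> do not join to equal parts of
  \<open>t + s\<close>; multiplicativity of \<open>Z\<close> therefore needs arbitrary fine
  partitions.\<close>

lemma Z_partitions:
  assumes t: "0 < t" and \<epsilon>: "0 < \<epsilon>"
  obtains \<delta> where "0 < \<delta>" "\<And>ps. pos ps \<Longrightarrow> \<forall>r\<in>set ps. r < \<delta> \<Longrightarrow> sum_list ps = t \<Longrightarrow> hdist E t (Y ps) (Z t) \<le> \<epsilon>"
proof -
  have e2: "0 < \<epsilon> / 2" using \<epsilon> by simp
  then obtain \<delta> where \<delta>: "0 < \<delta>" "\<And>ps qs. pos ps \<Longrightarrow> pos qs \<Longrightarrow> \<forall>r\<in>set ps. r < \<delta> \<Longrightarrow> \<forall>r\<in>set qs. r < \<delta> \<Longrightarrow>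
      sum_list ps = t \<Longrightarrow> sum_list qs = t \<Longrightarrow> hdist E t (Y ps) (Y qs) \<le> \<epsilon> / 2"
    using partitions_close[OF t] by metis
  show ?thesis
  proof (rule that[OF \<delta>(1)])
    fix ps assume ps: "pos ps" "\<forall>r\<in>set ps. r < \<delta>" "sum_list ps = t"
    obtain M where M: "\<forall>m\<ge>M. \<forall>r\<in>set (part t m). r < \<delta>" using part_mesh[OF \<delta>(1)] by blast
    have "eventually (\<lambda>m. hdist E t (Y (part t m)) (Z t) < \<epsilon> / 2) sequentially"
      using Z_limit(2)[OF t] e2 by (rule order_tendstoD)
    then obtain M' where M': "\<forall>m\<ge>M'. hdist E t (Y (part t m)) (Z t) < \<epsilon> / 2" by (auto simp: eventually_sequentially)
    let ?m = "max M M'"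
    have "\<forall>r\<in>set (part t ?m). r < \<delta>" using M max.cobounded1 by blast
    then have "hdist E t (Y ps) (Y (part t ?m)) \<le> \<epsilon> / 2" using ps t by (intro \<delta>(2) part)
    moreover have "hdist E t (Y (part t ?m)) (Z t) < \<epsilon> / 2" using M' by auto
    moreover have "hdist E t (Y ps) (Z t) \<le> hdist E t (Y ps) (Y (part t ?m)) + hdist E t (Y (part t ?m)) (Z t)"
      using t Y_closed[OF ps(1)] Y_closed[OF part(1)[OF t]] part(2) ps(3) Z_limit(1)[OF t]
      by (intro hdist_triangle) (auto simp: less_imp_le)
    ultimately show "hdist E t (Y ps) (Z t) \<le> \<epsilon>" by linarith
  qed
qed

lemma Z_closed: "0 \<le> t \<Longrightarrow> Z t \<in> carrier (fibre E t)"
  using Z_limit(1) Z_0 triv_closed by (cases "t = 0") auto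

lemma Z_unit: "Z \<in> units E"
proof (rule unitI)
  show "Z \<in> extensional {0..}" by (simp add: Z_def power_limit_def)
  show "Z 0 = triv E 1" by (rule Z_0)
  show "Z t \<in> carrier (fibre E t)" if "0 \<le> t" for t using that by (rule Z_closed)
  fix t s :: real assume ts: "0 \<le> t" "0 \<le> s"
  show "prd E t s (Z t) (Z s) = Z (t + s)"
  proof (cases "t = 0 \<or> s = 0")
    case True
    then show ?thesis
      using ts Z_0 triv_prd_left[of s "Z s" 1] triv_prd_right[of t "Z t" 1] Z_closed
        bimodule.lact_one[OF bim] right_module.ract_one[OF rmod] by auto
  next
    case False
    then have t: "0 < t" and s: "0 < s" using ts by auto
    have ts0: "0 < t + s" using t s by simp
    have c: "Z t \<in> carrier (fibre E t)" "Z s \<in> carrier (fibre E s)" "Z (t + s) \<in> carrier (fibre E (t + s))"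
      "prd E t s (Z t) (Z s) \<in> carrier (fibre E (t + s))"
      using Z_closed prd_closed ts by auto
    \<comment> \<open>Covers the coefficients that \<open>hdist_prd\<close> gives to the two errors,
      and is at least 1, so that \<open>\<epsilon> * C \<le> e / 2\<close> also yields
      \<open>\<epsilon> \<le> e / 2\<close>.\<close>
    define C where "C = 2 + hnorm (fibre E t) (Z t) + hnorm (fibre E s) (Z s)"
    have hn: "0 \<le> hnorm (fibre E t) (Z t)" "0 \<le> hnorm (fibre E s) (Z s)"
      using hnorm_nonneg ts by auto
    have "hdist E (t + s) (prd E t s (Z t) (Z s)) (Z (t + s)) \<le> 0"
    proof (rule field_le_epsilon)
      fix e :: real assume e: "0 < e"
      define \<epsilon> where "\<epsilon> = min 1 (e / (2 * C))"
      have C: "C > 0" using hn unfolding C_def by linarith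
      have \<epsilon>: "0 < \<epsilon>" "\<epsilon> \<le> 1" "\<epsilon> * C \<le> e / 2" "\<epsilon> \<le> e / 2"
      proof -
        show "0 < \<epsilon>" "\<epsilon> \<le> 1" using e C by (auto simp: \<epsilon>_def)
        have "\<epsilon> * C \<le> e / (2 * C) * C" using C by (intro mult_right_mono) (auto simp: \<epsilon>_def)
        then show *: "\<epsilon> * C \<le> e / 2" using C by simp
        have "\<epsilon> * 1 \<le> \<epsilon> * C" using \<open>0 < \<epsilon>\<close> hn by (intro mult_left_mono) (auto simp: C_def)
        then show "\<epsilon> \<le> e / 2" using * by simp
      qed
      obtain d1 where d1: "0 < d1" "\<And>ps. pos ps \<Longrightarrow> \<forall>r\<in>set ps. r < d1 \<Longrightarrow> sum_list ps = t \<Longrightarrow> hdist E t (Y ps) (Z t) \<le> \<epsilon>"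
        using Z_partitions[OF t \<epsilon>(1)] by metis
      obtain d2 where d2: "0 < d2" "\<And>ps. pos ps \<Longrightarrow> \<forall>r\<in>set ps. r < d2 \<Longrightarrow> sum_list ps = s \<Longrightarrow> hdist E s (Y ps) (Z s) \<le> \<epsilon>"
        using Z_partitions[OF s \<epsilon>(1)] by metis
      obtain d3 where d3: "0 < d3" "\<And>ps. pos ps \<Longrightarrow> \<forall>r\<in>set ps. r < d3 \<Longrightarrow> sum_list ps = t + s \<Longrightarrow> hdist E (t + s) (Y ps) (Z (t + s)) \<le> \<epsilon>"
        using Z_partitions[OF ts0 \<epsilon>(1)] by metis
      have dd: "0 < min d1 d3" "0 < min d2 d3" using d1 d2 d3 by auto
      obtain ps where ps: "sum_list ps = t" "\<And>r. r \<in> set ps \<Longrightarrow> 0 < r \<and> r < min d1 d3" using partition_exists[OF t dd(1)] by metis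
      obtain qs where qs: "sum_list qs = s" "\<And>r. r \<in> set qs \<Longrightarrow> 0 < r \<and> r < min d2 d3" using partition_exists[OF s dd(2)] by metis
      have pp: "pos ps" "pos qs" "pos (ps @ qs)" using ps qs by (auto simp: pos_def)
      have Yc: "Y ps \<in> carrier (fibre E t)" "Y qs \<in> carrier (fibre E s)" "Y (ps @ qs) \<in> carrier (fibre E (t + s))"
        using Y_closed[OF pp(1)] Y_closed[OF pp(2)] Y_closed[OF pp(3)] ps qs by auto
      have split: "Y (ps @ qs) = prd E t s (Y ps) (Y qs)"
      proof -
        have "timed E (map (\<lambda>r. (r, y r)) ps)" "timed E (map (\<lambda>r. (r, y r)) qs)"
          using pp by (auto simp: timed_def pos_def y_closed less_imp_le)
        from tens_append[OF this] show ?thesis using ps qs by (simp add: Y_def comp_def)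
      qed
      have a: "hdist E t (Y ps) (Z t) \<le> \<epsilon>" using ps pp by (intro d1(2)) auto
      have b: "hdist E s (Y qs) (Z s) \<le> \<epsilon>" using qs pp by (intro d2(2)) auto
      have d: "hdist E (t + s) (Y (ps @ qs)) (Z (t + s)) \<le> \<epsilon>" using ps qs pp by (intro d3(2)) auto
      have "hdist E (t + s) (Y (ps @ qs)) (prd E t s (Z t) (Z s))
          \<le> hdist E t (Y ps) (Z t) * hnorm (fibre E s) (Y qs) + hnorm (fibre E t) (Z t) * hdist E s (Y qs) (Z s)"
        unfolding split using ts Yc c by (intro hdist_prd) auto
      also have "\<dots> \<le> \<epsilon> * (1 + hnorm (fibre E s) (Z s)) + hnorm (fibre E t) (Z t) * \<epsilon>"
      proof (intro add_mono mult_mono a b)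
        show "hnorm (fibre E s) (Y qs) \<le> 1 + hnorm (fibre E s) (Z s)"
          using hnorm_le_hdist[of s "Y qs" "Z s"] ts Yc c b \<epsilon>(2) by simp
      qed (use hn \<epsilon> ts hnorm_nonneg in \<open>auto simp: hdist_nonneg\<close>)
      also have "\<dots> \<le> \<epsilon> * C" using \<epsilon>(1) by (simp add: C_def algebra_simps)
      finally have "hdist E (t + s) (prd E t s (Z t) (Z s)) (Y (ps @ qs)) \<le> e / 2"
        using \<epsilon>(3) hdist_commute[of "t + s"] ts Yc c by simp
      moreover have "hdist E (t + s) (prd E t s (Z t) (Z s)) (Z (t + s))
          \<le> hdist E (t + s) (prd E t s (Z t) (Z s)) (Y (ps @ qs)) + hdist E (t + s) (Y (ps @ qs)) (Z (t + s))"
        using ts Yc c by (intro hdist_triangle) auto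
      ultimately show "hdist E (t + s) (prd E t s (Z t) (Z s)) (Z (t + s)) \<le> 0 + e" using d \<epsilon>(4) by simp
    qed
    then show ?thesis using c ts by (intro hdist_eq_0[of "t + s"]) (auto intro: antisym simp: hdist_nonneg)
  qed
qed

text \<open>The bound of \<open>first_order_fold\<close> is the same for all partitions of
  \<open>s\<close>, so it survives the limit along \<open>part s\<close> with the same linear
  term.\<close>

lemma first_order_limit:
  assumes fo: "first_order E u (\<lambda>s. {v s}) (\<lambda>b. b) L" and L: "bounded_linear L"
    and fold: "\<And>s m b. 0 < s \<Longrightarrow> mel E s (u' s m) (v' s m) b = fold (\<lambda>r. mel E r (u r) (v r)) (part s m) b"
    and lim: "\<And>s b. 0 < s \<Longrightarrow> (\<lambda>m. mel E s (u' s m) (v' s m) b) \<longlonglongrightarrow> mel E s (z s) (w s) b"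
  shows "first_order E z (\<lambda>s. {w s}) (\<lambda>b. b) L"
proof (rule first_orderI)
  fix \<epsilon> :: real assume \<epsilon>: "0 < \<epsilon>"
  obtain \<delta> where \<delta>: "0 < \<delta>" "\<And>rs b. (\<forall>r\<in>set rs. 0 < r) \<Longrightarrow> sum_list rs < \<delta> \<Longrightarrow>
      norm (fold (\<lambda>r. mel E r (u r) (v r)) rs b - b - sum_list rs *\<^sub>R L b) \<le> \<epsilon> * sum_list rs * norm b"
    using first_order_fold[OF fo L \<epsilon>] by metis
  have "norm (mel E s (z s) (w s) b - b - s *\<^sub>R L b) \<le> \<epsilon> * s * norm b" if s: "0 < s" "s < \<delta>" for s b
  proof (rule LIMSEQ_le_const2)
    show "(\<lambda>m. norm (mel E s (u' s m) (v' s m) b - b - s *\<^sub>R L b)) \<longlonglongrightarrow> norm (mel E s (z s) (w s) b - b - s *\<^sub>R L b)"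
      by (intro tendsto_intros lim s)
    show "\<exists>N. \<forall>m\<ge>N. norm (mel E s (u' s m) (v' s m) b - b - s *\<^sub>R L b) \<le> \<epsilon> * s * norm b"
      using \<delta>(2)[of "part s _" b] part(1)[OF s(1)] part(2) s by (simp add: fold pos_def)
  qed
  then show "\<exists>\<delta>>0. \<forall>s v b. 0 < s \<longrightarrow> s < \<delta> \<longrightarrow> v \<in> {w s} \<longrightarrow> norm (mel E s (z s) v b - b - s *\<^sub>R L b) \<le> \<epsilon> * s * norm b"
    using \<delta>(1) by (intro exI[of _ \<delta>]) auto
qed

lemma Y_part_closed: "0 < s \<Longrightarrow> Y (part s m) \<in> carrier (fibre E s)"
  using Y_closed[OF part(1)] part(2) by simp

lemma first_order_Z_unit:
  assumes \<xi>: "\<xi> \<in> U"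
  shows "first_order E Z (\<lambda>s. {\<xi> s}) (\<lambda>b. b) (B \<xi>)"
proof (rule first_order_limit[OF B_expansion(2,1)[OF \<xi>], where u'="\<lambda>s m. Y (part s m)" and v'="\<lambda>s m. \<xi> s"])
  show "mel E s (Y (part s m)) (\<xi> s) b = fold (\<lambda>r. mel E r (y r) (\<xi> r)) (part s m) b" if "0 < s" for s m b
    using mel_Y_unit[OF part(1)[OF that] U_unit[OF \<xi>], of m b] part(2) by simp
  show "(\<lambda>m. mel E s (Y (part s m)) (\<xi> s) b) \<longlonglongrightarrow> mel E s (Z s) (\<xi> s) b" if "0 < s" for s b
    using that \<xi> Z_limit[OF that] by (intro mel_tendsto) (auto simp: U_closed Y_part_closed)
qed

lemma first_order_Z_Z: "first_order E Z (\<lambda>s. {Z s}) (\<lambda>b. b) A"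
proof (rule first_order_limit[OF A_self A_expansion(1), where u'="\<lambda>s m. Y (part s m)" and v'="\<lambda>s m. Y (part s m)"])
  show "mel E s (Y (part s m)) (Y (part s m)) b = fold (\<lambda>r. mel E r (y r) (y r)) (part s m) b" if "0 < s" for s m b
    using mel_Y_Y[OF part(1)[OF that], of m b] part(2) by simp
  show "(\<lambda>m. mel E s (Y (part s m)) (Y (part s m)) b) \<longlonglongrightarrow> mel E s (Z s) (Z s) b" if "0 < s" for s b
    using that Z_limit[OF that] by (intro mel_tendsto) (auto simp: Y_part_closed)
qed

lemma Z_U: "Z \<in> U"
  unfolding max_units_iff
proof (intro conjI Z_unit)
  have fo: "first_order E \<omega> (\<lambda>s. {Z s}) (\<lambda>b. b) (\<lambda>b. adj (B \<omega> (adj b)))"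
    by (rule first_order_adj[OF first_order_Z_unit[OF omega_U]]) (auto simp: Z_closed U_closed[OF omega_U])
  have "((\<lambda>t. sqrt (norm ((mel E t (Z t) (Z t) 1 - mel E t (Z t) (\<omega> t) 1) - (mel E t (\<omega> t) (Z t) 1 - mel E t (\<omega> t) (\<omega> t) 1))))
      \<longlongrightarrow> sqrt (norm ((1 - 1) - (1 - (1::'a))))) (at_right 0)"
    by (intro tendsto_intros first_order_tendsto[OF first_order_Z_Z] first_order_tendsto[OF fo]
        first_order_tendsto[OF first_order_Z_unit[OF omega_U]] first_order_tendsto[OF gen_first_order[OF omega_U omega_U]])
  then have "((\<lambda>t. sqrt (norm ((mel E t (Z t) (Z t) 1 - mel E t (Z t) (\<omega> t) 1) - (mel E t (\<omega> t) (Z t) 1 - mel E t (\<omega> t) (\<omega> t) 1))))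
      \<longlongrightarrow> 0) (at_right 0)" by simp
  then show "((\<lambda>t. hdist E t (Z t) (\<omega> t)) \<longlongrightarrow> 0) (at_right 0)"
    by (rule Lim_transform_eventually)
      (auto simp: eventually_at_right_field Z_closed U_closed[OF omega_U] simp flip: hdist_square intro!: exI[of _ 1])
qed

end

context product_system_unit
begin

text \<open>Existence and generators of power limits in one place; with \<open>unit_eqI\<close>
  every module identity below becomes an identity between functionals of generators.\<close>

lemma power_limit_tangent:
  assumes "tangent y \<Phi>"
  shows "power_limit E y \<in> U"
    and "\<xi> \<in> U \<Longrightarrow> blinfun_apply (gen E (power_limit E y) \<xi>) b = \<Phi> (\<lambda>x. blinfun_apply (gen E x \<xi>)) b"
proof -
  interpret tangent_family E \<omega> y \<Phi> by unfold_locales (rule assms)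
  show "power_limit E y \<in> U" using Z_U by (simp add: Z_def)
  show "blinfun_apply (gen E (power_limit E y) \<xi>) b = \<Phi> (\<lambda>x. blinfun_apply (gen E x \<xi>)) b" if "\<xi> \<in> U"
    using gen_eqI[OF Z_U that first_order_Z_unit[OF that]] by (simp add: Z_def B_def)
qed

end

section \<open>The bimodule of units\<close>

text \<open>The witness \<open>b'\<close> covers both actions: the left one moves the argument to
  \<open>adj a * b\<close>, the right one keeps it and multiplies the value.\<close>

lemma first_order_scaled_bound:
  assumes "first_order E x T A0 A1" "0 \<le> K"
    and bd: "\<And>s v b. 0 < s \<Longrightarrow> v \<in> T s \<Longrightarrow> \<exists>b'. norm (mel E s (x' s) v b - B0 b - s *\<^sub>R B1 b)
        \<le> C * norm (mel E s (x s) v b' - A0 b' - s *\<^sub>R A1 b') \<and> C * norm b' \<le> K * norm b"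
    and "0 \<le> C"
  shows "first_order E x' T B0 B1"
proof (rule first_orderI)
  fix \<epsilon> :: real assume \<epsilon>: "0 < \<epsilon>"
  define \<eta> where "\<eta> = \<epsilon> / (K + 1)"
  have \<eta>: "0 < \<eta>" "\<eta> * K \<le> \<epsilon>" using \<epsilon> assms(2) by (auto simp: \<eta>_def field_simps)
  obtain \<delta> where \<delta>: "0 < \<delta>" "\<And>s v b. 0 < s \<Longrightarrow> s < \<delta> \<Longrightarrow> v \<in> T s \<Longrightarrow>
      norm (mel E s (x s) v b - A0 b - s *\<^sub>R A1 b) \<le> \<eta> * s * norm b"
    by (rule first_orderE[OF assms(1) \<eta>(1)]) auto
  have "norm (mel E s (x' s) v b - B0 b - s *\<^sub>R B1 b) \<le> \<epsilon> * s * norm b" if s: "0 < s" "s < \<delta>" "v \<in> T s" for s v b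
  proof -
    obtain b' where b': "norm (mel E s (x' s) v b - B0 b - s *\<^sub>R B1 b)
        \<le> C * norm (mel E s (x s) v b' - A0 b' - s *\<^sub>R A1 b')" "C * norm b' \<le> K * norm b"
      using bd[OF s(1,3)] by blast
    have "norm (mel E s (x' s) v b - B0 b - s *\<^sub>R B1 b) \<le> C * norm (mel E s (x s) v b' - A0 b' - s *\<^sub>R A1 b')"
      by (rule b'(1))
    also have "\<dots> \<le> C * (\<eta> * s * norm b')" by (rule mult_left_mono[OF \<delta>(2)[OF s] assms(4)])
    also have "\<dots> = \<eta> * s * (C * norm b')" by simp
    also have "\<dots> \<le> \<eta> * s * (K * norm b)" using \<eta> s b'(2) by (intro mult_left_mono) auto
    also have "\<dots> = (\<eta> * K) * (s * norm b)" by simp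
    also have "\<dots> \<le> \<epsilon> * (s * norm b)" using \<eta> s by (intro mult_right_mono) auto
    finally show ?thesis by simp
  qed
  then show "\<exists>\<delta>>0. \<forall>s v b. 0 < s \<longrightarrow> s < \<delta> \<longrightarrow> v \<in> T s \<longrightarrow> norm (mel E s (x' s) v b - B0 b - s *\<^sub>R B1 b) \<le> \<epsilon> * s * norm b"
    using \<delta>(1) by (intro exI[of _ \<delta>]) auto
qed

context product_system
begin

lemma first_order_lact:
  assumes "first_order E x T P Q" and x: "\<And>s. 0 < s \<Longrightarrow> x s \<in> carrier (fibre E s)"
    and T: "\<And>s. 0 < s \<Longrightarrow> T s \<subseteq> carrier (fibre E s)"
  shows "first_order E (\<lambda>s. lact (fibre E s) a (x s)) T (\<lambda>b. P (adj a * b)) (\<lambda>b. Q (adj a * b))"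
proof (rule first_order_scaled_bound[OF assms(1), where K="norm a" and C=1])
  fix s :: real and v b assume s: "0 < s" "v \<in> T s"
  then have "v \<in> carrier (fibre E s)" using T by blast
  then show "\<exists>b'. norm (mel E s (lact (fibre E s) a (x s)) v b - P (adj a * b) - s *\<^sub>R Q (adj a * b))
      \<le> 1 * norm (mel E s (x s) v b' - P b' - s *\<^sub>R Q b') \<and> 1 * norm b' \<le> norm a * norm b"
    using s x norm_mult_ineq[of "adj a" b] by (intro exI[of _ "adj a * b"]) (simp add: mel_lact_left)
qed auto

lemma first_order_ract:
  assumes "first_order E x T P Q" and x: "\<And>s. 0 < s \<Longrightarrow> x s \<in> carrier (fibre E s)"
    and T: "\<And>s. 0 < s \<Longrightarrow> T s \<subseteq> carrier (fibre E s)"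
  shows "first_order E (\<lambda>s. ract (fibre E s) (x s) a) T (\<lambda>b. adj a * P b) (\<lambda>b. adj a * Q b)"
proof (rule first_order_scaled_bound[OF assms(1), where K="norm a" and C="norm a"])
  fix s :: real and v b assume s: "0 < s" "v \<in> T s"
  then have v: "v \<in> carrier (fibre E s)" using T by blast
  have "mel E s (ract (fibre E s) (x s) a) v b - adj a * P b - s *\<^sub>R (adj a * Q b)
      = adj a * (mel E s (x s) v b - P b - s *\<^sub>R Q b)"
    using s x v by (simp add: mel_ract_left algebra_simps)
  then have "norm (mel E s (ract (fibre E s) (x s) a) v b - adj a * P b - s *\<^sub>R (adj a * Q b))
      \<le> norm a * norm (mel E s (x s) v b - P b - s *\<^sub>R Q b)"
    using norm_mult_ineq[of "adj a"] by (metis norm_adj)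
  then show "\<exists>b'. norm (mel E s (ract (fibre E s) (x s) a) v b - adj a * P b - s *\<^sub>R (adj a * Q b))
      \<le> norm a * norm (mel E s (x s) v b' - P b' - s *\<^sub>R Q b') \<and> norm a * norm b' \<le> norm a * norm b"
    by blast
qed auto

lemma first_order_add:
  assumes x: "first_order E x T A0 A1" "\<And>s. 0 < s \<Longrightarrow> x s \<in> carrier (fibre E s)"
    and y: "first_order E y T B0 B1" "\<And>s. 0 < s \<Longrightarrow> y s \<in> carrier (fibre E s)"
    and T: "\<And>s. 0 < s \<Longrightarrow> T s \<subseteq> carrier (fibre E s)"
  shows "first_order E (\<lambda>s. x s \<oplus>\<^bsub>fibre E s\<^esub> y s) T (\<lambda>b. A0 b + B0 b) (\<lambda>b. A1 b + B1 b)"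
proof (rule first_orderI)
  fix \<epsilon> :: real assume "0 < \<epsilon>"
  then have \<epsilon>: "0 < \<epsilon> / 2" by simp
  obtain d1 where d1: "0 < d1" "\<And>s v b. 0 < s \<Longrightarrow> s < d1 \<Longrightarrow> v \<in> T s \<Longrightarrow>
      norm (mel E s (x s) v b - A0 b - s *\<^sub>R A1 b) \<le> (\<epsilon> / 2) * s * norm b"
    by (rule first_orderE[OF x(1) \<epsilon>]) auto
  obtain d2 where d2: "0 < d2" "\<And>s v b. 0 < s \<Longrightarrow> s < d2 \<Longrightarrow> v \<in> T s \<Longrightarrow>
      norm (mel E s (y s) v b - B0 b - s *\<^sub>R B1 b) \<le> (\<epsilon> / 2) * s * norm b"
    by (rule first_orderE[OF y(1) \<epsilon>]) auto
  have "norm (mel E s (x s \<oplus>\<^bsub>fibre E s\<^esub> y s) v b - (A0 b + B0 b) - s *\<^sub>R (A1 b + B1 b)) \<le> \<epsilon> * s * norm b"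
    if s: "0 < s" "s < min d1 d2" "v \<in> T s" for s v b
  proof -
    have "v \<in> carrier (fibre E s)" using T s by blast
    then have "mel E s (x s \<oplus>\<^bsub>fibre E s\<^esub> y s) v b - (A0 b + B0 b) - s *\<^sub>R (A1 b + B1 b)
        = (mel E s (x s) v b - A0 b - s *\<^sub>R A1 b) + (mel E s (y s) v b - B0 b - s *\<^sub>R B1 b)"
      using s x y by (simp add: mel_add_left algebra_simps)
    also have "norm \<dots> \<le> (\<epsilon> / 2) * s * norm b + (\<epsilon> / 2) * s * norm b"
      using s by (intro order_trans[OF norm_triangle_ineq] add_mono d1 d2) auto
    finally show ?thesis by simp
  qed
  then show "\<exists>\<delta>>0. \<forall>s v b. 0 < s \<longrightarrow> s < \<delta> \<longrightarrow> v \<in> T s \<longrightarrow>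
      norm (mel E s (x s \<oplus>\<^bsub>fibre E s\<^esub> y s) v b - (A0 b + B0 b) - s *\<^sub>R (A1 b + B1 b)) \<le> \<epsilon> * s * norm b"
    using d1(1) d2(1) by (intro exI[of _ "min d1 d2"]) auto
qed

lemma first_order_zero:
  assumes T: "\<And>s. 0 < s \<Longrightarrow> T s \<subseteq> carrier (fibre E s)"
  shows "first_order E (\<lambda>s. \<zero>\<^bsub>fibre E s\<^esub>) T (\<lambda>b. 0) (\<lambda>b. 0)"
proof (rule first_orderI)
  fix \<epsilon> :: real assume \<epsilon>: "0 < \<epsilon>"
  have "mel E s \<zero>\<^bsub>fibre E s\<^esub> v b = 0" if s: "0 < s" "v \<in> T s" for s v b
  proof -
    interpret M: pre_hilbert_bimodule "fibre E s" by (rule pre) (use s in simp)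
    show ?thesis using T[OF s(1)] s(2) by (auto simp: mel_def M.lact_closed)
  qed
  then show "\<exists>\<delta>>0. \<forall>s v b. 0 < s \<longrightarrow> s < \<delta> \<longrightarrow> v \<in> T s \<longrightarrow> norm (mel E s \<zero>\<^bsub>fibre E s\<^esub> v b - 0 - s *\<^sub>R 0) \<le> \<epsilon> * s * norm b"
    using \<epsilon> by (intro exI[of _ 1]) auto
qed

text \<open>The scalar \<open>s\<close> turns the constant term \<open>adj \<beta> * b\<close> into
  the linear one and pushes the former linear term to second order.\<close>

lemma first_order_small_ract:
  assumes fo: "first_order E x T (\<lambda>b. b) A" and x: "\<And>s. 0 < s \<Longrightarrow> x s \<in> carrier (fibre E s)"
    and T: "\<And>s. 0 < s \<Longrightarrow> T s \<subseteq> carrier (fibre E s)" and A: "bounded_linear A"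
  shows "first_order E (\<lambda>s. ract (fibre E s) (x s) (s *\<^sub>R \<beta>)) T (\<lambda>b. 0) (\<lambda>b. adj \<beta> * b)"
proof (rule first_orderI)
  fix \<epsilon> :: real assume \<epsilon>: "0 < \<epsilon>"
  obtain \<alpha> where \<alpha>: "0 \<le> \<alpha>" "\<And>b. norm (A b) \<le> \<alpha> * norm b"
    using bounded_linear.nonneg_bounded[OF A] by (auto simp: mult.commute)
  obtain d where d: "0 < d" "\<And>s v b. 0 < s \<Longrightarrow> s < d \<Longrightarrow> v \<in> T s \<Longrightarrow>
      norm (mel E s (x s) v b - b - s *\<^sub>R A b) \<le> 1 * s * norm b"
    by (rule first_orderE[OF fo zero_less_one]) auto
  define C where "C = norm \<beta> * (1 + \<alpha>) + 1"
  have C: "C > 0" using \<alpha> by (simp add: C_def add_nonneg_pos)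
  have "norm (mel E s (ract (fibre E s) (x s) (s *\<^sub>R \<beta>)) v b - 0 - s *\<^sub>R (adj \<beta> * b)) \<le> \<epsilon> * s * norm b"
    if s: "0 < s" "s < min d (\<epsilon> / C)" "v \<in> T s" for s v b
  proof -
    have v: "v \<in> carrier (fibre E s)" using T s by blast
    have "norm (s *\<^sub>R A b) \<le> s * (\<alpha> * norm b)" using \<alpha>(2) s by (simp add: mult_left_mono)
    with d(2)[of s v b] s have "norm ((mel E s (x s) v b - b - s *\<^sub>R A b) + s *\<^sub>R A b) \<le> 1 * s * norm b + s * (\<alpha> * norm b)"
      by (intro order_trans[OF norm_triangle_ineq] add_mono) auto
    then have n: "norm (mel E s (x s) v b - b) \<le> (1 + \<alpha>) * s * norm b" by (simp add: algebra_simps)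
    have "mel E s (ract (fibre E s) (x s) (s *\<^sub>R \<beta>)) v b - 0 - s *\<^sub>R (adj \<beta> * b) = s *\<^sub>R (adj \<beta> * (mel E s (x s) v b - b))"
      using s x v by (simp add: mel_ract_left adj_scaleR algebra_simps)
    then have "norm (mel E s (ract (fibre E s) (x s) (s *\<^sub>R \<beta>)) v b - 0 - s *\<^sub>R (adj \<beta> * b))
        = s * norm (adj \<beta> * (mel E s (x s) v b - b))" using s by simp
    also have "\<dots> \<le> s * (norm (adj \<beta>) * norm (mel E s (x s) v b - b))"
      using s by (intro mult_left_mono norm_mult_ineq) auto
    also have "\<dots> \<le> s * (norm \<beta> * ((1 + \<alpha>) * s * norm b))"
      unfolding norm_adj using s by (intro mult_left_mono n) auto
    also have "\<dots> = (norm \<beta> * (1 + \<alpha>) * s) * (s * norm b)" by simp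
    also have "\<dots> \<le> (C * s) * (s * norm b)" using s by (intro mult_right_mono) (auto simp: C_def)
    also have "\<dots> \<le> \<epsilon> * (s * norm b)" using s C by (intro mult_right_mono) (auto simp: field_simps)
    finally show ?thesis by simp
  qed
  then show "\<exists>\<delta>>0. \<forall>s v b. 0 < s \<longrightarrow> s < \<delta> \<longrightarrow> v \<in> T s \<longrightarrow>
      norm (mel E s (ract (fibre E s) (x s) (s *\<^sub>R \<beta>)) v b - 0 - s *\<^sub>R (adj \<beta> * b)) \<le> \<epsilon> * s * norm b"
    using d(1) \<epsilon> C by (intro exI[of _ "min d (\<epsilon> / C)"]) auto
qed

lemma triv_zero: "triv E 0 = \<zero>\<^bsub>fibre E 0\<^esub>"
proof -
  interpret M: pre_hilbert_bimodule "fibre E 0" by (rule pre) simp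
  have "ip (fibre E 0) (triv E 0) (triv E 0) = 0" by (simp add: triv_ip)
  then show ?thesis using triv_closed by (intro M.ip_definite)
qed

end

section \<open>Combinations of units and the module operations\<close>

context product_system_unit
begin

lemma lact_closed_U: "x \<in> U \<Longrightarrow> 0 \<le> s \<Longrightarrow> lact (fibre E s) a (x s) \<in> carrier (fibre E s)"
  by (rule bimodule.lact_closed[OF bim U_closed])

lemma ract_closed_U: "x \<in> U \<Longrightarrow> 0 \<le> s \<Longrightarrow> ract (fibre E s) (x s) a \<in> carrier (fibre E s)"
  by (rule right_module.ract_closed[OF rmod U_closed])

lemma zero_closed_fibre: "0 \<le> s \<Longrightarrow> \<zero>\<^bsub>fibre E s\<^esub> \<in> carrier (fibre E s)"
  by (rule abelian_monoid.zero_closed[OF abelian_group.axioms(1)[OF abg]])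

lemma add_closed_fibre:
  "0 \<le> s \<Longrightarrow> u \<in> carrier (fibre E s) \<Longrightarrow> v \<in> carrier (fibre E s) \<Longrightarrow> u \<oplus>\<^bsub>fibre E s\<^esub> v \<in> carrier (fibre E s)"
  by (rule abelian_monoid.a_closed[OF abelian_group.axioms(1)[OF abg]])

lemma bounded_linear_comp_mult: "bounded_linear A \<Longrightarrow> bounded_linear (\<lambda>b. A (a * b))" for A :: "'b \<Rightarrow> 'b"
  by (rule bounded_linear_compose[OF _ bounded_linear_mult_right])

lemma bounded_linear_mult_comp: "bounded_linear A \<Longrightarrow> bounded_linear (\<lambda>b. a * A b)" for A :: "'b \<Rightarrow> 'b"
  by (rule bounded_linear_compose[OF bounded_linear_mult_right])

lemmas fibre_closed = U_closed lact_closed_U ract_closed_U zero_closed_fibre add_closed_fibre omega_U less_imp_le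

lemma expands_lact:
  assumes "x \<in> U"
  shows "expands (\<lambda>s. lact (fibre E s) a (x s)) (\<lambda>b. adj a * b) (\<lambda>A b. A x (adj a * b))"
  using assms
  by (intro expandsI bounded_linear_comp_mult first_order_lact[where P="\<lambda>b. b"]) (auto simp: fibre_closed)

lemma expands_ract:
  assumes "x \<in> U"
  shows "expands (\<lambda>s. ract (fibre E s) (x s) a) (\<lambda>b. adj a * b) (\<lambda>A b. adj a * A x b)"
  using assms
  by (intro expandsI bounded_linear_mult_comp first_order_ract[where P="\<lambda>b. b"]) (auto simp: fibre_closed)

lemma expands_zero: "expands (\<lambda>s. \<zero>\<^bsub>fibre E s\<^esub>) (\<lambda>b. 0) (\<lambda>A b. 0)"
  by (intro expandsI bounded_linear_zero first_order_zero) (auto simp: fibre_closed)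

lemma expands_add:
  assumes x: "expands x P \<Phi>" and y: "expands y Q \<Psi>"
  shows "expands (\<lambda>s. x s \<oplus>\<^bsub>fibre E s\<^esub> y s) (\<lambda>b. P b + Q b) (\<lambda>A b. \<Phi> A b + \<Psi> A b)"
proof (rule expandsI)
  show "x s \<oplus>\<^bsub>fibre E s\<^esub> y s \<in> carrier (fibre E s)" if "0 < s" for s
    using that expands_closed[OF x] expands_closed[OF y] by (simp add: fibre_closed)
  show "bounded_linear (\<lambda>b. \<Phi> A b + \<Psi> A b)" if A: "\<And>x. x \<in> U \<Longrightarrow> bounded_linear (A x)" for A
    by (intro bounded_linear_add expands_bounded_linear[OF x A] expands_bounded_linear[OF y A])
  fix T A assume T: "\<And>s. 0 < s \<Longrightarrow> T s \<subseteq> carrier (fibre E s)" and A: "\<And>x. x \<in> U \<Longrightarrow> bounded_linear (A x)"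
    and fo: "\<And>x. x \<in> U \<Longrightarrow> first_order E x T (\<lambda>b. b) (A x)"
  show "first_order E (\<lambda>s. x s \<oplus>\<^bsub>fibre E s\<^esub> y s) T (\<lambda>b. P b + Q b) (\<lambda>b. \<Phi> A b + \<Psi> A b)"
    by (rule first_order_add[OF expandsD(2)[OF x T A fo] expands_closed[OF x] expandsD(2)[OF y T A fo] expands_closed[OF y] T])
qed

text \<open>The \<open>+ 0\<close> comes from the zero vector that ends the \<open>foldr\<close>;
  weights of sum 1 make the constant term the identity and the vector at time 0 the image of
  1.\<close>

lemma tangent_left3:
  assumes "x \<in> U" "y \<in> U" "z \<in> U" "a + b + c = 1"
  shows "tangent (\<lambda>s. foldr (\<lambda>(k, x) y. lact (fibre E s) k (x s) \<oplus>\<^bsub>fibre E s\<^esub> y) [(a, x), (b, y), (c, z)] \<zero>\<^bsub>fibre E s\<^esub>)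
    (\<lambda>A e. A x (adj a * e) + (A y (adj b * e) + (A z (adj c * e) + 0)))"
proof -
  have "(\<lambda>e. adj a * e + (adj b * e + (adj c * e + 0))) = (\<lambda>e::'b. e)"
    using assms(4) by (simp add: fun_eq_iff add.assoc flip: distrib_right adj_add)
  with expands_add[OF expands_lact expands_add[OF expands_lact expands_add[OF expands_lact expands_zero]], OF assms(1-3), of a b c]
  show ?thesis using assms by (simp add: tangent_def unit_0 U_unit add.assoc flip: triv_lact triv_zero triv_add)
qed

lemma tangent_left2:
  assumes "x \<in> U" "y \<in> U" "a + b = 1"
  shows "tangent (\<lambda>s. foldr (\<lambda>(k, x) y. lact (fibre E s) k (x s) \<oplus>\<^bsub>fibre E s\<^esub> y) [(a, x), (b, y)] \<zero>\<^bsub>fibre E s\<^esub>)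
    (\<lambda>A e. A x (adj a * e) + (A y (adj b * e) + 0))"
proof -
  have "(\<lambda>e. adj a * e + (adj b * e + 0)) = (\<lambda>e::'b. e)"
    using assms(3) by (simp add: fun_eq_iff flip: distrib_right adj_add)
  with expands_add[OF expands_lact expands_add[OF expands_lact expands_zero], OF assms(1,2), of a b]
  show ?thesis using assms by (simp add: tangent_def unit_0 U_unit flip: triv_lact triv_zero triv_add)
qed

lemma tangent_right2:
  assumes "x \<in> U" "y \<in> U" "a + b = 1"
  shows "tangent (\<lambda>s. foldr (\<lambda>(x, k) y. ract (fibre E s) (x s) k \<oplus>\<^bsub>fibre E s\<^esub> y) [(x, a), (y, b)] \<zero>\<^bsub>fibre E s\<^esub>)
    (\<lambda>A e. adj a * A x e + (adj b * A y e + 0))"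
proof -
  have "(\<lambda>e. adj a * e + (adj b * e + 0)) = (\<lambda>e::'b. e)"
    using assms(3) by (simp add: fun_eq_iff flip: distrib_right adj_add)
  with expands_add[OF expands_ract expands_add[OF expands_ract expands_zero], OF assms(1,2), of a b]
  show ?thesis using assms by (simp add: tangent_def unit_0 U_unit flip: triv_ract triv_zero triv_add)
qed

text \<open>These units have length zero in the module of units; adding them adjusts the part of a unit that
  is invisible in the index.\<close>

definition pert :: "'b \<Rightarrow> real \<Rightarrow> 'e" where
  "pert \<beta> = power_limit E (\<lambda>s. \<omega> s \<oplus>\<^bsub>fibre E s\<^esub> ract (fibre E s) (\<omega> s) (s *\<^sub>R \<beta>))"

lemma tangent_pert:
  "tangent (\<lambda>s. \<omega> s \<oplus>\<^bsub>fibre E s\<^esub> ract (fibre E s) (\<omega> s) (s *\<^sub>R \<beta>)) (\<lambda>A e. A \<omega> e + adj \<beta> * e)"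
  unfolding tangent_def
proof
  show "\<omega> 0 \<oplus>\<^bsub>fibre E 0\<^esub> ract (fibre E 0) (\<omega> 0) (0 *\<^sub>R \<beta>) = triv E 1"
    using triv_add[of 1 0] by (simp add: unit_0 omega_unit flip: triv_ract)
  have "expands \<omega> (\<lambda>b. b) (\<lambda>A. A \<omega>)" by (rule expandsI) (auto simp: fibre_closed)
  moreover have "expands (\<lambda>s. ract (fibre E s) (\<omega> s) (s *\<^sub>R \<beta>)) (\<lambda>b. 0) (\<lambda>A b. adj \<beta> * b)"
  proof (rule expandsI)
    show "first_order E (\<lambda>s. ract (fibre E s) (\<omega> s) (s *\<^sub>R \<beta>)) T (\<lambda>b. 0) (\<lambda>b. adj \<beta> * b)"
      if "\<And>s. 0 < s \<Longrightarrow> T s \<subseteq> carrier (fibre E s)" "\<And>x. x \<in> U \<Longrightarrow> bounded_linear (A x)"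
        "\<And>x. x \<in> U \<Longrightarrow> first_order E x T (\<lambda>b. b) (A x)" for T A
      using that by (intro first_order_small_ract[where A="A \<omega>"]) (auto simp: fibre_closed)
  qed (auto simp: fibre_closed bounded_linear_mult_right)
  ultimately show "expands (\<lambda>s. \<omega> s \<oplus>\<^bsub>fibre E s\<^esub> ract (fibre E s) (\<omega> s) (s *\<^sub>R \<beta>)) (\<lambda>b. b) (\<lambda>A e. A \<omega> e + adj \<beta> * e)"
    using expands_add by fastforce
qed

abbreviation G :: "(real \<Rightarrow> 'e) \<Rightarrow> (real \<Rightarrow> 'e) \<Rightarrow> 'b \<Rightarrow> 'b" where
  "G x y \<equiv> blinfun_apply (gen E x y)"

abbreviation M where "M \<equiv> unit_module E \<omega>"

lemma M_simps [simp]: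
  "carrier M = U" "\<zero>\<^bsub>M\<^esub> = \<omega>" "x \<oplus>\<^bsub>M\<^esub> y = boxplus_left E [(1, x), (1, y), (- 1, \<omega>)]"
  "lact M b x = boxplus_left E [(b, x), (1 - b, \<omega>)]" "ract M x b = boxplus_right E [(x, b), (\<omega>, 1 - b)]"
  "ip M x y = blinfun_apply (gen E x y - gen E x \<omega> - gen E \<omega> y + gen E \<omega> \<omega>) 1"
  by (simp_all add: unit_module_def mk_bimod_def)

lemma add_M: assumes "x \<in> U" "y \<in> U"
  shows add_M_closed: "x \<oplus>\<^bsub>M\<^esub> y \<in> U"
    and gen_add_M: "\<xi> \<in> U \<Longrightarrow> G (x \<oplus>\<^bsub>M\<^esub> y) \<xi> e = G x \<xi> e + G y \<xi> e - G \<omega> \<xi> e"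
proof -
  have t: "tangent (\<lambda>s. foldr (\<lambda>(k, x) y. lact (fibre E s) k (x s) \<oplus>\<^bsub>fibre E s\<^esub> y) [(1, x), (1, y), (- 1, \<omega>)] \<zero>\<^bsub>fibre E s\<^esub>)
    (\<lambda>A e. A x (adj 1 * e) + (A y (adj 1 * e) + (A \<omega> (adj (- 1) * e) + 0)))"
    by (rule tangent_left3) (use assms omega_U in auto)
  show "x \<oplus>\<^bsub>M\<^esub> y \<in> U" using power_limit_tangent(1)[OF t] by (simp add: boxplus_left_def)
  show "G (x \<oplus>\<^bsub>M\<^esub> y) \<xi> e = G x \<xi> e + G y \<xi> e - G \<omega> \<xi> e" if "\<xi> \<in> U"
    using power_limit_tangent(2)[OF t that, of e] by (simp add: boxplus_left_def adj_minus blinfun.minus_right)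
qed

lemma lact_M: assumes "x \<in> U"
  shows lact_M_closed: "lact M b x \<in> U"
    and gen_lact_M: "\<xi> \<in> U \<Longrightarrow> G (lact M b x) \<xi> e = G x \<xi> (adj b * e) + G \<omega> \<xi> (e - adj b * e)"
proof -
  have t: "tangent (\<lambda>s. foldr (\<lambda>(k, x) y. lact (fibre E s) k (x s) \<oplus>\<^bsub>fibre E s\<^esub> y) [(b, x), (1 - b, \<omega>)] \<zero>\<^bsub>fibre E s\<^esub>)
    (\<lambda>A e. A x (adj b * e) + (A \<omega> (adj (1 - b) * e) + 0))"
    by (rule tangent_left2) (use assms omega_U in auto)
  show "lact M b x \<in> U" using power_limit_tangent(1)[OF t] by (simp add: boxplus_left_def)
  show "G (lact M b x) \<xi> e = G x \<xi> (adj b * e) + G \<omega> \<xi> (e - adj b * e)" if "\<xi> \<in> U"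
    using power_limit_tangent(2)[OF t that, of e] by (simp add: boxplus_left_def adj_diff left_diff_distrib)
qed

lemma ract_M: assumes "x \<in> U"
  shows ract_M_closed: "ract M x b \<in> U"
    and gen_ract_M: "\<xi> \<in> U \<Longrightarrow> G (ract M x b) \<xi> e = adj b * G x \<xi> e + (G \<omega> \<xi> e - adj b * G \<omega> \<xi> e)"
proof -
  have t: "tangent (\<lambda>s. foldr (\<lambda>(x, k) y. ract (fibre E s) (x s) k \<oplus>\<^bsub>fibre E s\<^esub> y) [(x, b), (\<omega>, 1 - b)] \<zero>\<^bsub>fibre E s\<^esub>)
    (\<lambda>A e. adj b * A x e + (adj (1 - b) * A \<omega> e + 0))"
    by (rule tangent_right2) (use assms omega_U in auto)
  show "ract M x b \<in> U" using power_limit_tangent(1)[OF t] by (simp add: boxplus_right_def)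
  show "G (ract M x b) \<xi> e = adj b * G x \<xi> e + (G \<omega> \<xi> e - adj b * G \<omega> \<xi> e)" if "\<xi> \<in> U"
    using power_limit_tangent(2)[OF t that, of e] by (simp add: boxplus_right_def adj_diff left_diff_distrib)
qed

lemma pert:
  shows pert_closed: "pert \<beta> \<in> U"
    and gen_pert: "\<xi> \<in> U \<Longrightarrow> G (pert \<beta>) \<xi> e = G \<omega> \<xi> e + adj \<beta> * e"
  using power_limit_tangent[OF tangent_pert] by (simp_all add: pert_def)

declare M_simps(3-5) [simp del]

lemmas M_closed = add_M_closed lact_M_closed ract_M_closed omega_U pert_closed
lemmas gen_M = gen_add_M gen_lact_M gen_ract_M gen_pert blinfun.add_right blinfun.diff_right blinfun.minus_right

section \<open>Module axioms, checked on generators\<close>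

lemma abelian_group_M: "abelian_group M"
proof (rule abelian_groupI)
  show "\<And>x y z. x \<in> carrier M \<Longrightarrow> y \<in> carrier M \<Longrightarrow> z \<in> carrier M \<Longrightarrow> x \<oplus>\<^bsub>M\<^esub> y \<oplus>\<^bsub>M\<^esub> z = x \<oplus>\<^bsub>M\<^esub> (y \<oplus>\<^bsub>M\<^esub> z)"
    by (rule unit_eqI) (simp_all add: M_closed gen_M)
  show "\<And>x y. x \<in> carrier M \<Longrightarrow> y \<in> carrier M \<Longrightarrow> x \<oplus>\<^bsub>M\<^esub> y = y \<oplus>\<^bsub>M\<^esub> x"
    by (rule unit_eqI) (simp_all add: M_closed gen_M)
  show "\<And>x. x \<in> carrier M \<Longrightarrow> \<zero>\<^bsub>M\<^esub> \<oplus>\<^bsub>M\<^esub> x = x"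
    by (rule unit_eqI) (simp_all add: M_closed gen_M)
  fix x assume x: "x \<in> carrier M"
  \<comment> \<open>Acting with -1 puts weight -1 on \<open>x\<close> and 2 on
    \<open>\<omega>\<close>; the generator is the reflection of that of \<open>x\<close> in that of
    \<open>\<omega>\<close>.\<close>
  have "lact M (- 1) x \<oplus>\<^bsub>M\<^esub> x = \<omega>"
    by (rule unit_eqI) (use x in \<open>simp_all add: M_closed gen_M adj_minus\<close>)
  then show "\<exists>y\<in>carrier M. y \<oplus>\<^bsub>M\<^esub> x = \<zero>\<^bsub>M\<^esub>" using x lact_M_closed[of x "- 1"] by auto
qed (simp_all add: M_closed)

lemma bimodule_M: "bimodule M"
proof -
  have "right_module_axioms M"
  proof
    show "\<And>x y b. x \<in> carrier M \<Longrightarrow> y \<in> carrier M \<Longrightarrow> ract M (x \<oplus>\<^bsub>M\<^esub> y) b = ract M x b \<oplus>\<^bsub>M\<^esub> ract M y b"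
      by (rule unit_eqI) (simp_all add: M_closed gen_M algebra_simps)
    show "\<And>x a b. x \<in> carrier M \<Longrightarrow> ract M x (a + b) = ract M x a \<oplus>\<^bsub>M\<^esub> ract M x b"
      by (rule unit_eqI) (simp_all add: M_closed gen_M algebra_simps adj_add)
    show "\<And>x a b. x \<in> carrier M \<Longrightarrow> ract M x (a * b) = ract M (ract M x a) b"
      by (rule unit_eqI) (simp_all add: M_closed gen_M algebra_simps adj_mult)
    show "\<And>x. x \<in> carrier M \<Longrightarrow> ract M x 1 = x"
      by (rule unit_eqI) (simp_all add: M_closed gen_M)
  qed (simp_all add: M_closed)
  moreover have "bimodule_axioms M"
  proof
    show "\<And>x y b. x \<in> carrier M \<Longrightarrow> y \<in> carrier M \<Longrightarrow> lact M b (x \<oplus>\<^bsub>M\<^esub> y) = lact M b x \<oplus>\<^bsub>M\<^esub> lact M b y"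
      by (rule unit_eqI) (simp_all add: M_closed gen_M algebra_simps)
    show "\<And>x a b. x \<in> carrier M \<Longrightarrow> lact M (a + b) x = lact M a x \<oplus>\<^bsub>M\<^esub> lact M b x"
      by (rule unit_eqI) (simp_all add: M_closed gen_M algebra_simps adj_add)
    show "\<And>x a b. x \<in> carrier M \<Longrightarrow> lact M (a * b) x = lact M a (lact M b x)"
      by (rule unit_eqI) (simp_all add: M_closed gen_M algebra_simps adj_mult)
    show "\<And>x. x \<in> carrier M \<Longrightarrow> lact M 1 x = x"
      by (rule unit_eqI) (simp_all add: M_closed gen_M blinfun.zero_right)
    show "\<And>x a b. x \<in> carrier M \<Longrightarrow> lact M a (ract M x b) = ract M (lact M a x) b"
      by (rule unit_eqI) (simp_all add: M_closed gen_M algebra_simps)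
    show "\<And>x c. x \<in> carrier M \<Longrightarrow> lact M (c *\<^sub>C 1) x = ract M x (c *\<^sub>C 1)"
      by (rule unit_eqI) (simp_all add: M_closed gen_M adj_scaleC mult_scaleC_left gen_scaleC)
  qed (simp_all add: M_closed)
  ultimately show ?thesis
    using abelian_group_M by (simp add: bimodule_def right_module_def)
qed

end

section \<open>The semi-inner product on the module of units\<close>

context product_system_unit
begin

lemma adj_G: "x \<in> U \<Longrightarrow> y \<in> U \<Longrightarrow> adj (G x y b) = G y x (adj b)"
  using gen_adj[of x y "adj b"] by (simp add: adj_adj)

lemma gen_add_M_right:
  assumes "x \<in> U" "y \<in> U" "\<xi> \<in> U"
  shows "G \<xi> (x \<oplus>\<^bsub>M\<^esub> y) e = G \<xi> x e + G \<xi> y e - G \<xi> \<omega> e"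
proof -
  have "G \<xi> (x \<oplus>\<^bsub>M\<^esub> y) e = adj (G (x \<oplus>\<^bsub>M\<^esub> y) \<xi> (adj e))" using assms by (intro gen_adj M_closed)
  also have "\<dots> = G \<xi> x e + G \<xi> y e - G \<xi> \<omega> e"
    using assms omega_U by (simp add: gen_add_M adj_add adj_diff adj_G adj_adj)
  finally show ?thesis .
qed

lemma gen_ract_M_right:
  assumes "x \<in> U" "\<xi> \<in> U"
  shows "G \<xi> (ract M x a) e = G \<xi> x e * a + (G \<xi> \<omega> e - G \<xi> \<omega> e * a)"
proof -
  have "G \<xi> (ract M x a) e = adj (G (ract M x a) \<xi> (adj e))" using assms by (intro gen_adj M_closed)
  also have "\<dots> = G \<xi> x e * a + (G \<xi> \<omega> e - G \<xi> \<omega> e * a)"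
    using assms omega_U by (simp add: gen_ract_M adj_add adj_diff adj_mult adj_G adj_adj)
  finally show ?thesis .
qed

lemma gen_lact_M_right:
  assumes "x \<in> U" "\<xi> \<in> U"
  shows "G \<xi> (lact M a x) e = G \<xi> x (e * a) + G \<xi> \<omega> (e - e * a)"
proof -
  have "G \<xi> (lact M a x) e = adj (G (lact M a x) \<xi> (adj e))" using assms by (intro gen_adj M_closed)
  also have "\<dots> = G \<xi> x (e * a) + G \<xi> \<omega> (e - e * a)"
    using assms omega_U by (simp add: gen_lact_M adj_add adj_diff adj_mult adj_G adj_adj)
  finally show ?thesis .
qed

lemma sesquilinear_M: "sesquilinear_bimodule M"
proof -
  have "sesquilinear_bimodule_axioms M"
  proof
    show "\<And>x y z. x \<in> carrier M \<Longrightarrow> y \<in> carrier M \<Longrightarrow> z \<in> carrier M \<Longrightarrow> ip M x (y \<oplus>\<^bsub>M\<^esub> z) = ip M x y + ip M x z"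
      using omega_U by (simp add: gen_add_M_right blinfun.diff_left blinfun.add_left)
    show "\<And>x y b. x \<in> carrier M \<Longrightarrow> y \<in> carrier M \<Longrightarrow> ip M x (ract M y b) = ip M x y * b"
      using omega_U by (simp add: gen_ract_M_right blinfun.diff_left blinfun.add_left algebra_simps)
    show "\<And>x y. x \<in> carrier M \<Longrightarrow> y \<in> carrier M \<Longrightarrow> ip M y x = adj (ip M x y)"
      using omega_U by (simp add: blinfun.diff_left blinfun.add_left adj_diff adj_add adj_G)
  qed
  then show ?thesis using bimodule_M by (simp add: sesquilinear_bimodule_def)
qed

lemma ip_M: "ip M x y = (G x y 1 - G x \<omega> 1) - (G \<omega> y 1 - G \<omega> \<omega> 1)"
  by (simp add: blinfun.diff_left blinfun.add_left)

section \<open>Lengths of units as limits of fibre distances\<close>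

lemma mel_gen_tendsto:
  assumes "x \<in> U" "y \<in> U"
  shows "((\<lambda>s. (1 / s) *\<^sub>R (mel E s (x s) (y s) b - b)) \<longlongrightarrow> G x y b) (at_right 0)"
proof (rule tendstoI)
  fix e :: real assume e: "0 < e"
  define \<epsilon> where "\<epsilon> = e / 2 / (1 + norm b)"
  have p: "0 < 1 + norm b" by (simp add: add_pos_nonneg)
  then have \<epsilon>: "0 < \<epsilon>" using e by (simp add: \<epsilon>_def)
  have "\<epsilon> * norm b < e"
  proof -
    have "\<epsilon> * norm b \<le> \<epsilon> * (1 + norm b)" using \<epsilon> by (intro mult_left_mono) auto
    also have "\<dots> = e / 2" unfolding \<epsilon>_def using p by (intro nonzero_eq_divide_eq[THEN iffD1]) auto
    finally show ?thesis using e by simp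
  qed
  obtain \<delta> where \<delta>: "0 < \<delta>" "\<And>s b. 0 < s \<Longrightarrow> s < \<delta> \<Longrightarrow> norm (mel E s (x s) (y s) b - b - s *\<^sub>R G x y b) \<le> \<epsilon> * s * norm b"
    by (rule first_order_singletonE[OF gen_first_order[OF assms] \<epsilon>]) auto
  show "\<forall>\<^sub>F s in at_right 0. dist ((1 / s) *\<^sub>R (mel E s (x s) (y s) b - b)) (G x y b) < e"
  proof (rule eventually_at_right_0I[OF \<delta>(1)])
    fix s :: real assume s: "0 < s" "s < \<delta>"
    have "(1 / s) *\<^sub>R (mel E s (x s) (y s) b - b) - G x y b = (1 / s) *\<^sub>R (mel E s (x s) (y s) b - b - s *\<^sub>R G x y b)"
      using s by (simp add: scaleR_diff_right)
    then have "dist ((1 / s) *\<^sub>R (mel E s (x s) (y s) b - b)) (G x y b) = (1 / s) * norm (mel E s (x s) (y s) b - b - s *\<^sub>R G x y b)"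
      using s by (simp add: dist_norm)
    also have "\<dots> \<le> (1 / s) * (\<epsilon> * s * norm b)" using s by (intro mult_left_mono \<delta>(2)) auto
    also have "\<dots> = \<epsilon> * norm b" using s by simp
    finally show "dist ((1 / s) *\<^sub>R (mel E s (x s) (y s) b - b)) (G x y b) < e" using \<open>\<epsilon> * norm b < e\<close> by simp
  qed
qed

text \<open>Grouped as in \<open>hdist_square\<close>, which makes it the limit of the fibre
  distance over \<open>sqrt s\<close>; \<open>hnorm_minus_M\<close> identifies it with the length of
  \<open>x - y\<close> in the module of units.\<close>

definition udist :: "(real \<Rightarrow> 'e) \<Rightarrow> (real \<Rightarrow> 'e) \<Rightarrow> real" where
  "udist x y = sqrt (norm ((G x x 1 - G x y 1) - (G y x 1 - G y y 1)))"

lemma udist_nonneg [simp]: "0 \<le> udist x y"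
  by (simp add: udist_def)

lemma udist_omega: "udist x \<omega> = hnorm M x"
  unfolding hnorm_def ip_M udist_def ..

lemma hnorm_minus_M:
  assumes "x \<in> U" "y \<in> U"
  shows "hnorm M (x \<ominus>\<^bsub>M\<^esub> y) = udist x y"
proof -
  interpret sesquilinear_bimodule M by (rule sesquilinear_M)
  have "(hnorm M (x \<ominus>\<^bsub>M\<^esub> y))\<^sup>2 = norm ((ip M x x - ip M x y) - (ip M y x - ip M y y))"
    using assms by (intro hnorm_minus_square) auto
  also have "(ip M x x - ip M x y) - (ip M y x - ip M y y) = (G x x 1 - G x y 1) - (G y x 1 - G y y 1)"
    unfolding ip_M by simp
  also have "norm \<dots> = (udist x y)\<^sup>2" by (simp add: udist_def)
  finally show ?thesis by (simp add: power2_eq_iff_nonneg)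
qed

text \<open>All four kernels start at 1, so their alternating sum divided by \<open>s\<close> is an
  alternating sum of difference quotients.\<close>

lemma hdist_udist_tendsto:
  assumes "x \<in> U" "y \<in> U"
  shows "((\<lambda>s. hdist E s (x s) (y s) / sqrt s) \<longlongrightarrow> udist x y) (at_right 0)"
proof -
  let ?d = "\<lambda>s u v. (1 / s) *\<^sub>R (mel E s (u s) (v s) 1 - 1)"
  have "((\<lambda>s. sqrt (norm ((?d s x x - ?d s x y) - (?d s y x - ?d s y y)))) \<longlongrightarrow> udist x y) (at_right 0)"
    unfolding udist_def using assms by (intro tendsto_intros mel_gen_tendsto)
  then show ?thesis
  proof (rule Lim_transform_eventually)
    show "\<forall>\<^sub>F s in at_right 0. sqrt (norm ((?d s x x - ?d s x y) - (?d s y x - ?d s y y))) = hdist E s (x s) (y s) / sqrt s"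
    proof (rule eventually_at_right_0I[OF zero_less_one])
      fix s :: real assume s: "0 < s"
      have "(?d s x x - ?d s x y) - (?d s y x - ?d s y y)
          = (1 / s) *\<^sub>R ((mel E s (x s) (x s) 1 - mel E s (x s) (y s) 1) - (mel E s (y s) (x s) 1 - mel E s (y s) (y s) 1))"
        by (simp add: algebra_simps)
      then have "norm ((?d s x x - ?d s x y) - (?d s y x - ?d s y y)) = (hdist E s (x s) (y s))\<^sup>2 / s"
        using s assms by (simp add: hdist_square U_closed)
      then show "sqrt (norm ((?d s x x - ?d s x y) - (?d s y x - ?d s y y))) = hdist E s (x s) (y s) / sqrt s"
        using s by (simp add: real_sqrt_divide)
    qed
  qed
qed

lemma udist_le:
  assumes "x \<in> U" "y \<in> U" "0 \<le> K" "\<And>t. 0 < t \<Longrightarrow> (hdist E t (x t) (y t))\<^sup>2 \<le> K * t * exp (R * t)"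
  shows "udist x y \<le> sqrt K"
proof -
  have "((\<lambda>s. sqrt (K * exp (R * s))) \<longlongrightarrow> sqrt (K * exp (R * 0))) (at_right 0)" by (intro tendsto_intros)
  then have "((\<lambda>s. sqrt (K * exp (R * s))) \<longlongrightarrow> sqrt K) (at_right 0)" by simp
  moreover have "\<forall>\<^sub>F s in at_right 0. hdist E s (x s) (y s) / sqrt s \<le> sqrt (K * exp (R * s))"
  proof (rule eventually_at_right_0I[OF zero_less_one])
    fix s :: real assume s: "0 < s"
    have "hdist E s (x s) (y s) \<le> sqrt (K * s * exp (R * s))" using assms(4)[OF s] by (rule real_le_rsqrt)
    also have "\<dots> = sqrt (K * exp (R * s)) * sqrt s" by (simp add: real_sqrt_mult)
    finally show "hdist E s (x s) (y s) / sqrt s \<le> sqrt (K * exp (R * s))" using s by (simp add: divide_le_eq)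
  qed
  ultimately show ?thesis using hdist_udist_tendsto[OF assms(1,2)] by (intro tendsto_le[OF trivial_limit_at_right_real])
qed

text \<open>Subtracting \<open>\<omega>\<close> makes the constant terms cancel, so the quotient by
  \<open>s\<close> converges; at \<open>b = 1\<close> the limit is the inner product of the
  module.\<close>

lemma ip_minus_omega_tendsto:
  assumes "x \<in> U" "y \<in> U"
  shows "((\<lambda>s. (1 / s) *\<^sub>R mel E s (x s \<ominus>\<^bsub>fibre E s\<^esub> \<omega> s) (y s \<ominus>\<^bsub>fibre E s\<^esub> \<omega> s) b)
    \<longlongrightarrow> (G x y b - G x \<omega> b) - (G \<omega> y b - G \<omega> \<omega> b)) (at_right 0)"
proof -
  let ?d = "\<lambda>s u v. (1 / s) *\<^sub>R (mel E s (u s) (v s) b - b)"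
  have "((\<lambda>s. (?d s x y - ?d s x \<omega>) - (?d s \<omega> y - ?d s \<omega> \<omega>))
      \<longlongrightarrow> (G x y b - G x \<omega> b) - (G \<omega> y b - G \<omega> \<omega> b)) (at_right 0)"
    using assms omega_U by (intro tendsto_intros mel_gen_tendsto)
  then show ?thesis
  proof (rule Lim_transform_eventually)
    show "\<forall>\<^sub>F s in at_right 0. (?d s x y - ?d s x \<omega>) - (?d s \<omega> y - ?d s \<omega> \<omega>)
        = (1 / s) *\<^sub>R mel E s (x s \<ominus>\<^bsub>fibre E s\<^esub> \<omega> s) (y s \<ominus>\<^bsub>fibre E s\<^esub> \<omega> s) b"
    proof (rule eventually_at_right_0I[OF zero_less_one])
      fix s :: real assume s: "0 < s"
      have c: "u \<in> U \<Longrightarrow> u s \<ominus>\<^bsub>fibre E s\<^esub> \<omega> s \<in> carrier (fibre E s)" for u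
        using s abelian_group.minus_closed[OF abg] by (simp add: fibre_closed)
      have "mel E s v (y s \<ominus>\<^bsub>fibre E s\<^esub> \<omega> s) b = mel E s v (y s) b - mel E s v (\<omega> s) b" if "v \<in> carrier (fibre E s)" for v
      proof -
        have "mel E s v (y s \<ominus>\<^bsub>fibre E s\<^esub> \<omega> s) b = adj (mel E s (y s \<ominus>\<^bsub>fibre E s\<^esub> \<omega> s) v (adj b))"
          using s c[OF assms(2)] that by (simp add: adj_mel adj_adj)
        also have "\<dots> = mel E s v (y s) b - mel E s v (\<omega> s) b"
          using s that assms by (simp add: mel_minus_left fibre_closed adj_diff adj_mel adj_adj)
        finally show ?thesis .
      qed
      then have eq: "mel E s (x s \<ominus>\<^bsub>fibre E s\<^esub> \<omega> s) (y s \<ominus>\<^bsub>fibre E s\<^esub> \<omega> s) b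
          = (mel E s (x s) (y s) b - mel E s (x s) (\<omega> s) b) - (mel E s (\<omega> s) (y s) b - mel E s (\<omega> s) (\<omega> s) b)"
        using s assms c[OF assms(1)] c[OF assms(2)] by (simp add: mel_minus_left fibre_closed)
      show "(?d s x y - ?d s x \<omega>) - (?d s \<omega> y - ?d s \<omega> \<omega>)
          = (1 / s) *\<^sub>R mel E s (x s \<ominus>\<^bsub>fibre E s\<^esub> \<omega> s) (y s \<ominus>\<^bsub>fibre E s\<^esub> \<omega> s) b"
        unfolding eq by (simp add: algebra_simps)
    qed
  qed
qed

text \<open>Both inequalities hold in the fibres for the vectors \<open>x s - \<omega> s\<close> and
  pass to the limit after division by \<open>s\<close>. For the left action, the squared length of
  \<open>b x\<close> is the limit of that of \<open>b (x s - \<omega> s)\<close> over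
  \<open>s\<close>.\<close>

lemma semi_inner_M: "semi_inner_bimodule M"
proof -
  have cs: "norm (ip M x y) \<le> hnorm M x * hnorm M y" if "x \<in> U" "y \<in> U" for x y
  proof -
    have "((\<lambda>s. (hdist E s (x s) (\<omega> s) / sqrt s) * (hdist E s (y s) (\<omega> s) / sqrt s)) \<longlongrightarrow> hnorm M x * hnorm M y) (at_right 0)"
      unfolding udist_omega[symmetric] using that omega_U by (intro tendsto_intros hdist_udist_tendsto)
    moreover have "((\<lambda>s. norm ((1 / s) *\<^sub>R mel E s (x s \<ominus>\<^bsub>fibre E s\<^esub> \<omega> s) (y s \<ominus>\<^bsub>fibre E s\<^esub> \<omega> s) 1)) \<longlongrightarrow> norm (ip M x y)) (at_right 0)"
      unfolding ip_M using that by (intro tendsto_intros ip_minus_omega_tendsto)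
    moreover have "\<forall>\<^sub>F s in at_right 0. norm ((1 / s) *\<^sub>R mel E s (x s \<ominus>\<^bsub>fibre E s\<^esub> \<omega> s) (y s \<ominus>\<^bsub>fibre E s\<^esub> \<omega> s) 1)
        \<le> (hdist E s (x s) (\<omega> s) / sqrt s) * (hdist E s (y s) (\<omega> s) / sqrt s)"
    proof (rule eventually_at_right_0I[OF zero_less_one])
      fix s :: real assume s: "0 < s"
      interpret F: pre_hilbert_bimodule "fibre E s" by (rule pre) (use s in simp)
      have "norm (mel E s (x s \<ominus>\<^bsub>fibre E s\<^esub> \<omega> s) (y s \<ominus>\<^bsub>fibre E s\<^esub> \<omega> s) 1) \<le> hdist E s (x s) (\<omega> s) * hdist E s (y s) (\<omega> s)"
        using s that F.ip_cauchy_schwarz by (simp add: mel_def hdist_def F.lact_one fibre_closed)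
      then have "(1 / s) * norm (mel E s (x s \<ominus>\<^bsub>fibre E s\<^esub> \<omega> s) (y s \<ominus>\<^bsub>fibre E s\<^esub> \<omega> s) 1) \<le> (1 / s) * (hdist E s (x s) (\<omega> s) * hdist E s (y s) (\<omega> s))"
        using s by (intro mult_left_mono) auto
      then show "norm ((1 / s) *\<^sub>R mel E s (x s \<ominus>\<^bsub>fibre E s\<^esub> \<omega> s) (y s \<ominus>\<^bsub>fibre E s\<^esub> \<omega> s) 1)
          \<le> (hdist E s (x s) (\<omega> s) / sqrt s) * (hdist E s (y s) (\<omega> s) / sqrt s)"
        using s by simp
    qed
    ultimately show ?thesis by (intro tendsto_le[OF trivial_limit_at_right_real])
  qed
  have lact: "hnorm M (lact M b x) \<le> norm b * hnorm M x" if x: "x \<in> U" for b x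
  proof -
    have eq: "ip M (lact M b x) (lact M b x) = (G x x (adj b * b) - G x \<omega> (adj b * b)) - (G \<omega> x (adj b * b) - G \<omega> \<omega> (adj b * b))"
      unfolding ip_M using x omega_U
      by (simp add: gen_lact_M gen_lact_M_right M_closed blinfun.diff_right algebra_simps)
    have "((\<lambda>s. norm b * norm b * (hdist E s (x s) (\<omega> s) / sqrt s) * (hdist E s (x s) (\<omega> s) / sqrt s)) \<longlongrightarrow> norm b * norm b * hnorm M x * hnorm M x) (at_right 0)"
      unfolding udist_omega[symmetric] using x omega_U by (intro tendsto_intros hdist_udist_tendsto)
    moreover have "((\<lambda>s. norm ((1 / s) *\<^sub>R mel E s (x s \<ominus>\<^bsub>fibre E s\<^esub> \<omega> s) (x s \<ominus>\<^bsub>fibre E s\<^esub> \<omega> s) (adj b * b))) \<longlongrightarrow> norm (ip M (lact M b x) (lact M b x))) (at_right 0)"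
      unfolding eq using x by (intro tendsto_intros ip_minus_omega_tendsto)
    moreover have "\<forall>\<^sub>F s in at_right 0. norm ((1 / s) *\<^sub>R mel E s (x s \<ominus>\<^bsub>fibre E s\<^esub> \<omega> s) (x s \<ominus>\<^bsub>fibre E s\<^esub> \<omega> s) (adj b * b))
        \<le> norm b * norm b * (hdist E s (x s) (\<omega> s) / sqrt s) * (hdist E s (x s) (\<omega> s) / sqrt s)"
    proof (rule eventually_at_right_0I[OF zero_less_one])
      fix s :: real assume s: "0 < s"
      interpret F: pre_hilbert_bimodule "fibre E s" by (rule pre) (use s in simp)
      let ?u = "x s \<ominus>\<^bsub>fibre E s\<^esub> \<omega> s"
      have u: "?u \<in> carrier (fibre E s)" using s x by (simp add: fibre_closed)
      have "mel E s ?u ?u (adj b * b) = ip (fibre E s) (lact (fibre E s) b ?u) (lact (fibre E s) b ?u)"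
        using u by (simp add: mel_def F.lact_mult F.ip_lact F.lact_closed)
      then have "norm (mel E s ?u ?u (adj b * b)) = (hnorm (fibre E s) (lact (fibre E s) b ?u))\<^sup>2" by (simp add: F.hnorm_square)
      also have "\<dots> \<le> (norm b * hdist E s (x s) (\<omega> s))\<^sup>2"
        using F.hnorm_lact[OF u] by (intro power_mono) (auto simp: hdist_def)
      finally have "(1 / s) * norm (mel E s ?u ?u (adj b * b)) \<le> (1 / s) * (norm b * hdist E s (x s) (\<omega> s))\<^sup>2"
        using s by (intro mult_left_mono) auto
      then show "norm ((1 / s) *\<^sub>R mel E s ?u ?u (adj b * b)) \<le> norm b * norm b * (hdist E s (x s) (\<omega> s) / sqrt s) * (hdist E s (x s) (\<omega> s) / sqrt s)"
        using s by (simp add: power2_eq_square mult.commute mult.left_commute)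
    qed
    ultimately have "norm (ip M (lact M b x) (lact M b x)) \<le> norm b * norm b * hnorm M x * hnorm M x"
      by (intro tendsto_le[OF trivial_limit_at_right_real])
    also have "\<dots> = (norm b * hnorm M x)\<^sup>2" by (simp add: power2_eq_square)
    finally show ?thesis unfolding hnorm_def[of M "lact M b x"] by (intro real_le_lsqrt) auto
  qed
  have "semi_inner_bimodule_axioms M"
    by unfold_locales (use cs lact in \<open>simp_all del: M_simps(6)\<close>)
  then show ?thesis using sesquilinear_M by (simp add: semi_inner_bimodule_def)
qed

text \<open>\<open>comm_form\<close> has four terms, each at most
  \<open>norm (gen E \<omega> \<omega>)\<close> times the square of \<open>norm c\<close>; this is
  the root of the total coefficient.\<close>

definition comm_bound :: real where "comm_bound = 2 * sqrt (norm (gen E \<omega> \<omega>))"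

text \<open>For the kernel of \<open>\<omega>\<close> this is the inner square of the commutator of
  \<open>c\<close> with \<open>\<omega>\<close>. It is linear in \<open>L\<close> and vanishes for
  the identity, so difference quotients may be inserted for the kernel.\<close>

definition comm_form :: "('b \<Rightarrow> 'b) \<Rightarrow> 'b \<Rightarrow> 'b" where
  "comm_form L c = (L (adj c * c) - L (adj c) * c) - (adj c * L c - adj c * L 1 * c)"

lemma hnorm_commutator_tendsto:
  defines "w \<equiv> \<lambda>s c. lact (fibre E s) c (\<omega> s) \<ominus>\<^bsub>fibre E s\<^esub> ract (fibre E s) (\<omega> s) c"
  shows "((\<lambda>s. hnorm (fibre E s) (w s c) / sqrt s) \<longlongrightarrow> sqrt (norm (comm_form (G \<omega> \<omega>) c))) (at_right 0)"
proof -
  let ?k = "\<lambda>s. mel E s (\<omega> s) (\<omega> s)"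
  let ?m = "\<lambda>s b. (1 / s) *\<^sub>R (?k s b - b)"
  have "((\<lambda>s. sqrt (norm (comm_form (?m s) c))) \<longlongrightarrow> sqrt (norm (comm_form (G \<omega> \<omega>) c))) (at_right 0)"
    unfolding comm_form_def using omega_U by (intro tendsto_intros mel_gen_tendsto)
  then show ?thesis
  proof (rule Lim_transform_eventually)
    show "\<forall>\<^sub>F s in at_right 0. sqrt (norm (comm_form (?m s) c)) = hnorm (fibre E s) (w s c) / sqrt s"
    proof (rule eventually_at_right_0I[OF zero_less_one])
      fix s :: real assume s: "0 < s"
      interpret F: pre_hilbert_bimodule "fibre E s" by (rule pre) (use s in simp)
      let ?l = "lact (fibre E s) c (\<omega> s)" and ?r = "ract (fibre E s) (\<omega> s) c"
      have w: "\<omega> s \<in> carrier (fibre E s)" using s by (simp add: fibre_closed)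
      have "ip (fibre E s) ?l ?l = ?k s (adj c * c)" "ip (fibre E s) ?l ?r = ?k s (adj c) * c"
        "ip (fibre E s) ?r ?l = adj c * ?k s c" "ip (fibre E s) ?r ?r = adj c * ?k s 1 * c"
        using w by (simp_all add: mel_def F.lact_mult F.ip_lact F.lact_closed F.ip_ract F.ip_ract_left F.lact_one F.ract_closed mult.assoc)
      then have "(hnorm (fibre E s) (w s c))\<^sup>2 = norm (comm_form (?k s) c)"
        using F.hnorm_minus_square[OF F.lact_closed[OF w] F.ract_closed[OF w]] by (simp only: w_def comm_form_def)
      moreover have "comm_form (?m s) c = (1 / s) *\<^sub>R comm_form (?k s) c"
        by (simp add: comm_form_def algebra_simps)
      ultimately have "norm (comm_form (?m s) c) = (hnorm (fibre E s) (w s c))\<^sup>2 / s" using s by simp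
      then show "sqrt (norm (comm_form (?m s) c)) = hnorm (fibre E s) (w s c) / sqrt s"
        using s by (simp add: real_sqrt_divide)
    qed
  qed
qed

lemma comm_form_bound: "sqrt (norm (comm_form (G \<omega> \<omega>) c)) \<le> comm_bound * norm c"
proof -
  let ?N = "norm (gen E \<omega> \<omega>)"
  have n: "norm (G \<omega> \<omega> b) \<le> ?N * norm b" for b by (rule norm_blinfun)
  have 1: "norm (G \<omega> \<omega> (adj c * c)) \<le> ?N * (norm c * norm c)"
    using order_trans[OF n mult_left_mono[OF norm_mult_ineq norm_ge_zero]] by (metis norm_adj)
  have 2: "norm (G \<omega> \<omega> (adj c) * c) \<le> ?N * (norm c * norm c)"
    using order_trans[OF norm_mult_ineq mult_right_mono[OF n[of "adj c"] norm_ge_zero]] by (simp add: mult.assoc)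
  have 3: "norm (adj c * G \<omega> \<omega> c) \<le> ?N * (norm c * norm c)"
    using order_trans[OF norm_mult_ineq[of "adj c"] mult_left_mono[OF n[of c] norm_ge_zero]] by (simp add: mult.assoc mult.left_commute)
  have "norm (adj c * G \<omega> \<omega> 1 * c) \<le> norm (adj c) * norm (G \<omega> \<omega> 1) * norm c"
    by (intro order_trans[OF norm_mult_ineq] mult_right_mono norm_mult_ineq) auto
  moreover have "norm (G \<omega> \<omega> 1) \<le> ?N"
    using order_trans[OF n[of 1] mult_left_mono[OF norm_one_le norm_ge_zero]] by simp
  then have "norm (adj c) * norm (G \<omega> \<omega> 1) * norm c \<le> norm c * ?N * norm c"
    unfolding norm_adj by (intro mult_right_mono mult_left_mono) auto
  ultimately have 4: "norm (adj c * G \<omega> \<omega> 1 * c) \<le> ?N * (norm c * norm c)" by (simp add: mult.assoc mult.left_commute)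
  have "norm (comm_form (G \<omega> \<omega>) c)
      \<le> (?N * (norm c * norm c) + ?N * (norm c * norm c)) + (?N * (norm c * norm c) + ?N * (norm c * norm c))"
    unfolding comm_form_def
    by (intro order_trans[OF norm_triangle_ineq4] add_mono order_trans[OF norm_triangle_ineq4] 1 2 3 4)
  also have "\<dots> = (comm_bound * norm c)\<^sup>2" by (simp add: comm_bound_def power2_eq_square)
  finally show ?thesis by (intro real_le_lsqrt) (auto simp: comm_bound_def)
qed

text \<open>With \<open>c \<xi>\<^sub>s = c (\<xi>\<^sub>s - \<omega>\<^sub>s) + (c \<omega>\<^sub>s - \<omega>\<^sub>s c) + \<omega>\<^sub>s c\<close>, the first two terms have norm \<open>O(sqrt s)\<close>,
  and so has \<open>x\<^sub>s - y\<^sub>s\<close>; the last term contributes nothing to the derivative of \<open>\<langle>x\<^sub>s - y\<^sub>s, c \<xi>\<^sub>s\<rangle>\<close>.\<close>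

lemma gen_diff_bound:
  assumes x: "x \<in> U" and y: "y \<in> U" and \<xi>: "\<xi> \<in> U" and eq: "G x \<omega> 1 = G y \<omega> 1"
  shows "norm (G x \<xi> c - G y \<xi> c) \<le> udist x y * (udist \<xi> \<omega> + comm_bound) * norm c"
proof -
  let ?w = "\<lambda>s. lact (fibre E s) c (\<omega> s) \<ominus>\<^bsub>fibre E s\<^esub> ract (fibre E s) (\<omega> s) c"
  let ?m = "\<lambda>s u v b. (1 / s) *\<^sub>R (mel E s (u s) (v s) b - b)"
  let ?r = "\<lambda>s. (hdist E s (x s) (y s) / sqrt s) * (norm c * (hdist E s (\<xi> s) (\<omega> s) / sqrt s) + hnorm (fibre E s) (?w s) / sqrt s)"
  have "(?r \<longlongrightarrow> udist x y * (norm c * udist \<xi> \<omega> + sqrt (norm (comm_form (G \<omega> \<omega>) c)))) (at_right 0)"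
    using assms omega_U by (intro tendsto_intros hdist_udist_tendsto hnorm_commutator_tendsto)
  moreover have "((\<lambda>s. norm ((?m s x \<xi> c - ?m s y \<xi> c) - (?m s x \<omega> 1 - ?m s y \<omega> 1) * c)) \<longlongrightarrow> norm ((G x \<xi> c - G y \<xi> c) - (G x \<omega> 1 - G y \<omega> 1) * c)) (at_right 0)"
    using assms omega_U by (intro tendsto_intros mel_gen_tendsto)
  moreover have "\<forall>\<^sub>F s in at_right 0. norm ((?m s x \<xi> c - ?m s y \<xi> c) - (?m s x \<omega> 1 - ?m s y \<omega> 1) * c) \<le> ?r s"
  proof (rule eventually_at_right_0I[OF zero_less_one])
    fix s :: real assume s: "0 < s"
    interpret F: pre_hilbert_bimodule "fibre E s" by (rule pre) (use s in simp)
    have cl: "x s \<in> carrier (fibre E s)" "y s \<in> carrier (fibre E s)" "\<xi> s \<in> carrier (fibre E s)" "\<omega> s \<in> carrier (fibre E s)"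
      using s assms by (simp_all add: fibre_closed)
    let ?u = "x s \<ominus>\<^bsub>fibre E s\<^esub> y s" and ?v = "\<xi> s \<ominus>\<^bsub>fibre E s\<^esub> \<omega> s"
    have u: "?u \<in> carrier (fibre E s)" and v: "?v \<in> carrier (fibre E s)" using cl by simp_all
    have lv: "lact (fibre E s) c (\<xi> s) = lact (fibre E s) c ?v \<oplus>\<^bsub>fibre E s\<^esub> lact (fibre E s) c (\<omega> s)"
      using cl v F.lact_add_right[of ?v "\<omega> s" c] by (simp add: F.minus_add_cancel)
    have lw: "lact (fibre E s) c (\<omega> s) = ?w s \<oplus>\<^bsub>fibre E s\<^esub> ract (fibre E s) (\<omega> s) c"
      using cl by (simp add: F.minus_add_cancel F.lact_closed F.ract_closed)
    have a: "mel E s ?u (\<xi> s) c = ip (fibre E s) ?u (lact (fibre E s) c ?v) + ip (fibre E s) ?u (?w s) + mel E s ?u (\<omega> s) 1 * c"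
    proof -
      have "mel E s ?u (\<xi> s) c = ip (fibre E s) ?u (lact (fibre E s) c ?v) + ip (fibre E s) ?u (lact (fibre E s) c (\<omega> s))"
        unfolding mel_def lv using u v cl by (simp add: F.ip_add_right F.lact_closed)
      also have "ip (fibre E s) ?u (lact (fibre E s) c (\<omega> s)) = ip (fibre E s) ?u (?w s) + mel E s ?u (\<omega> s) 1 * c"
        by (subst lw) (use u cl in \<open>simp add: F.ip_add_right F.lact_closed F.ract_closed F.ip_ract F.lact_one mel_def\<close>)
      finally show ?thesis by (simp add: add.assoc)
    qed
    have "norm (mel E s ?u (\<xi> s) c - mel E s ?u (\<omega> s) 1 * c) \<le> norm (ip (fibre E s) ?u (lact (fibre E s) c ?v)) + norm (ip (fibre E s) ?u (?w s))"
      unfolding a by (simp add: norm_triangle_ineq)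
    also have "\<dots> \<le> hnorm (fibre E s) ?u * hnorm (fibre E s) (lact (fibre E s) c ?v) + hnorm (fibre E s) ?u * hnorm (fibre E s) (?w s)"
      using u v cl by (intro add_mono F.ip_cauchy_schwarz F.lact_closed F.minus_closed F.ract_closed)
    also have "\<dots> \<le> hnorm (fibre E s) ?u * (norm c * hnorm (fibre E s) ?v) + hnorm (fibre E s) ?u * hnorm (fibre E s) (?w s)"
      using v by (intro add_mono mult_left_mono F.hnorm_lact) auto
    finally have "norm (mel E s ?u (\<xi> s) c - mel E s ?u (\<omega> s) 1 * c)
        \<le> hdist E s (x s) (y s) * (norm c * hdist E s (\<xi> s) (\<omega> s) + hnorm (fibre E s) (?w s))"
      by (simp add: hdist_def distrib_left)
    then have "(1 / s) * norm (mel E s ?u (\<xi> s) c - mel E s ?u (\<omega> s) 1 * c)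
        \<le> (1 / s) * (hdist E s (x s) (y s) * (norm c * hdist E s (\<xi> s) (\<omega> s) + hnorm (fibre E s) (?w s)))"
      using s by (intro mult_left_mono) auto
    moreover have "(?m s x \<xi> c - ?m s y \<xi> c) - (?m s x \<omega> 1 - ?m s y \<omega> 1) * c = (1 / s) *\<^sub>R (mel E s ?u (\<xi> s) c - mel E s ?u (\<omega> s) 1 * c)"
      using s cl by (simp add: mel_minus_left algebra_simps)
    moreover have "?r s = (1 / s) * (hdist E s (x s) (y s) * (norm c * hdist E s (\<xi> s) (\<omega> s) + hnorm (fibre E s) (?w s)))"
    proof -
      have "?r s = hdist E s (x s) (y s) * (norm c * hdist E s (\<xi> s) (\<omega> s) + hnorm (fibre E s) (?w s)) / (sqrt s * sqrt s)"
        by (simp add: add_divide_distrib distrib_left)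
      then show ?thesis using s by simp
    qed
    ultimately show "norm ((?m s x \<xi> c - ?m s y \<xi> c) - (?m s x \<omega> 1 - ?m s y \<omega> 1) * c) \<le> ?r s" using s by simp
  qed
  ultimately have "norm ((G x \<xi> c - G y \<xi> c) - (G x \<omega> 1 - G y \<omega> 1) * c)
      \<le> udist x y * (norm c * udist \<xi> \<omega> + sqrt (norm (comm_form (G \<omega> \<omega>) c)))"
    by (intro tendsto_le[OF trivial_limit_at_right_real])
  also have "\<dots> \<le> udist x y * (norm c * udist \<xi> \<omega> + comm_bound * norm c)"
    by (intro mult_left_mono add_left_mono comm_form_bound) auto
  finally show ?thesis using eq by (simp add: algebra_simps)
qed

end

section \<open>Completeness of the module of units\<close>

context product_system_unit
begin

lemma udist_commute: "x \<in> U \<Longrightarrow> y \<in> U \<Longrightarrow> udist x y = udist y x"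
  using sesquilinear_bimodule.hnorm_minus_commute[OF sesquilinear_M, of x y]
  by (simp add: hnorm_minus_M)

lemma udist_triangle: "x \<in> U \<Longrightarrow> y \<in> U \<Longrightarrow> z \<in> U \<Longrightarrow> udist x z \<le> udist x y + udist y z"
  using semi_inner_bimodule.hnorm_minus_triangle[OF semi_inner_M, of x y z] by (simp add: hnorm_minus_M)

lemma comm_bound_nonneg [simp]: "0 \<le> comm_bound"
  by (simp add: comm_bound_def)

lemma eq_if_udist_0:
  assumes "x \<in> U" "y \<in> U" "G x \<omega> 1 = G y \<omega> 1" "udist x y = 0"
  shows "x = y"
proof (rule unit_eqI[OF assms(1,2)])
  fix \<xi> b assume "\<xi> \<in> U"
  from gen_diff_bound[OF assms(1,2) this assms(3), of b] assms(4) show "G x \<xi> b = G y \<xi> b" by simp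
qed

lemma hdist_limit_unique:
  fixes f :: "nat \<Rightarrow> 'e"
  assumes that: "0 \<le> t" "u \<in> carrier (fibre E t)" "v \<in> carrier (fibre E t)" "\<And>n. f n \<in> carrier (fibre E t)"
      "(\<lambda>n. hdist E t (f n) u) \<longlonglongrightarrow> 0" "(\<lambda>n. hdist E t (f n) v) \<longlonglongrightarrow> 0"
  shows "u = v"
proof -
  have "(\<lambda>n. hdist E t (f n) u + hdist E t (f n) v) \<longlonglongrightarrow> 0 + 0" using that by (intro tendsto_add)
  moreover have "hdist E t u v \<le> hdist E t (f n) u + hdist E t (f n) v" for n
    using hdist_triangle[of t u "f n" v] hdist_commute[of t u "f n"] that by simp
  ultimately have "hdist E t u v \<le> 0" by (intro LIMSEQ_le_const) auto
  then show ?thesis using that by (intro hdist_eq_0[of t]) (auto intro: antisym simp: hdist_nonneg)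
qed

lemma unit_limit:
  assumes xU: "\<And>n. x n \<in> U" and ext: "l \<in> extensional {0..}" and lc: "\<And>t. 0 \<le> t \<Longrightarrow> l t \<in> carrier (fibre E t)"
    and ll: "\<And>t. 0 \<le> t \<Longrightarrow> (\<lambda>n. hdist E t (x n t) (l t)) \<longlonglongrightarrow> 0"
  shows "l \<in> units E"
proof -
  have hn: "(\<lambda>n. hnorm (fibre E t) (x n t)) \<longlonglongrightarrow> hnorm (fibre E t) (l t)" if "0 \<le> t" for t
    by (rule pre_hilbert_bimodule.hnorm_tendsto[OF pre[OF that] U_closed[OF xU that] lc[OF that] ll[OF that, unfolded hdist_def]])
  show ?thesis
  proof (rule unitI)
    show "l \<in> extensional {0..}" by (rule ext)
    show "l t \<in> carrier (fibre E t)" if "0 \<le> t" for t by (rule lc[OF that])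
    show "l 0 = triv E 1"
      using lc[of 0] ll[of 0] triv_closed xU by (intro hdist_limit_unique[of 0 _ _ "\<lambda>n. x n 0"]) (auto simp: unit_0 U_unit)
    fix t s :: real assume ts: "0 \<le> t" "0 \<le> s"
    show "prd E t s (l t) (l s) = l (t + s)"
    proof (rule hdist_limit_unique[of "t + s" _ _ "\<lambda>n. x n (t + s)"])
      have "(\<lambda>n. hdist E t (x n t) (l t) * hnorm (fibre E s) (x n s) + hnorm (fibre E t) (l t) * hdist E s (x n s) (l s))
          \<longlonglongrightarrow> 0 * hnorm (fibre E s) (l s) + hnorm (fibre E t) (l t) * 0"
        using ts by (intro tendsto_intros ll hn)
      then have lim: "(\<lambda>n. hdist E t (x n t) (l t) * hnorm (fibre E s) (x n s) + hnorm (fibre E t) (l t) * hdist E s (x n s) (l s)) \<longlonglongrightarrow> 0"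
        by simp
      have "norm (hdist E (t + s) (x n (t + s)) (prd E t s (l t) (l s)))
          \<le> hdist E t (x n t) (l t) * hnorm (fibre E s) (x n s) + hnorm (fibre E t) (l t) * hdist E s (x n s) (l s)" for n
        using hdist_prd[OF ts, of "x n t" "l t" "x n s" "l s"] ts lc xU by (simp add: U_closed unit_prd U_unit hdist_nonneg)
      then show "(\<lambda>n. hdist E (t + s) (x n (t + s)) (prd E t s (l t) (l s))) \<longlonglongrightarrow> 0"
        by (intro Lim_null_comparison[OF always_eventually lim]) auto
    qed (use ts lc ll xU prd_closed in \<open>auto simp: U_closed\<close>)
  qed
qed

text \<open>Convergence in the fibres alone does not carry over derivatives at 0; the remainder
  \<open>(exp (Q t) - 1 - Q t) / t\<close> from \<open>mel_exp_bound\<close> does, being the same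
  for all \<open>n\<close> and tending to 0.\<close>

lemma gen_omega_limit:
  assumes xU: "\<And>n. x n \<in> U" and lU: "l \<in> U" and l: "\<And>t. 0 < t \<Longrightarrow> (\<lambda>n. hdist E t (x n t) (l t)) \<longlonglongrightarrow> 0"
    and Qw: "\<And>n b. norm (G (x n) \<omega> b) \<le> Q * norm b" and Q0: "0 \<le> Q" and norm: "\<And>n. G (x n) \<omega> 1 = g"
  shows "G l \<omega> 1 = g"
proof -
  let ?b = "\<lambda>t. (exp (Q * t) - 1 - Q * t) / t"
  have "((\<lambda>t. (exp (Q * t) - 1) / t - Q) \<longlongrightarrow> Q - Q) (at_right 0)"
  proof (intro tendsto_diff tendsto_const)
    have "((\<lambda>t. exp (Q * t)) has_field_derivative exp (Q * 0) * Q) (at 0)" by (auto intro!: derivative_eq_intros)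
    then have "((\<lambda>t. (exp (Q * t) - 1) / t) \<longlongrightarrow> Q) (at 0)" by (simp add: has_field_derivative_iff)
    then show "((\<lambda>t. (exp (Q * t) - 1) / t) \<longlongrightarrow> Q) (at_right 0)" by (rule tendsto_mono[OF at_le, rotated]) auto
  qed
  then have "((\<lambda>t. (exp (Q * t) - 1) / t - Q) \<longlongrightarrow> 0) (at_right 0)" by simp
  then have b: "(?b \<longlongrightarrow> 0) (at_right 0)"
  proof (rule Lim_transform_eventually)
    show "\<forall>\<^sub>F t in at_right 0. (exp (Q * t) - 1) / t - Q = ?b t"
      by (rule eventually_at_right_0I[OF zero_less_one]) (simp add: diff_divide_distrib)
  qed
  have "\<forall>\<^sub>F t in at_right 0. norm ((1 / t) *\<^sub>R (mel E t (l t) (\<omega> t) 1 - 1) - g) \<le> ?b t"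
  proof (rule eventually_at_right_0I[OF zero_less_one])
    fix t :: real assume t: "0 < t"
    have "(\<lambda>n. mel E t (x n t) (\<omega> t) 1) \<longlonglongrightarrow> mel E t (l t) (\<omega> t) 1"
      using t l xU lU omega_U by (intro mel_tendsto) (auto simp: U_closed)
    then have "(\<lambda>n. norm (mel E t (x n t) (\<omega> t) 1 - 1 - t *\<^sub>R g)) \<longlonglongrightarrow> norm (mel E t (l t) (\<omega> t) 1 - 1 - t *\<^sub>R g)" by (intro tendsto_intros)
    moreover have "norm (mel E t (x n t) (\<omega> t) 1 - 1 - t *\<^sub>R g) \<le> exp (Q * t) - 1 - Q * t" for n
    proof -
      have "norm (mel E t (x n t) (\<omega> t) 1 - 1 - t *\<^sub>R G (x n) \<omega> 1) \<le> (exp (Q * t) - 1 - Q * t) * norm (1::'b)"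
        by (rule mel_exp_bound[OF xU omega_U Qw Q0 t])
      also have "\<dots> \<le> (exp (Q * t) - 1 - Q * t) * 1"
      proof (rule mult_left_mono[OF norm_one_le])
        show "0 \<le> exp (Q * t) - 1 - Q * t" using exp_ge_add_one_self[of "Q * t"] by linarith
      qed
      finally show ?thesis by (simp add: norm)
    qed
    ultimately have "norm (mel E t (l t) (\<omega> t) 1 - 1 - t *\<^sub>R g) \<le> exp (Q * t) - 1 - Q * t"
      by (intro LIMSEQ_le_const2) auto
    moreover have "(1 / t) *\<^sub>R (mel E t (l t) (\<omega> t) 1 - 1) - g = (1 / t) *\<^sub>R (mel E t (l t) (\<omega> t) 1 - 1 - t *\<^sub>R g)"
      using t by (simp add: scaleR_diff_right)
    ultimately show "norm ((1 / t) *\<^sub>R (mel E t (l t) (\<omega> t) 1 - 1) - g) \<le> ?b t"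
      using t by (simp add: divide_right_mono)
  qed
  from Lim_null_comparison[OF this b] have "((\<lambda>t. (1 / t) *\<^sub>R (mel E t (l t) (\<omega> t) 1 - 1)) \<longlongrightarrow> g) (at_right 0)"
    by (rule LIM_zero_cancel)
  with mel_gen_tendsto[OF lU omega_U, of 1] show ?thesis by (rule tendsto_unique[OF trivial_limit_at_right_real])
qed

text \<open>Equal values \<open>G (x n) \<omega> 1\<close> make \<open>gen_diff_bound\<close>
  applicable to every pair: lengths then control generators, generators control fibre distances by
  \<open>hdist_compare\<close>, and the fibres are complete.\<close>

lemma normalised_complete:
  assumes xU: "\<And>n. x n \<in> U" and norm: "\<And>n. G (x n) \<omega> 1 = g"
    and Cauchy: "\<And>e. 0 < e \<Longrightarrow> \<exists>N. \<forall>m\<ge>N. \<forall>n\<ge>N. udist (x m) (x n) < e"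
  obtains l where "l \<in> U" "G l \<omega> 1 = g" "(\<lambda>n. udist (x n) l) \<longlonglongrightarrow> 0"
proof -
  have eqn: "G (x n) \<omega> 1 = G (x m) \<omega> 1" for n m by (simp add: norm)
  obtain N1 where N1: "\<And>n. n \<ge> N1 \<Longrightarrow> udist (x n) (x N1) < 1" using Cauchy[of 1] by auto
  \<comment> \<open>The maximum over the finitely many early indices makes the bound hold for the
    whole sequence.\<close>
  define R where "R = 1 + Max ((\<lambda>n. udist (x n) (x N1)) ` {..N1})"
  have R: "udist (x n) (x N1) \<le> R" for n
  proof (cases "n \<le> N1")
    case True
    then have "udist (x n) (x N1) \<le> Max ((\<lambda>n. udist (x n) (x N1)) ` {..N1})" by (intro Max_ge) auto
    then show ?thesis by (simp add: R_def)
  next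
    case False
    have "0 \<le> udist (x N1) (x N1)" by simp
    also have "udist (x N1) (x N1) \<le> Max ((\<lambda>n. udist (x n) (x N1)) ` {..N1})" by (intro Max_ge) auto
    finally show ?thesis using N1[of n] False by (simp add: R_def)
  qed
  have R0: "0 \<le> R" using R[of N1] udist_nonneg order_trans by blast
  \<comment> \<open>Bounds the coefficient that \<open>gen_diff_bound\<close> attaches to the test
    unit \<open>x k\<close>, uniformly in \<open>k\<close>.\<close>
  define S where "S = R + udist (x N1) \<omega> + comm_bound"
  have S: "udist (x n) \<omega> + comm_bound \<le> S" for n
    using udist_triangle[OF xU[of n] xU[of N1] omega_U] R[of n] by (simp add: S_def)
  have S0: "0 \<le> S" using R0 by (simp add: S_def)
  have Cw: "udist \<omega> \<omega> + comm_bound \<le> S + udist \<omega> \<omega>" using S[of N1] udist_nonneg[of "x N1" \<omega>] by linarith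
  have d1: "norm (G (x n) (x k) b - G (x m) (x k) b) \<le> udist (x n) (x m) * S * norm b" for n m k b
    using gen_diff_bound[OF xU[of n] xU[of m] xU[of k] eqn[of n m], of b] S[of k]
    by (elim order_trans) (intro mult_right_mono mult_left_mono, auto)
  have d2: "norm (G (x k) (x n) b - G (x k) (x m) b) \<le> udist (x n) (x m) * S * norm b" for n m k b
  proof -
    have "G (x k) (x n) b - G (x k) (x m) b = adj (G (x n) (x k) (adj b) - G (x m) (x k) (adj b))"
      using xU by (simp add: adj_diff adj_G adj_adj)
    then show ?thesis using d1[of n k "adj b" m] by simp
  qed
  \<comment> \<open>Bounds all generators among the \<open>x n\<close> and against
    \<open>\<omega>\<close>: starting from index \<open>N1\<close>, exchanging one argument costs at
    most \<open>R * S\<close>, or \<open>R * (S + udist \<omega> \<omega>)\<close> when the test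
    unit is \<open>\<omega>\<close>.\<close>
  define Q where "Q = norm (gen E (x N1) (x N1)) + 2 * (R * S) + norm (gen E (x N1) \<omega>) + R * (S + udist \<omega> \<omega>)"
  have Q0: "0 \<le> Q" using R0 S0 by (simp add: Q_def)
  have Q: "norm (G (x n) (x m) b) \<le> Q * norm b" for n m b
  proof -
    have "G (x n) (x m) b = (G (x n) (x m) b - G (x N1) (x m) b) + ((G (x N1) (x m) b - G (x N1) (x N1) b) + G (x N1) (x N1) b)" by simp
    also have "norm \<dots> \<le> R * S * norm b + (R * S * norm b + norm (gen E (x N1) (x N1)) * norm b)"
      using S0
      by (intro order_trans[OF norm_triangle_ineq] add_mono norm_blinfun order_trans[OF d1] order_trans[OF d2] mult_right_mono R) auto
    also have "\<dots> = (norm (gen E (x N1) (x N1)) + 2 * (R * S)) * norm b" by (simp add: algebra_simps)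
    also have "\<dots> \<le> Q * norm b" using R0 S0 by (intro mult_right_mono) (auto simp: Q_def)
    finally show ?thesis .
  qed
  have Qw: "norm (G (x n) \<omega> b) \<le> Q * norm b" for n b
  proof -
    have "norm (G (x n) \<omega> b - G (x N1) \<omega> b) \<le> R * (S + udist \<omega> \<omega>) * norm b"
      using gen_diff_bound[OF xU[of n] xU[of N1] omega_U eqn[of n N1], of b] Cw R[of n] R0
      by (elim order_trans) (intro mult_right_mono mult_mono, auto)
    moreover have "G (x n) \<omega> b = (G (x n) \<omega> b - G (x N1) \<omega> b) + G (x N1) \<omega> b" by simp
    ultimately have "norm (G (x n) \<omega> b) \<le> R * (S + udist \<omega> \<omega>) * norm b + norm (gen E (x N1) \<omega>) * norm b"
      using norm_triangle_mono norm_blinfun by metis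
    also have "\<dots> = (R * (S + udist \<omega> \<omega>) + norm (gen E (x N1) \<omega>)) * norm b" by (simp add: algebra_simps)
    also have "\<dots> \<le> Q * norm b" using R0 S0 by (intro mult_right_mono) (auto simp: Q_def)
    finally show ?thesis .
  qed
  have hd: "(hdist E t (x n t) (x m t))\<^sup>2 \<le> 2 * (udist (x n) (x m) * S) * t * exp (Q * t)" if "0 < t" for n m t
    using xU Q Q0 d2 S0 that
  proof (intro hdist_compare)
    show "norm (G (x m) (x n) b - G (x m) (x m) b) \<le> udist (x n) (x m) * S * norm b" for b by (rule d2)
    show "norm (G (x n) (x n) b - G (x n) (x m) b) \<le> udist (x n) (x m) * S * norm b" for b by (rule d2)
  qed auto
  have conv: "\<exists>l. l \<in> carrier (fibre E t) \<and> (\<lambda>n. hdist E t (x n t) l) \<longlonglongrightarrow> 0" if t: "0 < t" for t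
  proof -
    interpret H: hilbert_bimodule "fibre E t" by (rule hilbert) (use t in simp)
    have "h_Cauchy (fibre E t) (\<lambda>n. x n t)"
      unfolding h_Cauchy_def
    proof (intro conjI allI impI)
      show "x n t \<in> carrier (fibre E t)" for n using xU t by (simp add: U_closed)
      fix e :: real assume e: "0 < e"
      define C where "C = 2 * S * t * exp (Q * t)"
      have C: "0 \<le> C" using S0 t by (simp add: C_def)
      have pos: "0 < e\<^sup>2 / (C + 1)" using e C by simp
      obtain N where N: "\<forall>m\<ge>N. \<forall>n\<ge>N. udist (x m) (x n) < e\<^sup>2 / (C + 1)" using Cauchy[OF pos] by blast
      have "hdist E t (x m t) (x n t) < e" if mn: "m \<ge> N" "n \<ge> N" for m n
      proof -
        have "(hdist E t (x m t) (x n t))\<^sup>2 \<le> udist (x m) (x n) * C" using hd[OF t, of m n] by (simp add: C_def algebra_simps)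
        also have "\<dots> \<le> udist (x m) (x n) * (C + 1)" by (intro mult_left_mono) auto
        also have "\<dots> < e\<^sup>2 / (C + 1) * (C + 1)" using N mn C by (intro mult_strict_right_mono) auto
        also have "\<dots> = e\<^sup>2" using C by simp
        finally show ?thesis using e by (intro power2_less_imp_less[of _ e]) auto
      qed
      then show "\<exists>N. \<forall>m\<ge>N. \<forall>n\<ge>N. hnorm (fibre E t) (x m t \<ominus>\<^bsub>fibre E t\<^esub> x n t) < e" unfolding hdist_def by blast
    qed
    from H.complete[OF this] show ?thesis by (auto simp: h_tendsto_def hdist_def)
  qed
  have conv0: "\<exists>l. l \<in> carrier (fibre E t) \<and> (\<lambda>n. hdist E t (x n t) l) \<longlonglongrightarrow> 0" if t: "0 \<le> t" for t
  proof (cases "t = 0")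
    case True
    have "x n 0 = triv E 1" for n by (rule unit_0[OF U_unit[OF xU]])
    then show ?thesis using True triv_closed by (intro exI[of _ "triv E 1"]) simp
  qed (use conv t in auto)
  obtain l0 where l0: "\<And>t. 0 \<le> t \<Longrightarrow> l0 t \<in> carrier (fibre E t) \<and> (\<lambda>n. hdist E t (x n t) (l0 t)) \<longlonglongrightarrow> 0"
    using conv0 by metis
  define l where "l = restrict l0 {0..}"
  have lc: "l t \<in> carrier (fibre E t)" and ll: "(\<lambda>n. hdist E t (x n t) (l t)) \<longlonglongrightarrow> 0" if "0 \<le> t" for t
    using l0[OF that] that by (auto simp: l_def)
  have l_unit: "l \<in> units E" by (rule unit_limit[OF xU _ lc ll]) (unfold l_def, rule restrict_extensional)
  \<comment> \<open>The bound \<open>hd\<close> passes to the limit in \<open>m\<close> within one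
    fibre, so it holds for \<open>l\<close> before \<open>l\<close> is known to lie in
    \<open>U\<close>.\<close>
  have hl: "(hdist E t (x n t) (l t))\<^sup>2 \<le> 2 * (e * S) * t * exp (Q * t)"
    if t: "0 < t" and e: "\<And>m. m \<ge> N \<Longrightarrow> udist (x n) (x m) \<le> e" for n N t e
  proof -
    have "(\<lambda>m. hdist E t (x n t) (x m t)) \<longlonglongrightarrow> hdist E t (x n t) (l t)"
    proof (rule Lim_null_comparison[OF always_eventually ll[OF less_imp_le[OF t]], THEN LIM_zero_cancel], intro allI)
      fix m
      show "norm (hdist E t (x n t) (x m t) - hdist E t (x n t) (l t)) \<le> hdist E t (x m t) (l t)"
        using hdist_triangle[of t "x n t" "l t" "x m t"] hdist_triangle[of t "x n t" "x m t" "l t"] hdist_commute[of t "l t" "x m t"]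
          t lc xU by (simp add: U_closed abs_le_iff)
    qed
    then have "(\<lambda>m. (hdist E t (x n t) (x m t))\<^sup>2) \<longlonglongrightarrow> (hdist E t (x n t) (l t))\<^sup>2" by (intro tendsto_intros)
    moreover have "(hdist E t (x n t) (x m t))\<^sup>2 \<le> 2 * (e * S) * t * exp (Q * t)" if "m \<ge> N" for m
      using hd[OF t, of n m] e[OF that] t S0 by (elim order_trans) (intro mult_right_mono mult_left_mono, auto)
    ultimately show ?thesis by (intro LIMSEQ_le_const2) auto
  qed
  have lU: "l \<in> U"
    unfolding max_units_iff
  proof (intro conjI l_unit)
    \<comment> \<open>One fixed \<open>x N\<close> links \<open>l\<close> to
      \<open>\<omega>\<close>: its distance to \<open>l\<close> is of order \<open>sqrt t\<close>,
      and its distance to \<open>\<omega>\<close> vanishes at 0.\<close>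
    obtain N where N: "\<And>m. m \<ge> N \<Longrightarrow> udist (x N) (x m) \<le> 1" using Cauchy[of 1] by (meson less_imp_le order_refl zero_less_one)
    let ?b = "\<lambda>t. sqrt (2 * (1 * S) * t * exp (Q * t)) + hdist E t (x N t) (\<omega> t)"
    have "(?b \<longlongrightarrow> sqrt (2 * (1 * S) * 0 * exp (Q * 0)) + 0) (at_right 0)"
      using xU[of N] unfolding max_units_iff by (intro tendsto_intros) auto
    then have b: "(?b \<longlongrightarrow> 0) (at_right 0)" by simp
    have "\<forall>\<^sub>F t in at_right 0. norm (hdist E t (l t) (\<omega> t)) \<le> ?b t"
    proof (rule eventually_at_right_0I[OF zero_less_one])
      fix t :: real assume t: "0 < t"
      have "hdist E t (x N t) (l t) \<le> sqrt (2 * (1 * S) * t * exp (Q * t))"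
        by (rule real_le_rsqrt, rule hl[OF t N])
      then show "norm (hdist E t (l t) (\<omega> t)) \<le> ?b t"
        using hdist_triangle[of t "l t" "x N t" "\<omega> t"] hdist_commute[of t "l t" "x N t"] t lc xU omega_U
        by (simp add: U_closed hdist_nonneg)
    qed
    then show "((\<lambda>t. hdist E t (l t) (\<omega> t)) \<longlongrightarrow> 0) (at_right 0)" by (rule Lim_null_comparison[OF _ b])
  qed
  have lg: "G l \<omega> 1 = g" by (rule gen_omega_limit[OF xU lU ll Qw Q0 norm]) simp
  have "(\<lambda>n. udist (x n) l) \<longlonglongrightarrow> 0"
  proof (rule LIMSEQ_I)
    fix e :: real assume e: "0 < e"
    have pos: "0 < e\<^sup>2 / (2 * S + 1)" using e S0 by simp
    obtain N where N: "\<forall>m\<ge>N. \<forall>n\<ge>N. udist (x m) (x n) < e\<^sup>2 / (2 * S + 1)" using Cauchy[OF pos] by blast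
    have "norm (udist (x n) l - 0) < e" if n: "n \<ge> N" for n
    proof -
      let ?d = "e\<^sup>2 / (2 * S + 1)"
      have "udist (x n) l \<le> sqrt (2 * (?d * S))"
        by (rule udist_le[OF xU lU, where R=Q], use pos S0 in simp, rule hl[where N=N]) (use N n in \<open>auto intro: less_imp_le\<close>)
      also have "\<dots> < sqrt (e\<^sup>2)"
      proof (rule real_sqrt_less_mono)
        have "2 * (?d * S) = ?d * (2 * S)" by simp
        also have "\<dots> < ?d * (2 * S + 1)" using pos by (intro mult_strict_left_mono) auto
        also have "\<dots> = e\<^sup>2" using S0 by simp
        finally show "2 * (?d * S) < e\<^sup>2" .
      qed
      finally show ?thesis using e by simp
    qed
    then show "\<exists>N. \<forall>n\<ge>N. norm (udist (x n) l - 0) < e" by blast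
  qed
  with lU lg show ?thesis by (rule that)
qed

lemma hnorm_pert: "hnorm M (pert \<beta>) = 0"
proof -
  have "ip M (pert \<beta>) (pert \<beta>) = 0"
    unfolding ip_M using gen_pert[of "pert \<beta>" \<beta> 1] gen_pert[of \<omega> \<beta> 1] omega_U pert_closed by simp
  then show ?thesis by (simp only: hnorm_def) simp
qed

lemma udist_add_pert:
  assumes x: "x \<in> U"
  shows "udist (x \<oplus>\<^bsub>M\<^esub> pert \<beta>) x = 0"
proof -
  interpret semi_inner_bimodule M by (rule semi_inner_M)
  have p: "pert \<beta> \<in> carrier M" "x \<in> carrier M" using x pert_closed by auto
  have "(x \<oplus>\<^bsub>M\<^esub> pert \<beta>) \<ominus>\<^bsub>M\<^esub> x = pert \<beta>"
    using p by (simp add: a_minus_def a_assoc[symmetric] a_comm[of x] del: M_simps) (simp add: a_assoc r_neg del: M_simps)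
  then have "hnorm M ((x \<oplus>\<^bsub>M\<^esub> pert \<beta>) \<ominus>\<^bsub>M\<^esub> x) = 0" by (simp add: hnorm_pert)
  then show ?thesis using x pert_closed add_M_closed by (simp add: hnorm_minus_M)
qed

lemma M_complete_prescribed:
  assumes "h_Cauchy M F"
  obtains l where "l \<in> U" "G l \<omega> 1 = g" "(\<lambda>n. hnorm M (F n \<ominus>\<^bsub>M\<^esub> l)) \<longlonglongrightarrow> 0"
proof -
  have FU: "F n \<in> U" for n using assms by (simp add: h_Cauchy_def)
  \<comment> \<open>The perturbation has length zero, so distances are unchanged, while every
    \<open>G (x n) \<omega> 1\<close> becomes \<open>g\<close>; the adjoint undoes the one in
    \<open>gen_pert\<close>.\<close>
  define x where "x n = F n \<oplus>\<^bsub>M\<^esub> pert (adj (g - G (F n) \<omega> 1))" for n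
  have xU: "x n \<in> U" for n using FU by (simp add: x_def add_M_closed pert_closed)
  have norm: "G (x n) \<omega> 1 = g" for n
    using FU omega_U by (simp add: x_def gen_add_M gen_pert pert_closed adj_adj)
  have xF: "udist (x n) (F n) = 0" "udist (F n) (x n) = 0" for n
    using udist_add_pert[OF FU] udist_commute[OF FU xU] by (auto simp: x_def)
  have "\<exists>N. \<forall>m\<ge>N. \<forall>n\<ge>N. udist (x m) (x n) < e" if e: "0 < e" for e
  proof -
    obtain N where N: "\<forall>m\<ge>N. \<forall>n\<ge>N. hnorm M (F m \<ominus>\<^bsub>M\<^esub> F n) < e" using assms e unfolding h_Cauchy_def by blast
    have le: "udist (x m) (x n) \<le> udist (F m) (F n)" for m n
      using udist_triangle[OF xU[of m] FU[of m] xU[of n]] udist_triangle[OF FU[of m] FU[of n] xU[of n]] xF by simp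
    have "udist (x m) (x n) < e" if "m \<ge> N" "n \<ge> N" for m n
      using N that hnorm_minus_M[OF FU FU] by (intro le_less_trans[OF le]) simp
    then show ?thesis by blast
  qed
  from normalised_complete[of x g, OF xU norm this] obtain l where l: "l \<in> U" "G l \<omega> 1 = g" "(\<lambda>n. udist (x n) l) \<longlonglongrightarrow> 0" by metis
  have "hnorm M (F n \<ominus>\<^bsub>M\<^esub> l) = udist (x n) l" for n
    using udist_triangle[OF xU[of n] FU[of n] l(1)] udist_triangle[OF FU[of n] xU[of n] l(1)] xF FU l(1) by (simp add: hnorm_minus_M)
  then show ?thesis using l by (intro that[of l]) auto
qed

end

section \<open>Images, quotients and completions of modules\<close>

text \<open>Transporting the axioms along a surjection avoids verifying them on classes; this serves
  the quotient and the direct sum with the index.\<close>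

lemma abelian_group_image:
  assumes M: "abelian_group M" and carr: "carrier N = f ` carrier M"
    and add: "\<And>x y. x \<in> carrier M \<Longrightarrow> y \<in> carrier M \<Longrightarrow> f (x \<oplus>\<^bsub>M\<^esub> y) = f x \<oplus>\<^bsub>N\<^esub> f y"
    and zero: "\<zero>\<^bsub>N\<^esub> = f \<zero>\<^bsub>M\<^esub>"
  shows "abelian_group N"
    and "x \<in> carrier M \<Longrightarrow> \<ominus>\<^bsub>N\<^esub> f x = f (\<ominus>\<^bsub>M\<^esub> x)"
    and "x \<in> carrier M \<Longrightarrow> y \<in> carrier M \<Longrightarrow> f x \<ominus>\<^bsub>N\<^esub> f y = f (x \<ominus>\<^bsub>M\<^esub> y)"
proof -
  interpret M: abelian_group M by (rule M)
  show N: "abelian_group N"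
  proof (rule abelian_groupI)
    show "\<And>x y z. x \<in> carrier N \<Longrightarrow> y \<in> carrier N \<Longrightarrow> z \<in> carrier N \<Longrightarrow> x \<oplus>\<^bsub>N\<^esub> y \<oplus>\<^bsub>N\<^esub> z = x \<oplus>\<^bsub>N\<^esub> (y \<oplus>\<^bsub>N\<^esub> z)"
      by (auto simp: carr M.a_assoc simp flip: add)
    show "\<And>x y. x \<in> carrier N \<Longrightarrow> y \<in> carrier N \<Longrightarrow> x \<oplus>\<^bsub>N\<^esub> y = y \<oplus>\<^bsub>N\<^esub> x"
      by (auto simp: carr M.a_comm simp flip: add)
    fix x assume "x \<in> carrier N"
    then obtain a where a: "x = f a" "a \<in> carrier M" by (auto simp: carr)
    have "f (\<ominus>\<^bsub>M\<^esub> a) \<oplus>\<^bsub>N\<^esub> x = \<zero>\<^bsub>N\<^esub>" using a by (simp add: zero M.l_neg flip: add)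
    then show "\<exists>y\<in>carrier N. y \<oplus>\<^bsub>N\<^esub> x = \<zero>\<^bsub>N\<^esub>" using a by (intro bexI[of _ "f (\<ominus>\<^bsub>M\<^esub> a)"]) (auto simp: carr)
  qed (auto simp: carr zero simp flip: add)
  interpret N: abelian_group N by (rule N)
  show neg: "\<ominus>\<^bsub>N\<^esub> f x = f (\<ominus>\<^bsub>M\<^esub> x)" if "x \<in> carrier M" for x
    using that by (intro N.minus_equality) (auto simp: carr zero M.l_neg simp flip: add)
  show "f x \<ominus>\<^bsub>N\<^esub> f y = f (x \<ominus>\<^bsub>M\<^esub> y)" if "x \<in> carrier M" "y \<in> carrier M"
    using that by (simp add: a_minus_def neg add)
qed

lemma right_module_image:
  assumes "right_module M" and carr: "carrier N = f ` carrier M"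
    and add: "\<And>x y. x \<in> carrier M \<Longrightarrow> y \<in> carrier M \<Longrightarrow> f (x \<oplus>\<^bsub>M\<^esub> y) = f x \<oplus>\<^bsub>N\<^esub> f y"
    and zero: "\<zero>\<^bsub>N\<^esub> = f \<zero>\<^bsub>M\<^esub>"
    and ract: "\<And>x b. x \<in> carrier M \<Longrightarrow> f (ract M x b) = ract N (f x) b"
  shows "right_module N"
proof -
  interpret M: right_module M by (rule assms(1))
  interpret N: abelian_group N by (rule abelian_group_image(1)[OF M.abelian_group_axioms carr add zero])
  show ?thesis
    by unfold_locales
      (auto simp: carr M.ract_closed M.ract_add_left M.ract_add_right M.ract_mult M.ract_one simp flip: add ract)
qed

lemma bimodule_image:
  assumes "bimodule M" and carr: "carrier N = f ` carrier M"
    and add: "\<And>x y. x \<in> carrier M \<Longrightarrow> y \<in> carrier M \<Longrightarrow> f (x \<oplus>\<^bsub>M\<^esub> y) = f x \<oplus>\<^bsub>N\<^esub> f y"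
    and zero: "\<zero>\<^bsub>N\<^esub> = f \<zero>\<^bsub>M\<^esub>"
    and ract: "\<And>x b. x \<in> carrier M \<Longrightarrow> f (ract M x b) = ract N (f x) b"
    and lact: "\<And>x b. x \<in> carrier M \<Longrightarrow> f (lact M b x) = lact N b (f x)"
  shows "bimodule N"
proof -
  interpret M: bimodule M by (rule assms(1))
  interpret N: right_module N by (rule right_module_image[OF M.right_module_axioms carr add zero ract])
  show ?thesis
    by unfold_locales
      (auto simp: carr M.lact_closed M.lact_add_left M.lact_add_right M.lact_mult M.lact_one M.lact_ract M.lact_scalar
        M.ract_closed simp flip: add ract lact)
qed

lemma mk_bimod_simps [simp]:
  "carrier (mk_bimod A p z l r i) = A" "zero (mk_bimod A p z l r i) = z" "add (mk_bimod A p z l r i) = p"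
  "lact (mk_bimod A p z l r i) = l" "ract (mk_bimod A p z l r i) = r" "ip (mk_bimod A p z l r i) = i"
  by (simp_all add: mk_bimod_def)

text \<open>Operations on classes are unions over representatives; over a nonempty class a union of
  equal sets collapses, which leaves independence of the representative to be checked.\<close>

lemma UN_class:
  assumes "equiv A r" "a \<in> A" "\<And>x. (a, x) \<in> r \<Longrightarrow> f x = f a"
  shows "(\<Union>x\<in>r `` {a}. f x) = f a"
proof -
  have "r `` {a} \<noteq> {}" using equiv_class_self[OF assms(1,2)] by blast
  then show ?thesis by (rule SUP_eq_const) (rule assms(3), blast)
qed

lemma UN_class2:
  assumes "equiv A r" "a \<in> A" "b \<in> A" "\<And>x y. (a, x) \<in> r \<Longrightarrow> (b, y) \<in> r \<Longrightarrow> f x y = f a b"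
  shows "(\<Union>x\<in>r `` {a}. \<Union>y\<in>r `` {b}. f x y) = f a b"
proof -
  have ne: "r `` {a} \<noteq> {}" "r `` {b} \<noteq> {}"
    using equiv_class_self[OF assms(1,2)] equiv_class_self[OF assms(1,3)] by blast+
  have "(\<Union>y\<in>r `` {b}. f x y) = f a b" if "(a, x) \<in> r" for x
    by (rule SUP_eq_const[OF ne(2)]) (rule assms(4)[OF that], blast)
  then show ?thesis by (intro SUP_eq_const[OF ne(1)]) blast
qed

section \<open>The quotient by the vectors of length zero\<close>

context semi_inner_bimodule
begin

lemma minus_add_distrib:
  assumes "a \<in> carrier M" "b \<in> carrier M" "c \<in> carrier M" "d \<in> carrier M"
  shows "(a \<oplus> b) \<ominus> (c \<oplus> d) = (a \<ominus> c) \<oplus> (b \<ominus> d)"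
  using assms by (simp add: a_minus_def minus_add a_ac)

lemma hnorm_add_minus_add:
  assumes "a \<in> carrier M" "b \<in> carrier M" "c \<in> carrier M" "d \<in> carrier M"
  shows "hnorm M ((a \<oplus> b) \<ominus> (c \<oplus> d)) \<le> hnorm M (a \<ominus> c) + hnorm M (b \<ominus> d)"
  using assms by (simp add: minus_add_distrib hnorm_triangle)

lemma ract_minus:
  assumes "x \<in> carrier M" "y \<in> carrier M"
  shows "ract M x b \<ominus> ract M y b = ract M (x \<ominus> y) b"
proof -
  have "ract M (x \<ominus> y) b \<oplus> ract M y b = ract M x b"
    using assms by (simp add: minus_add_cancel flip: ract_add_left)
  then show ?thesis using assms by (metis ract_closed minus_closed minus_eq add.inv_solve_right)
qed

lemma lact_minus:
  assumes "x \<in> carrier M" "y \<in> carrier M"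
  shows "lact M b x \<ominus> lact M b y = lact M b (x \<ominus> y)"
proof -
  have "lact M b (x \<ominus> y) \<oplus> lact M b y = lact M b x"
    using assms by (simp add: minus_add_cancel flip: lact_add_right)
  then show ?thesis using assms by (metis lact_closed minus_closed minus_eq add.inv_solve_right)
qed

lemma hnorm_ract_minus:
  "x \<in> carrier M \<Longrightarrow> y \<in> carrier M \<Longrightarrow> hnorm M (ract M x b \<ominus> ract M y b) \<le> hnorm M (x \<ominus> y) * norm b"
  by (simp add: ract_minus hnorm_ract)

lemma hnorm_lact_minus:
  "x \<in> carrier M \<Longrightarrow> y \<in> carrier M \<Longrightarrow> hnorm M (lact M b x \<ominus> lact M b y) \<le> norm b * hnorm M (x \<ominus> y)"
  by (simp add: lact_minus hnorm_lact)

lemma hnorm_minus_self: "x \<in> carrier M \<Longrightarrow> hnorm M (x \<ominus> x) = 0"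
  by (simp add: a_minus_def r_neg)

lemma ip_cong:
  assumes "x \<in> carrier M" "x' \<in> carrier M" "y \<in> carrier M" "y' \<in> carrier M"
    and "hnorm M (x \<ominus> x') = 0" "hnorm M (y \<ominus> y') = 0"
  shows "ip M x y = ip M x' y'"
proof -
  have "ip M (x \<ominus> x') y = 0" using ip_cauchy_schwarz[of "x \<ominus> x'" y] assms by simp
  moreover have "ip M x' (y \<ominus> y') = 0" using ip_cauchy_schwarz[of x' "y \<ominus> y'"] assms by simp
  ultimately show ?thesis using assms by (simp add: ip_minus_left ip_minus_right)
qed

end

text \<open>The construction of \<open>length_quotient\<close> is for records without extension.\<close>

locale semi_inner_bimodule_plain = semi_inner_bimodule M for M :: "('b::unital_cstar_algebra, 'm) hilb_bimod" (structure)
begin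

definition cls where "cls x = length_zero_rel M `` {x}"

lemma length_zero_rel_iff: "(x, y) \<in> length_zero_rel M \<longleftrightarrow> x \<in> carrier M \<and> y \<in> carrier M \<and> hnorm M (x \<ominus> y) = 0"
  by (auto simp: length_zero_rel_def length_zero_def hnorm_def)

lemma equiv_length_zero_rel: "equiv (carrier M) (length_zero_rel M)"
proof (rule equivI)
  show "length_zero_rel M \<subseteq> carrier M \<times> carrier M" by (auto simp: length_zero_rel_iff)
  show "refl_on (carrier M) (length_zero_rel M)"
    by (auto simp: refl_on_def length_zero_rel_iff hnorm_minus_self)
  show "sym (length_zero_rel M)" by (auto simp: sym_def length_zero_rel_iff hnorm_minus_commute)
  show "trans (length_zero_rel M)"
  proof (rule transI)
    fix x y z assume "(x, y) \<in> length_zero_rel M" "(y, z) \<in> length_zero_rel M"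
    then show "(x, z) \<in> length_zero_rel M"
      using hnorm_minus_triangle[of x y z] hnorm_nonneg[of M "x \<ominus> z"] by (auto simp: length_zero_rel_iff)
  qed
qed

lemma cls_eqI: "x \<in> carrier M \<Longrightarrow> y \<in> carrier M \<Longrightarrow> hnorm M (x \<ominus> y) = 0 \<Longrightarrow> cls x = cls y"
  unfolding cls_def by (rule equiv_class_eq[OF equiv_length_zero_rel]) (simp add: length_zero_rel_iff)

lemma quotient_carrier: "carrier (length_quotient M) = cls ` carrier M"
  by (auto simp: length_quotient_def quotient_def cls_def)

lemma quotient_zero: "\<zero>\<^bsub>length_quotient M\<^esub> = cls \<zero>"
  by (simp add: length_quotient_def cls_def)

lemma quotient_add:
  assumes "x \<in> carrier M" "y \<in> carrier M"
  shows "cls (x \<oplus> y) = cls x \<oplus>\<^bsub>length_quotient M\<^esub> cls y"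
proof -
  have "(\<Union>u\<in>length_zero_rel M `` {x}. \<Union>v\<in>length_zero_rel M `` {y}. cls (u \<oplus> v)) = cls (x \<oplus> y)"
  proof (rule UN_class2[OF equiv_length_zero_rel assms])
    fix u v assume "(x, u) \<in> length_zero_rel M" "(y, v) \<in> length_zero_rel M"
    then show "cls (u \<oplus> v) = cls (x \<oplus> y)"
      using hnorm_add_minus_add[of u v x y] hnorm_minus_commute[of u x] hnorm_minus_commute[of v y]
        hnorm_nonneg[of M "(u \<oplus> v) \<ominus> (x \<oplus> y)"]
      by (intro cls_eqI) (auto simp: length_zero_rel_iff)
  qed
  then show ?thesis by (simp add: length_quotient_def cls_def)
qed

lemma quotient_ract:
  assumes "x \<in> carrier M"
  shows "cls (ract M x b) = ract (length_quotient M) (cls x) b"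
proof -
  have "(\<Union>u\<in>length_zero_rel M `` {x}. cls (ract M u b)) = cls (ract M x b)"
  proof (rule UN_class[OF equiv_length_zero_rel assms])
    fix u assume "(x, u) \<in> length_zero_rel M"
    then show "cls (ract M u b) = cls (ract M x b)"
      using hnorm_ract_minus[of u x b] hnorm_minus_commute[of u x] hnorm_nonneg[of M "ract M u b \<ominus> ract M x b"]
      by (intro cls_eqI) (auto simp: length_zero_rel_iff ract_closed)
  qed
  then show ?thesis by (simp add: length_quotient_def cls_def)
qed

lemma quotient_lact:
  assumes "x \<in> carrier M"
  shows "cls (lact M b x) = lact (length_quotient M) b (cls x)"
proof -
  have "(\<Union>u\<in>length_zero_rel M `` {x}. cls (lact M b u)) = cls (lact M b x)"
  proof (rule UN_class[OF equiv_length_zero_rel assms])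
    fix u assume "(x, u) \<in> length_zero_rel M"
    then show "cls (lact M b u) = cls (lact M b x)"
      using hnorm_lact_minus[of u x b] hnorm_minus_commute[of u x] hnorm_nonneg[of M "lact M b u \<ominus> lact M b x"]
      by (intro cls_eqI) (auto simp: length_zero_rel_iff lact_closed)
  qed
  then show ?thesis by (simp add: length_quotient_def cls_def)
qed

lemma quotient_ip:
  assumes "x \<in> carrier M" "y \<in> carrier M"
  shows "ip (length_quotient M) (cls x) (cls y) = ip M x y"
proof -
  have "(\<Union>u\<in>length_zero_rel M `` {x}. \<Union>v\<in>length_zero_rel M `` {y}. {ip M u v}) = {ip M x y}"
  proof (rule UN_class2[OF equiv_length_zero_rel assms])
    fix u v assume "(x, u) \<in> length_zero_rel M" "(y, v) \<in> length_zero_rel M"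
    then show "{ip M u v} = {ip M x y}"
      using ip_cong[of u x v y] hnorm_minus_commute[of u x] hnorm_minus_commute[of v y] by (simp add: length_zero_rel_iff)
  qed
  then show ?thesis by (simp add: length_quotient_def cls_def)
qed

lemma quotient_hnorm: "x \<in> carrier M \<Longrightarrow> hnorm (length_quotient M) (cls x) = hnorm M x"
  by (simp add: hnorm_def quotient_ip)

lemma quotient_minus:
  "x \<in> carrier M \<Longrightarrow> y \<in> carrier M \<Longrightarrow> cls x \<ominus>\<^bsub>length_quotient M\<^esub> cls y = cls (x \<ominus> y)"
  by (rule abelian_group_image(3)[OF abelian_group_axioms quotient_carrier quotient_add quotient_zero])

text \<open>Places the quotient in the same locale as \<open>M\<close>, so that the facts about
  Cauchy sequences below can be instantiated with it.\<close>

lemma semi_inner_quotient: "semi_inner_bimodule_plain (length_quotient M)"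
proof -
  interpret Q: bimodule "length_quotient M"
    by (rule bimodule_image[OF bimodule_axioms quotient_carrier quotient_add quotient_zero quotient_ract quotient_lact])
  have "sesquilinear_bimodule_axioms (length_quotient M)"
    by unfold_locales
      (auto simp: quotient_carrier quotient_ip ip_add_right ip_ract ract_closed simp flip: quotient_add quotient_ract intro: ip_adj)
  then have "sesquilinear_bimodule (length_quotient M)" using Q.bimodule_axioms by (simp add: sesquilinear_bimodule_def)
  moreover have "semi_inner_bimodule_axioms (length_quotient M)"
    by unfold_locales
      (auto simp: quotient_carrier quotient_ip quotient_hnorm ip_cauchy_schwarz hnorm_lact lact_closed simp flip: quotient_lact)
  ultimately show ?thesis by (simp add: semi_inner_bimodule_plain_def semi_inner_bimodule_def)
qed

section \<open>Cauchy sequences modulo null sequences\<close>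

definition ccls where "ccls F = null_sequence_rel M `` {F}"

lemma h_Cauchy_closed: "h_Cauchy M F \<Longrightarrow> F n \<in> carrier M"
  by (simp add: h_Cauchy_def)

lemma equiv_null_sequence_rel: "equiv (Collect (h_Cauchy M)) (null_sequence_rel M)"
proof (rule equivI)
  show "null_sequence_rel M \<subseteq> Collect (h_Cauchy M) \<times> Collect (h_Cauchy M)" by (auto simp: null_sequence_rel_def)
  show "refl_on (Collect (h_Cauchy M)) (null_sequence_rel M)"
    by (auto simp: refl_on_def null_sequence_rel_def hnorm_minus_self h_Cauchy_closed)
  show "sym (null_sequence_rel M)"
    by (auto simp: sym_def null_sequence_rel_def hnorm_minus_commute[OF h_Cauchy_closed h_Cauchy_closed])
  show "trans (null_sequence_rel M)"
  proof (rule transI)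
    fix F G H assume FG: "(F, G) \<in> null_sequence_rel M" "(G, H) \<in> null_sequence_rel M"
    then have lim: "(\<lambda>n. hnorm M (F n \<ominus> G n) + hnorm M (G n \<ominus> H n)) \<longlonglongrightarrow> 0 + 0"
      by (intro tendsto_add) (auto simp: null_sequence_rel_def)
    have c: "h_Cauchy M F" "h_Cauchy M G" "h_Cauchy M H" using FG by (auto simp: null_sequence_rel_def)
    have "(\<lambda>n. hnorm M (F n \<ominus> H n)) \<longlonglongrightarrow> 0"
    proof (rule Lim_null_comparison[OF always_eventually])
      show "\<forall>n. norm (hnorm M (F n \<ominus> H n)) \<le> hnorm M (F n \<ominus> G n) + hnorm M (G n \<ominus> H n)"
        using c by (auto intro: hnorm_minus_triangle h_Cauchy_closed)
    qed (use lim in simp)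
    then show "(F, H) \<in> null_sequence_rel M" using c by (simp add: null_sequence_rel_def)
  qed
qed

lemma ccls_eqI:
  "h_Cauchy M F \<Longrightarrow> h_Cauchy M G \<Longrightarrow> (\<lambda>n. hnorm M (F n \<ominus> G n)) \<longlonglongrightarrow> 0 \<Longrightarrow> ccls F = ccls G"
  unfolding ccls_def by (rule equiv_class_eq[OF equiv_null_sequence_rel]) (simp add: null_sequence_rel_def)

lemma ccls_eqD: "h_Cauchy M G \<Longrightarrow> ccls F = ccls G \<Longrightarrow> (\<lambda>n. hnorm M (F n \<ominus> G n)) \<longlonglongrightarrow> 0"
  unfolding ccls_def
  by (drule eq_equiv_class[OF _ equiv_null_sequence_rel]) (auto simp: null_sequence_rel_def)

lemma h_Cauchy_const: "x \<in> carrier M \<Longrightarrow> h_Cauchy M (\<lambda>n. x)"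
  by (simp add: h_Cauchy_def hnorm_minus_self)

lemma h_Cauchy_transfer:
  assumes F: "h_Cauchy M F" and H: "\<And>n. H n \<in> carrier M" and "0 \<le> K"
    and le: "\<And>m n. hnorm M (H m \<ominus> H n) \<le> K * hnorm M (F m \<ominus> F n)"
  shows "h_Cauchy M H"
  unfolding h_Cauchy_def
proof (intro conjI allI impI H)
  fix e :: real assume e: "0 < e"
  have "0 < e / (K + 1)" using e assms(3) by simp
  then obtain N where N: "\<forall>m\<ge>N. \<forall>n\<ge>N. hnorm M (F m \<ominus> F n) < e / (K + 1)" using F unfolding h_Cauchy_def by blast
  have "hnorm M (H m \<ominus> H n) < e" if "m \<ge> N" "n \<ge> N" for m n
  proof -
    have "hnorm M (H m \<ominus> H n) \<le> (K + 1) * hnorm M (F m \<ominus> F n)"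
      by (rule order_trans[OF le]) (intro mult_right_mono, auto)
    also have "\<dots> < (K + 1) * (e / (K + 1))" using N that assms(3) by (intro mult_strict_left_mono) auto
    also have "\<dots> = e" using assms(3) by simp
    finally show ?thesis .
  qed
  then show "\<exists>N. \<forall>m\<ge>N. \<forall>n\<ge>N. hnorm M (H m \<ominus> H n) < e" by blast
qed

lemma h_Cauchy_add:
  assumes F: "h_Cauchy M F" and G: "h_Cauchy M G"
  shows "h_Cauchy M (\<lambda>n. F n \<oplus> G n)"
  unfolding h_Cauchy_def
proof (intro conjI allI impI)
  show "F n \<oplus> G n \<in> carrier M" for n using F G by (simp add: h_Cauchy_closed)
  fix e :: real assume "0 < e"
  then have e: "0 < e / 2" by simp
  obtain N where N: "\<forall>m\<ge>N. \<forall>n\<ge>N. hnorm M (F m \<ominus> F n) < e / 2" using F e unfolding h_Cauchy_def by blast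
  obtain N' where N': "\<forall>m\<ge>N'. \<forall>n\<ge>N'. hnorm M (G m \<ominus> G n) < e / 2" using G e unfolding h_Cauchy_def by blast
  have "hnorm M ((F m \<oplus> G m) \<ominus> (F n \<oplus> G n)) < e" if "m \<ge> max N N'" "n \<ge> max N N'" for m n
  proof -
    have "hnorm M (F m \<ominus> F n) < e / 2" "hnorm M (G m \<ominus> G n) < e / 2" using N N' that by auto
    then show ?thesis using hnorm_add_minus_add[of "F m" "G m" "F n" "G n"] F G by (simp add: h_Cauchy_closed)
  qed
  then show "\<exists>N. \<forall>m\<ge>N. \<forall>n\<ge>N. hnorm M ((F m \<oplus> G m) \<ominus> (F n \<oplus> G n)) < e" by blast
qed

lemma completion_carrier: "carrier (completion M) = ccls ` Collect (h_Cauchy M)"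
  by (auto simp: completion_def quotient_def ccls_def)

lemma completion_zero: "\<zero>\<^bsub>completion M\<^esub> = ccls (\<lambda>n. \<zero>)"
  by (simp add: completion_def ccls_def)

lemma completion_add:
  assumes F: "h_Cauchy M F" and G: "h_Cauchy M G"
  shows "ccls (\<lambda>n. F n \<oplus> G n) = ccls F \<oplus>\<^bsub>completion M\<^esub> ccls G"
proof -
  have "(\<Union>f\<in>null_sequence_rel M `` {F}. \<Union>g\<in>null_sequence_rel M `` {G}. ccls (\<lambda>n. f n \<oplus> g n)) = ccls (\<lambda>n. F n \<oplus> G n)"
  proof (rule UN_class2[OF equiv_null_sequence_rel])
    fix f g assume fg: "(F, f) \<in> null_sequence_rel M" "(G, g) \<in> null_sequence_rel M"
    then have c: "h_Cauchy M f" "h_Cauchy M g" by (auto simp: null_sequence_rel_def)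
    have lim: "(\<lambda>n. hnorm M (F n \<ominus> f n) + hnorm M (G n \<ominus> g n)) \<longlonglongrightarrow> 0 + 0"
      using fg by (intro tendsto_add) (auto simp: null_sequence_rel_def)
    have "(\<lambda>n. hnorm M ((F n \<oplus> G n) \<ominus> (f n \<oplus> g n))) \<longlonglongrightarrow> 0"
    proof (rule Lim_null_comparison[OF always_eventually])
      show "\<forall>n. norm (hnorm M ((F n \<oplus> G n) \<ominus> (f n \<oplus> g n))) \<le> hnorm M (F n \<ominus> f n) + hnorm M (G n \<ominus> g n)"
        using F G c by (auto intro: hnorm_add_minus_add h_Cauchy_closed)
    qed (use lim in simp)
    then show "ccls (\<lambda>n. f n \<oplus> g n) = ccls (\<lambda>n. F n \<oplus> G n)"
      using F G c by (intro ccls_eqI[symmetric] h_Cauchy_add)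
  qed (use F G in auto)
  then show ?thesis by (simp add: completion_def ccls_def)
qed

text \<open>Both actions are Lipschitz for the length and operate term by term on sequences, so
  independence of representatives is proved once for such maps.\<close>

lemma completion_op:
  assumes F: "h_Cauchy M F" and op: "\<And>x. x \<in> carrier M \<Longrightarrow> op x \<in> carrier M" and K: "0 \<le> K"
    and le: "\<And>x y. x \<in> carrier M \<Longrightarrow> y \<in> carrier M \<Longrightarrow> hnorm M (op x \<ominus> op y) \<le> K * hnorm M (x \<ominus> y)"
  shows "(\<Union>f\<in>null_sequence_rel M `` {F}. ccls (\<lambda>n. op (f n))) = ccls (\<lambda>n. op (F n))"
proof (rule UN_class[OF equiv_null_sequence_rel])
  fix f assume f: "(F, f) \<in> null_sequence_rel M"
  then have c: "h_Cauchy M f" and lim: "(\<lambda>n. hnorm M (F n \<ominus> f n)) \<longlonglongrightarrow> 0" by (auto simp: null_sequence_rel_def)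
  have C: "h_Cauchy M (\<lambda>n. op (H n))" if "h_Cauchy M H" for H
    using that by (intro h_Cauchy_transfer[OF that op K le] h_Cauchy_closed)
  have "(\<lambda>n. hnorm M (op (F n) \<ominus> op (f n))) \<longlonglongrightarrow> 0"
  proof (rule Lim_null_comparison[OF always_eventually])
    show "\<forall>n. norm (hnorm M (op (F n) \<ominus> op (f n))) \<le> K * hnorm M (F n \<ominus> f n)"
      using F c by (auto intro: le h_Cauchy_closed)
    show "(\<lambda>n. K * hnorm M (F n \<ominus> f n)) \<longlonglongrightarrow> 0" by (rule tendsto_mult_right_zero[OF lim])
  qed
  then show "ccls (\<lambda>n. op (f n)) = ccls (\<lambda>n. op (F n))"
    using F c by (intro ccls_eqI[symmetric] C)
qed (use F in simp)

lemma completion_ract: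
  assumes "h_Cauchy M F"
  shows "ccls (\<lambda>n. ract M (F n) b) = ract (completion M) (ccls F) b"
  using completion_op[OF assms, of "\<lambda>x. ract M x b" "norm b"] hnorm_ract_minus
  by (simp add: completion_def ccls_def ract_closed mult.commute)

lemma completion_lact:
  assumes "h_Cauchy M F"
  shows "ccls (\<lambda>n. lact M b (F n)) = lact (completion M) b (ccls F)"
  using completion_op[OF assms, of "\<lambda>x. lact M b x" "norm b"] hnorm_lact_minus
  by (simp add: completion_def ccls_def lact_closed)

end

section \<open>The map of a module into the completion of its quotient\<close>

context semi_inner_bimodule_plain
begin

interpretation Q: semi_inner_bimodule_plain "length_quotient M" by (rule semi_inner_quotient)

definition emb where "emb x = Q.ccls (\<lambda>n. cls x)"

lemma cls_closed: "x \<in> carrier M \<Longrightarrow> cls x \<in> carrier (length_quotient M)"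
  by (simp add: quotient_carrier)

lemma emb_closed: "x \<in> carrier M \<Longrightarrow> emb x \<in> carrier (completion (length_quotient M))"
  by (simp add: emb_def Q.completion_carrier Q.h_Cauchy_const cls_closed)

lemma emb_zero: "\<zero>\<^bsub>completion (length_quotient M)\<^esub> = emb \<zero>"
  by (simp add: emb_def Q.completion_zero quotient_zero)

lemma emb_add:
  "x \<in> carrier M \<Longrightarrow> y \<in> carrier M \<Longrightarrow> emb (x \<oplus> y) = emb x \<oplus>\<^bsub>completion (length_quotient M)\<^esub> emb y"
  by (simp add: emb_def quotient_add Q.h_Cauchy_const cls_closed flip: Q.completion_add)

lemma emb_ract: "x \<in> carrier M \<Longrightarrow> emb (ract M x b) = ract (completion (length_quotient M)) (emb x) b"
  by (simp add: emb_def quotient_ract Q.h_Cauchy_const cls_closed flip: Q.completion_ract)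

lemma emb_lact: "x \<in> carrier M \<Longrightarrow> emb (lact M b x) = lact (completion (length_quotient M)) b (emb x)"
  by (simp add: emb_def quotient_lact Q.h_Cauchy_const cls_closed flip: Q.completion_lact)

lemma emb_eqD:
  assumes "x \<in> carrier M" "y \<in> carrier M" "emb x = emb y"
  shows "hnorm M (x \<ominus> y) = 0"
proof -
  have "(\<lambda>n::nat. hnorm (length_quotient M) (cls x \<ominus>\<^bsub>length_quotient M\<^esub> cls y)) \<longlonglongrightarrow> 0"
    using assms by (intro Q.ccls_eqD) (auto simp: emb_def Q.h_Cauchy_const cls_closed)
  then show ?thesis using assms by (simp add: quotient_minus quotient_hnorm LIMSEQ_const_iff)
qed

text \<open>A sequence of classes is lifted term by term; lengths are unchanged, so the lift is
  Cauchy. This reduces surjectivity of \<open>emb\<close> to convergence of Cauchy sequences in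
  \<open>M\<close> itself.\<close>

lemma emb_representative:
  assumes "X \<in> carrier (completion (length_quotient M))"
  obtains F where "h_Cauchy M F" "\<And>l. l \<in> carrier M \<Longrightarrow> (\<lambda>n. hnorm M (F n \<ominus> l)) \<longlonglongrightarrow> 0 \<Longrightarrow> emb l = X"
proof -
  obtain H where H: "h_Cauchy (length_quotient M) H" "X = Q.ccls H" using assms by (auto simp: Q.completion_carrier)
  have "\<exists>x. x \<in> carrier M \<and> H n = cls x" for n using Q.h_Cauchy_closed[OF H(1), of n] by (auto simp: quotient_carrier)
  then obtain F where F: "\<And>n. F n \<in> carrier M" "\<And>n. H n = cls (F n)" by metis
  have d: "hnorm (length_quotient M) (cls x \<ominus>\<^bsub>length_quotient M\<^esub> cls y) = hnorm M (x \<ominus> y)"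
    if "x \<in> carrier M" "y \<in> carrier M" for x y using that by (simp add: quotient_minus quotient_hnorm)
  have "h_Cauchy M F" using H(1) F d by (simp add: h_Cauchy_def)
  moreover have "emb l = X" if l: "l \<in> carrier M" "(\<lambda>n. hnorm M (F n \<ominus> l)) \<longlonglongrightarrow> 0" for l
  proof -
    have "(\<lambda>n. hnorm (length_quotient M) (H n \<ominus>\<^bsub>length_quotient M\<^esub> cls l)) \<longlonglongrightarrow> 0" using l F d by simp
    then have "Q.ccls H = Q.ccls (\<lambda>n. cls l)" using l H(1) by (intro Q.ccls_eqI) (auto simp: Q.h_Cauchy_const cls_closed)
    then show ?thesis by (simp add: emb_def H(2))
  qed
  ultimately show ?thesis by (rule that)
qed

end

section \<open>The splitting\<close>

context product_system_unit
begin

interpretation S: semi_inner_bimodule_plain M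
  by (simp add: semi_inner_bimodule_plain_def semi_inner_M)

text \<open>The adjoint converts the factor \<open>adj b\<close> that the right action puts on the
  left of generators into \<open>b\<close> on the right.\<close>

definition drift :: "(real \<Rightarrow> 'e) \<Rightarrow> 'b" where
  "drift x = adj (G x \<omega> 1 - G \<omega> \<omega> 1)"

definition splitting where "splitting x = (S.emb x, drift x)"

abbreviation D where "D \<equiv> direct_sum (ind E \<omega>) (base_bimod :: ('b, 'b) hilb_bimod)"

lemma drift_eq_iff: "drift x = drift y \<longleftrightarrow> G x \<omega> 1 = G y \<omega> 1"
proof
  assume "drift x = drift y"
  then have "adj (drift x) = adj (drift y)" by simp
  then show "G x \<omega> 1 = G y \<omega> 1" by (simp add: drift_def adj_adj)
qed (simp add: drift_def)

lemma splitting_bij: "bij_betw splitting (carrier M) (carrier D)"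
  unfolding bij_betw_def
proof
  show "inj_on splitting (carrier M)"
  proof (rule inj_onI)
    fix x y assume xy: "x \<in> carrier M" "y \<in> carrier M" "splitting x = splitting y"
    then have "hnorm M (x \<ominus>\<^bsub>M\<^esub> y) = 0" by (intro S.emb_eqD) (auto simp: splitting_def)
    then show "x = y"
      using xy by (intro eq_if_udist_0) (auto simp: hnorm_minus_M splitting_def drift_eq_iff)
  qed
  show "splitting ` carrier M = carrier D"
  proof
    show "splitting ` carrier M \<subseteq> carrier D"
      using S.emb_closed by (auto simp: splitting_def direct_sum_def base_bimod_def ind_def)
    show "carrier D \<subseteq> splitting ` carrier M"
    proof
      fix p assume "p \<in> carrier D"
      then obtain X b where p: "p = (X, b)" "X \<in> carrier (completion (length_quotient M))"
        by (auto simp: direct_sum_def ind_def)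
      from p(2) obtain F where F: "h_Cauchy M F" "\<And>l. l \<in> carrier M \<Longrightarrow> (\<lambda>n. hnorm M (F n \<ominus>\<^bsub>M\<^esub> l)) \<longlonglongrightarrow> 0 \<Longrightarrow> S.emb l = X"
        by (rule S.emb_representative) blast
      obtain l where l: "l \<in> U" "G l \<omega> 1 = G \<omega> \<omega> 1 + adj b" "(\<lambda>n. hnorm M (F n \<ominus>\<^bsub>M\<^esub> l)) \<longlonglongrightarrow> 0"
        by (rule M_complete_prescribed[OF F(1)])
      then have "splitting l = p" using F(2)[of l] by (simp add: splitting_def drift_def p adj_adj)
      then show "p \<in> splitting ` carrier M" using l(1) by auto
    qed
  qed
qed

lemma splitting_add: "x \<in> carrier M \<Longrightarrow> y \<in> carrier M \<Longrightarrow> splitting (x \<oplus>\<^bsub>M\<^esub> y) = splitting x \<oplus>\<^bsub>D\<^esub> splitting y"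
  using omega_U S.emb_add[of x y]
  by (simp add: splitting_def direct_sum_def base_bimod_def ind_def drift_def gen_add_M adj_add adj_diff)

lemma splitting_ract: "x \<in> carrier M \<Longrightarrow> splitting (ract M x b) = ract D (splitting x) b"
  using omega_U S.emb_ract[of x b]
  by (simp add: splitting_def direct_sum_def base_bimod_def ind_def drift_def gen_ract_M adj_diff adj_add adj_mult adj_adj left_diff_distrib)

lemma splitting_zero: "\<zero>\<^bsub>D\<^esub> = splitting \<zero>\<^bsub>M\<^esub>"
  using S.emb_zero by (simp add: splitting_def direct_sum_def base_bimod_def ind_def drift_def)

lemma splitting_lact:
  assumes central: "central E \<omega>" and x: "x \<in> carrier M"
  shows "splitting (lact M b x) = lact D b (splitting x)"
proof -
  \<comment> \<open>As \<open>\<omega>\<close> commutes with \<open>c\<close>, right linearity of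
    the fibre inner product takes \<open>c\<close> out of every kernel against
    \<open>\<omega>\<close>; so the \<open>adj b\<close> that the left action puts inside the
    generator can be moved out.\<close>
  have fo: "G y \<omega> c = G y \<omega> 1 * c" if y: "y \<in> U" for y c
  proof -
    have "((\<lambda>s. (1 / s) *\<^sub>R (mel E s (y s) (\<omega> s) 1 - 1) * c) \<longlongrightarrow> G y \<omega> 1 * c) (at_right 0)"
      using y omega_U by (intro tendsto_intros mel_gen_tendsto)
    moreover have "\<forall>\<^sub>F s in at_right 0. (1 / s) *\<^sub>R (mel E s (y s) (\<omega> s) 1 - 1) * c = (1 / s) *\<^sub>R (mel E s (y s) (\<omega> s) c - c)"
    proof (rule eventually_at_right_0I[OF zero_less_one])
      fix s :: real assume s: "0 < s"
      interpret F: pre_hilbert_bimodule "fibre E s" by (rule pre) (use s in simp)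
      have "lact (fibre E s) c (\<omega> s) = ract (fibre E s) (\<omega> s) c" using central s by (simp add: central_def)
      then have "mel E s (y s) (\<omega> s) c = mel E s (y s) (\<omega> s) 1 * c"
        using s y omega_U by (simp add: mel_def F.ip_ract F.lact_one U_closed)
      then show "(1 / s) *\<^sub>R (mel E s (y s) (\<omega> s) 1 - 1) * c = (1 / s) *\<^sub>R (mel E s (y s) (\<omega> s) c - c)"
        by (simp add: left_diff_distrib)
    qed
    ultimately have "((\<lambda>s. (1 / s) *\<^sub>R (mel E s (y s) (\<omega> s) c - c)) \<longlongrightarrow> G y \<omega> 1 * c) (at_right 0)"
      by (rule Lim_transform_eventually)
    with mel_gen_tendsto[OF y omega_U, of c] show ?thesis by (rule tendsto_unique[OF trivial_limit_at_right_real])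
  qed
  have "drift (lact M b x) = b * drift x"
  proof -
    have "G (lact M b x) \<omega> 1 - G \<omega> \<omega> 1 = (G x \<omega> 1 - G \<omega> \<omega> 1) * adj b"
      using x omega_U fo[of x "adj b"] fo[of \<omega> "1 - adj b"] by (simp add: gen_lact_M algebra_simps)
    then show ?thesis by (simp add: drift_def adj_mult adj_adj)
  qed
  then show ?thesis using x S.emb_lact[of x b] by (simp add: splitting_def direct_sum_def base_bimod_def ind_def)
qed

text \<open>That the direct sum with the completed quotient is a right module is read off from its
  being the image of the module of units under \<open>splitting\<close>.\<close>

lemma right_module_isomorphic_M: "right_module_isomorphic M D"
proof -
  have M: "right_module M" using bimodule_M by (simp add: bimodule_def)
  have "carrier D = splitting ` carrier M" using splitting_bij by (simp add: bij_betw_def)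
  from right_module_image[where f=splitting and M=M and N=D, OF M this splitting_add splitting_zero splitting_ract]
  show ?thesis
    unfolding right_module_isomorphic_def
    using M splitting_bij splitting_add splitting_ract by blast
qed

lemma bimodule_isomorphic_M:
  assumes "central E \<omega>"
  shows "bimodule_isomorphic M D"
proof -
  have "carrier D = splitting ` carrier M" using splitting_bij by (simp add: bij_betw_def)
  from bimodule_image[where f=splitting and M=M and N=D, OF bimodule_M this splitting_add splitting_zero splitting_ract splitting_lact[OF assms]]
  show ?thesis
    unfolding bimodule_isomorphic_def
    using bimodule_M splitting_bij splitting_add splitting_ract splitting_lact[OF assms] by blast
qed

end

theorem proposition5p7:
  fixes E :: "('b::unital_cstar_algebra, 'e) prodsys" and \<omega> :: "real \<Rightarrow> 'e"
  assumes "product_system E"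
    and "subspatial TYPE('f) E"
    and "continuous_units E {\<omega>}"
    and "spatial E \<Longrightarrow> central E \<omega>"
  shows "right_module_isomorphic (unit_module E \<omega>) (direct_sum (ind E \<omega>) base_bimod) \<and>
    (spatial E \<longrightarrow>
      bimodule_isomorphic (unit_module E \<omega>) (direct_sum (ind E \<omega>) base_bimod))"
proof -
  interpret product_system_unit E \<omega>
    using assms(1,3) by (simp add: product_system_unit_def product_system_unit_axioms_def)
  show ?thesis using right_module_isomorphic_M bimodule_isomorphic_M assms(4) by blast
qed

end
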